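(* Let $(\mathcal{M},\tau)$ be a tracial $W^*$-probability space. Let $\mathbf{X}_1,\dots,\mathbf{X}_{n+1}$ be random self-adjoint multi-variables in $(\mathcal{M},\tau)$ and let $\mathbf{v}=(v_1,\dots,v_n)$ be an $n$-tuple of unitaries in $\mathcal{M}$. Assume that $\mathbf{X}:=\mathbf{X}_1\sqcup\cdots\sqcup\mathbf{X}_{n+1}$ has f.d.a. (equivalently, $W^*(\mathbf{X})$ is $R^\omega$-embeddable) and that $\mathbf{X}$ and $\mathbf{v}$ are freely independent. Then $$ \begin{aligned} \chi_{\mathrm{orb}}(v_1\mathbf{X}_1v_1^*,\dots,v_n\mathbf{X}_nv_n^*,\mathbf{X}_{n+1}) &\geq \chi_{\mathrm{orb}}(v_1\mathbf{X}_1v_1^*,\dots,v_n\mathbf{X}_nv_n^*,\mathbf{X}_{n+1}:\mathbf{v})\\ &\geq \chi_{\mathrm{orb}}(v_1\mathbf{X}v_1^*,\dots,v_n\mathbf{X}v_n^*,\mathbf{X}:\mathbf{v})\\ &\geq \chi_u(\mathbf{v}). \end{aligned} $$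
   Context: A tracial $W^*$-probability space $(\mathcal{M},\tau)$ is a finite von Neumann algebra $\mathcal{M}$ with a faithful normal tracial state $\tau$. A random self-adjoint multi-variable in $(\mathcal{M},\tau)$ is a finite tuple $\mathbf{X}=(X_1,\dots,X_r)$ of self-adjoint elements of $\mathcal{M}$; $\sqcup$ denotes concatenation of tuples; for a unitary $v$, $v\mathbf{X}v^*:=(vX_1v^*,\dots,vX_rv^* )$ (and likewise for tuples of matrices); $W^*(\mathbf{X})$ is the von Neumann subalgebra generated by $\mathbf{X}$. "$\mathbf{X}$ and $\mathbf{v}$ are freely independent" means that the $*$-algebras generated by $\mathbf{X}$ and by $\{v_1,\dots,v_n\}$ are freely independent with respect to $\tau$ (no freeness among $v_1,\dots,v_n$ is assumed). $M_N(\mathbb{C})^{\mathrm{sa}}$ is the set of $N\times N$ self-adjoint matrices, $(M_N(\mathbb{C})^{\mathrm{sa}})_R$ its subset of matrices of operator norm at most $R$, $\mathrm{tr}_N$ the normalized trace, $\mathrm{U}(N)$ the $N\times N$ unitary group, $\gamma_{\mathrm{U}(N)}$ its Haar probability measure. Convention: $\log 0=-\infty$, and the supremum over the empty set is $-\infty$. Microstates: for a multi-variable $\mathbf{X}=(X_1,\dots,X_r)$, $\Gamma_R(\mathbf{X};N,m,\delta)$ is the set of $\mathbf{A}\in((M_N(\mathbb{C})^{\mathrm{sa}})_R)^r$ with $|\mathrm{tr}_N(h(\mathbf{A}))-\tau(h(\mathbf{X}))|<\delta$ for all $*$-monomials $h$ in $r$ indeterminates of degree at most $m$. $\mathbf{X}$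 has f.d.a. (finite-dimensional approximants) if for every $R>\max_j\|X_j\|_\infty$, $m\in\mathbb{N}$ and $\delta>0$ one has $\Gamma_R(\mathbf{X};N,m,\delta)\neq\emptyset$ for all sufficiently large $N$; equivalently, $W^*(\mathbf{X})$ embeds trace-preservingly in an ultrapower $R^\omega$ of the hyperfinite II$_1$ factor. Orbital free entropy: let $\mathbf{Y}_i=(Y_{i1},\dots,Y_{ir(i)})$, $1\le i\le k$, be random self-adjoint multi-variables in $(\mathcal{M},\tau)$. For $\mathbf{A}_i\in(M_N(\mathbb{C})^{\mathrm{sa}})^{r(i)}$, $m\in\mathbb{N}$, $\delta>0$, let $\Gamma_{\mathrm{orb}}(\mathbf{Y}_1,\dots,\mathbf{Y}_k:(\mathbf{A}_i)_{i=1}^k;N,m,\delta)$ be the set of all $(U_i)_{i=1}^k\in\mathrm{U}(N)^k$ such that $$|\mathrm{tr}_N(h((U_i\mathbf{A}_iU_i^* )_{i=1}^k))-\tau(h((\mathbf{Y}_i)_{i=1}^k))|<\delta$$ for all $*$-monomials $h$ in $r(1)+\cdots+r(k)$ indeterminates of degree at most $m$. Set $$\bar\chi_{\mathrm{orb},R}(\mathbf{Y}_1,\dots,\mathbf{Y}_k;N,m,\delta):=\sup_{\mathbf{A}_i\in((M_N(\mathbb{C})^{\mathrm{sa}})_R)^{r(i)}}\log\gamma_{\mathrm{U}(N)}^{\otimes k}\big(\Gamma_{\mathrm{orb}}(\mathbf{Y}_1,\dots,\mathbf{Y}_k:(\mathbf{A}_i)_{i=1}^k;N,m,\delta)\big),$$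 $$\chi_{\mathrm{orb},R}(\mathbf{Y}_1,\dots,\mathbf{Y}_k):=\lim_{m\to\infty,\,\delta\searrow0}\limsup_{N\to\infty}\frac1{N^2}\bar\chi_{\mathrm{orb},R}(\mathbf{Y}_1,\dots,\mathbf{Y}_k;N,m,\delta),$$ and $\chi_{\mathrm{orb}}(\mathbf{Y}_1,\dots,\mathbf{Y}_k):=\sup_{R>0}\chi_{\mathrm{orb},R}(\mathbf{Y}_1,\dots,\mathbf{Y}_k)$. Orbital free entropy in presence of unitaries: for a tuple $\mathbf{v}=(v_1,\dots,v_s)$ of unitaries in $\mathcal{M}$, $\Gamma_{\mathrm{orb}}(\mathbf{Y}_1,\dots,\mathbf{Y}_k:(\mathbf{A}_i)_{i=1}^k:\mathbf{v};N,m,\delta)$ is the set of all $(U_i)_{i=1}^k\in\mathrm{U}(N)^k$ for which there exists $\mathbf{V}=(V_1,\dots,V_s)\in\mathrm{U}(N)^s$ with $$|\mathrm{tr}_N(h((U_i\mathbf{A}_iU_i^* )_{i=1}^k,\mathbf{V}))-\tau(h((\mathbf{Y}_i)_{i=1}^k,\mathbf{v}))|<\delta$$ for all $*$-monomials $h$ in $r(1)+\cdots+r(k)+s$ indeterminates of degree at most $m$. The quantities $\bar\chi_{\mathrm{orb},R}(\mathbf{Y}_1,\dots,\mathbf{Y}_k:\mathbf{v};N,m,\delta)$, $\chi_{\mathrm{orb},R}(\mathbf{Y}_1,\dots,\mathbf{Y}_k:\mathbf{v})$ and $\chi_{\mathrm{orb}}(\mathbf{Y}_1,\dots,\mathbf{Y}_k:\mathbf{v})$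 are defined as before with this set in place of $\Gamma_{\mathrm{orb}}(\mathbf{Y}_1,\dots,\mathbf{Y}_k:(\mathbf{A}_i)_{i=1}^k;N,m,\delta)$. Microstate free entropy of unitaries: for $\mathbf{v}=(v_1,\dots,v_n)$ unitaries in $\mathcal{M}$, $\Gamma_u(\mathbf{v};N,m,\delta)$ is the set of $\mathbf{V}=(V_1,\dots,V_n)\in\mathrm{U}(N)^n$ with $|\mathrm{tr}_N(h(\mathbf{V}))-\tau(h(\mathbf{v}))|<\delta$ for all $*$-monomials $h$ in $n$ indeterminates of degree at most $m$, and $$\chi_u(\mathbf{v}):=\lim_{m\to\infty,\,\delta\searrow0}\limsup_{N\to\infty}\frac1{N^2}\log\gamma_{\mathrm{U}(N)}^{\otimes n}\big(\Gamma_u(\mathbf{v};N,m,\delta)\big).$$ *)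

theory Defs
  imports "HOL-Probability.Probability" "Jordan_Normal_Form.Schur_Decomposition"
begin

unbundle no vec_syntax

text \<open>
  The inner product is linear in the first argument. Positive definiteness is contained in
  \<open>norm_eq_cinner\<close>: norms are nonnegative and vanish only at 0, and \<^const>\<open>sqrt\<close> is an odd
  increasing function on all of the reals.
\<close>

class complex_hilbert_space = banach +
  fixes scaleC :: "complex \<Rightarrow> 'a \<Rightarrow> 'a"  (infixr \<open>*\<^sub>C\<close> 75)
    and cinner :: "'a \<Rightarrow> 'a \<Rightarrow> complex"
  assumes scaleC_add_right: "c *\<^sub>C (x + y) = c *\<^sub>C x + c *\<^sub>C y"
    and scaleC_add_left: "(c + d) *\<^sub>C x = c *\<^sub>C x + d *\<^sub>C x"
    and scaleC_scaleC: "c *\<^sub>C (d *\<^sub>C x) = (c * d) *\<^sub>C x"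
    and scaleR_scaleC: "r *\<^sub>R x = complex_of_real r *\<^sub>C x"
    and cinner_commute: "cinner x y = cnj (cinner y x)"
    and cinner_add_left: "cinner (x + y) z = cinner x z + cinner y z"
    and cinner_scaleC_left: "cinner (c *\<^sub>C x) y = c * cinner x y"
    and norm_eq_cinner: "norm x = sqrt (Re (cinner x x))"

type_synonym 'h op = "'h \<Rightarrow>\<^sub>L 'h"

text \<open>
  The type \<^typ>\<open>'h op\<close> consists of the bounded real-linear operators; its norm is the operator norm.
  The algebra of bounded complex-linear operators is carved out as a subset.
\<close>

definition clinear_ops :: "'h::complex_hilbert_space op set" where
  "clinear_ops = {T. \<forall>c x. blinfun_apply T (c *\<^sub>C x) = c *\<^sub>C blinfun_apply T x}"

definition op_scaleC :: "complex \<Rightarrow> 'h::complex_hilbert_space op \<Rightarrow> 'h op" where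
  "op_scaleC c T = Blinfun (\<lambda>x. c *\<^sub>C blinfun_apply T x)"

definition op_adj :: "'h::complex_hilbert_space op \<Rightarrow> 'h op" where
  "op_adj T = (THE S. \<forall>x y. cinner (blinfun_apply S x) y = cinner x (blinfun_apply T y))"

definition op_le :: "'h::complex_hilbert_space op \<Rightarrow> 'h op \<Rightarrow> bool" where
  "op_le S T \<longleftrightarrow> (\<forall>x. cinner (blinfun_apply (T - S) x) x \<in> \<real>\<^sub>\<ge>\<^sub>0)"

definition self_adjoints :: "'h::complex_hilbert_space op set \<Rightarrow> 'h op set" where
  "self_adjoints M = {T \<in> M. op_adj T = T}"

definition unitaries :: "'h::complex_hilbert_space op set \<Rightarrow> 'h op set" where
  "unitaries M = {u \<in> M. op_adj u o\<^sub>L u = id_blinfun \<and> u o\<^sub>L op_adj u = id_blinfun}"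

definition commutant :: "'h::complex_hilbert_space op set \<Rightarrow> 'h op set" where
  "commutant S = {T \<in> clinear_ops. \<forall>A\<in>S. T o\<^sub>L A = A o\<^sub>L T}"

definition von_neumann_algebra :: "'h::complex_hilbert_space op set \<Rightarrow> bool" where
  "von_neumann_algebra M \<longleftrightarrow>
     M \<subseteq> clinear_ops \<and> (\<forall>T\<in>M. op_adj T \<in> M) \<and> commutant (commutant M) = M"

definition finite_von_neumann_algebra :: "'h::complex_hilbert_space op set \<Rightarrow> bool" where
  "finite_von_neumann_algebra M \<longleftrightarrow> von_neumann_algebra M \<and>
     (\<forall>u\<in>M. op_adj u o\<^sub>L u = id_blinfun \<longrightarrow> u o\<^sub>L op_adj u = id_blinfun)"

definition state_on :: "'h::complex_hilbert_space op set \<Rightarrow> ('h op \<Rightarrow> complex) \<Rightarrow> bool" where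
  "state_on M \<tau> \<longleftrightarrow>
     (\<forall>S\<in>M. \<forall>T\<in>M. \<tau> (S + T) = \<tau> S + \<tau> T) \<and>
     (\<forall>c. \<forall>T\<in>M. \<tau> (op_scaleC c T) = c * \<tau> T) \<and>
     (\<forall>T\<in>M. \<tau> (op_adj T o\<^sub>L T) \<in> \<real>\<^sub>\<ge>\<^sub>0) \<and>
     \<tau> id_blinfun = 1"

definition tracial_on :: "'h::complex_hilbert_space op set \<Rightarrow> ('h op \<Rightarrow> complex) \<Rightarrow> bool" where
  "tracial_on M \<tau> \<longleftrightarrow> (\<forall>S\<in>M. \<forall>T\<in>M. \<tau> (S o\<^sub>L T) = \<tau> (T o\<^sub>L S))"

definition faithful_on :: "'h::complex_hilbert_space op set \<Rightarrow> ('h op \<Rightarrow> complex) \<Rightarrow> bool" where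
  "faithful_on M \<tau> \<longleftrightarrow> (\<forall>T\<in>M. \<tau> (op_adj T o\<^sub>L T) = 0 \<longrightarrow> T = 0)"

text \<open>
  Normality: suprema of upward directed families of self-adjoint elements are preserved
  (on self-adjoint elements a state takes real values).
\<close>

definition is_sup_in :: "'h::complex_hilbert_space op set \<Rightarrow> 'h op set \<Rightarrow> 'h op \<Rightarrow> bool" where
  "is_sup_in M D S \<longleftrightarrow> S \<in> self_adjoints M \<and> (\<forall>T\<in>D. op_le T S) \<and>
     (\<forall>S'\<in>self_adjoints M. (\<forall>T\<in>D. op_le T S') \<longrightarrow> op_le S S')"

definition normal_on :: "'h::complex_hilbert_space op set \<Rightarrow> ('h op \<Rightarrow> complex) \<Rightarrow> bool" where
  "normal_on M \<tau> \<longleftrightarrow>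
     (\<forall>D S. D \<noteq> {} \<and> D \<subseteq> self_adjoints M \<and>
        (\<forall>A\<in>D. \<forall>B\<in>D. \<exists>C\<in>D. op_le A C \<and> op_le B C) \<and> is_sup_in M D S
        \<longrightarrow> Re (\<tau> S) = (SUP T\<in>D. Re (\<tau> T)))"

definition tracial_W_prob_space ::
    "'h::complex_hilbert_space op set \<Rightarrow> ('h op \<Rightarrow> complex) \<Rightarrow> bool" where
  "tracial_W_prob_space M \<tau> \<longleftrightarrow> finite_von_neumann_algebra M \<and>
     state_on M \<tau> \<and> tracial_on M \<tau> \<and> faithful_on M \<tau> \<and> normal_on M \<tau>"

definition op_conj :: "'h::complex_hilbert_space op \<Rightarrow> 'h op list \<Rightarrow> 'h op list" where
  "op_conj u Xs = map (\<lambda>T. u o\<^sub>L T o\<^sub>L op_adj u) Xs"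

inductive_set star_algebra :: "'h::complex_hilbert_space op set \<Rightarrow> 'h op set"
  for S :: "'h op set" where
  gen: "T \<in> S \<Longrightarrow> T \<in> star_algebra S"
| one: "id_blinfun \<in> star_algebra S"
| add: "A \<in> star_algebra S \<Longrightarrow> B \<in> star_algebra S \<Longrightarrow> A + B \<in> star_algebra S"
| scale: "A \<in> star_algebra S \<Longrightarrow> op_scaleC c A \<in> star_algebra S"
| mult: "A \<in> star_algebra S \<Longrightarrow> B \<in> star_algebra S \<Longrightarrow> A o\<^sub>L B \<in> star_algebra S"
| adj: "A \<in> star_algebra S \<Longrightarrow> op_adj A \<in> star_algebra S"

text \<open>
  An alternating product is given by a nonempty list of pairs (index, element of the
  subalgebra with that index) in which neighbouring indices differ.
\<close>

definition free_family ::
    "('h::complex_hilbert_space op \<Rightarrow> complex) \<Rightarrow> 'i set \<Rightarrow> ('i \<Rightarrow> 'h op set) \<Rightarrow> bool" where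
  "free_family \<tau> I \<A> \<longleftrightarrow>
     (\<forall>ps. ps \<noteq> [] \<and> (\<forall>(i, a)\<in>set ps. i \<in> I \<and> a \<in> \<A> i \<and> \<tau> a = 0) \<and>
        successively (\<lambda>p q. fst p \<noteq> fst q) ps
        \<longrightarrow> \<tau> (foldr (\<lambda>p b. snd p o\<^sub>L b) ps id_blinfun) = 0)"

definition freely_independent ::
    "('h::complex_hilbert_space op \<Rightarrow> complex) \<Rightarrow> 'h op list \<Rightarrow> 'h op list \<Rightarrow> bool" where
  "freely_independent \<tau> Xs Ys \<longleftrightarrow>
     free_family \<tau> UNIV (\<lambda>b::bool. star_algebra (set (if b then Xs else Ys)))"

definition ntrace :: "nat \<Rightarrow> complex mat \<Rightarrow> complex" where
  "ntrace N A = (\<Sum>i<N. A $$ (i, i)) / of_nat N"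

definition vec_l2norm :: "complex vec \<Rightarrow> real" where
  "vec_l2norm x = L2_set (\<lambda>i. cmod (x $ i)) {..<dim_vec x}"

definition mat_opnorm :: "complex mat \<Rightarrow> real" where
  "mat_opnorm A = Sup {vec_l2norm (A *\<^sub>v x) | x. x \<in> carrier_vec (dim_col A) \<and> vec_l2norm x \<le> 1}"

definition sa_mats :: "nat \<Rightarrow> complex mat set" where
  "sa_mats N = {A \<in> carrier_mat N N. mat_adjoint A = A}"

definition sa_mats_bounded :: "nat \<Rightarrow> real \<Rightarrow> complex mat set" where
  "sa_mats_bounded N R = {A \<in> sa_mats N. mat_opnorm A \<le> R}"

definition unitary_group :: "nat \<Rightarrow> complex mat set" where
  "unitary_group N =
     {U \<in> carrier_mat N N. U * mat_adjoint U = 1\<^sub>m N \<and> mat_adjoint U * U = 1\<^sub>m N}"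

text \<open>
  This is the Borel sigma-algebra: the entries embed the unitary group into a finite power of the
  complex plane, whose Borel sigma-algebra is the product one.
\<close>

definition borel_unitary :: "nat \<Rightarrow> complex mat measure" where
  "borel_unitary N = vimage_algebra (unitary_group N)
     (\<lambda>U. restrict (\<lambda>p. U $$ p) ({..<N} \<times> {..<N})) (\<Pi>\<^sub>M p\<in>{..<N} \<times> {..<N}. borel)"

definition is_haar_unitary :: "nat \<Rightarrow> complex mat measure \<Rightarrow> bool" where
  "is_haar_unitary N \<mu> \<longleftrightarrow> prob_space \<mu> \<and> sets \<mu> = sets (borel_unitary N) \<and>
     (\<forall>W\<in>unitary_group N. distr \<mu> \<mu> (\<lambda>U. W * U) = \<mu>)"

text \<open>The measure chosen here exists and is unique, since the unitary group is compact.\<close>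

definition haar_unitary :: "nat \<Rightarrow> complex mat measure" where
  "haar_unitary N = (SOME \<mu>. is_haar_unitary N \<mu>)"

definition haar_power :: "nat \<Rightarrow> nat \<Rightarrow> (nat \<Rightarrow> complex mat) measure" where
  "haar_power N k = (\<Pi>\<^sub>M i\<in>{..<k}. haar_unitary N)"

definition unitary_power :: "nat \<Rightarrow> nat \<Rightarrow> (nat \<Rightarrow> complex mat) set" where
  "unitary_power N k = ({..<k} \<rightarrow>\<^sub>E unitary_group N)"

text \<open>
  A *-monomial is a word in letters (j, b): the indeterminate with index j (counted from 0),
  starred if b holds. The length of the word is the degree.
\<close>

type_synonym star_word = "(nat \<times> bool) list"

definition star_words :: "nat \<Rightarrow> nat \<Rightarrow> star_word set" where
  "star_words r m = {w. length w \<le> m \<and> (\<forall>(j, b)\<in>set w. j < r)}"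

definition op_eval :: "'h::complex_hilbert_space op list \<Rightarrow> star_word \<Rightarrow> 'h op" where
  "op_eval Ys w =
     foldr (\<lambda>(j, b) T. (if b then op_adj (Ys ! j) else Ys ! j) o\<^sub>L T) w id_blinfun"

definition mat_eval :: "nat \<Rightarrow> complex mat list \<Rightarrow> star_word \<Rightarrow> complex mat" where
  "mat_eval N As w =
     foldr (\<lambda>(j, b) B. (if b then mat_adjoint (As ! j) else As ! j) * B) w (1\<^sub>m N)"

definition moments_close ::
    "('h::complex_hilbert_space op \<Rightarrow> complex) \<Rightarrow> 'h op list \<Rightarrow> nat \<Rightarrow> nat \<Rightarrow> real
      \<Rightarrow> complex mat list \<Rightarrow> bool" where
  "moments_close \<tau> Ys N m \<delta> As \<longleftrightarrow>
     (\<forall>w\<in>star_words (length Ys) m. cmod (ntrace N (mat_eval N As w) - \<tau> (op_eval Ys w)) < \<delta>)"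

definition Gamma_R ::
    "real \<Rightarrow> ('h::complex_hilbert_space op \<Rightarrow> complex) \<Rightarrow> 'h op list \<Rightarrow> nat \<Rightarrow> nat \<Rightarrow> real
      \<Rightarrow> complex mat list set" where
  "Gamma_R R \<tau> Xs N m \<delta> =
     {As. length As = length Xs \<and> set As \<subseteq> sa_mats_bounded N R \<and> moments_close \<tau> Xs N m \<delta> As}"

definition has_fda :: "('h::complex_hilbert_space op \<Rightarrow> complex) \<Rightarrow> 'h op list \<Rightarrow> bool" where
  "has_fda \<tau> Xs \<longleftrightarrow>
     (\<forall>R m \<delta>. (\<forall>T\<in>set Xs. norm T < R) \<and> \<delta> > 0
        \<longrightarrow> (\<forall>\<^sub>F N in sequentially. Gamma_R R \<tau> Xs N m \<delta> \<noteq> {}))"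

definition log_ext :: "real \<Rightarrow> ereal" where
  "log_ext p = (if p = 0 then - \<infinity> else ereal (ln p))"

definition entropy_limit :: "(nat \<Rightarrow> nat \<Rightarrow> real \<Rightarrow> ereal) \<Rightarrow> ereal" where
  "entropy_limit F =
     Lim (sequentially \<times>\<^sub>F at_right 0) (\<lambda>(m, \<delta>). limsup (\<lambda>N. F N m \<delta> / ereal (real (N ^ 2))))"

text \<open>
  A k-tuple of multi-variables is a list of k lists. For k-tuples of matrix tuples,
  \<open>mat_tuples\<close> requires the same shape as the given k-tuple of multi-variables.
\<close>

definition mat_tuples :: "'a list list \<Rightarrow> complex mat set \<Rightarrow> complex mat list list set" where
  "mat_tuples Ys S = {As. map length As = map length Ys \<and> (\<forall>A\<in>set As. set A \<subseteq> S)}"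

definition orbit_tuple :: "(nat \<Rightarrow> complex mat) \<Rightarrow> complex mat list list \<Rightarrow> complex mat list" where
  "orbit_tuple U As =
     concat (map (\<lambda>i. map (\<lambda>A. U i * A * mat_adjoint (U i)) (As ! i)) [0..<length As])"

definition Gamma_orb ::
    "('h::complex_hilbert_space op \<Rightarrow> complex) \<Rightarrow> 'h op list list \<Rightarrow> complex mat list list
      \<Rightarrow> nat \<Rightarrow> nat \<Rightarrow> real \<Rightarrow> (nat \<Rightarrow> complex mat) set" where
  "Gamma_orb \<tau> Ys As N m \<delta> =
     {U \<in> unitary_power N (length Ys). moments_close \<tau> (concat Ys) N m \<delta> (orbit_tuple U As)}"

definition chibar_orb_R ::
    "real \<Rightarrow> ('h::complex_hilbert_space op \<Rightarrow> complex) \<Rightarrow> 'h op list list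
      \<Rightarrow> nat \<Rightarrow> nat \<Rightarrow> real \<Rightarrow> ereal" where
  "chibar_orb_R R \<tau> Ys N m \<delta> =
     (SUP As\<in>mat_tuples Ys (sa_mats_bounded N R).
        log_ext (measure (haar_power N (length Ys)) (Gamma_orb \<tau> Ys As N m \<delta>)))"

definition chi_orb_R ::
    "real \<Rightarrow> ('h::complex_hilbert_space op \<Rightarrow> complex) \<Rightarrow> 'h op list list \<Rightarrow> ereal" where
  "chi_orb_R R \<tau> Ys = entropy_limit (chibar_orb_R R \<tau> Ys)"

definition chi_orb ::
    "('h::complex_hilbert_space op \<Rightarrow> complex) \<Rightarrow> 'h op list list \<Rightarrow> ereal" where
  "chi_orb \<tau> Ys = (SUP R\<in>{0<..}. chi_orb_R R \<tau> Ys)"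

definition Gamma_orb_pres ::
    "('h::complex_hilbert_space op \<Rightarrow> complex) \<Rightarrow> 'h op list list \<Rightarrow> complex mat list list
      \<Rightarrow> 'h op list \<Rightarrow> nat \<Rightarrow> nat \<Rightarrow> real \<Rightarrow> (nat \<Rightarrow> complex mat) set" where
  "Gamma_orb_pres \<tau> Ys As vs N m \<delta> =
     {U \<in> unitary_power N (length Ys).
        \<exists>Vs. length Vs = length vs \<and> set Vs \<subseteq> unitary_group N \<and>
          moments_close \<tau> (concat Ys @ vs) N m \<delta> (orbit_tuple U As @ Vs)}"

definition chibar_orb_pres_R ::
    "real \<Rightarrow> ('h::complex_hilbert_space op \<Rightarrow> complex) \<Rightarrow> 'h op list list \<Rightarrow> 'h op list
      \<Rightarrow> nat \<Rightarrow> nat \<Rightarrow> real \<Rightarrow> ereal" where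
  "chibar_orb_pres_R R \<tau> Ys vs N m \<delta> =
     (SUP As\<in>mat_tuples Ys (sa_mats_bounded N R).
        log_ext (measure (haar_power N (length Ys)) (Gamma_orb_pres \<tau> Ys As vs N m \<delta>)))"

definition chi_orb_pres_R ::
    "real \<Rightarrow> ('h::complex_hilbert_space op \<Rightarrow> complex) \<Rightarrow> 'h op list list \<Rightarrow> 'h op list \<Rightarrow> ereal"
  where
  "chi_orb_pres_R R \<tau> Ys vs = entropy_limit (chibar_orb_pres_R R \<tau> Ys vs)"

definition chi_orb_pres ::
    "('h::complex_hilbert_space op \<Rightarrow> complex) \<Rightarrow> 'h op list list \<Rightarrow> 'h op list \<Rightarrow> ereal" where
  "chi_orb_pres \<tau> Ys vs = (SUP R\<in>{0<..}. chi_orb_pres_R R \<tau> Ys vs)"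

definition Gamma_u ::
    "('h::complex_hilbert_space op \<Rightarrow> complex) \<Rightarrow> 'h op list \<Rightarrow> nat \<Rightarrow> nat \<Rightarrow> real
      \<Rightarrow> (nat \<Rightarrow> complex mat) set" where
  "Gamma_u \<tau> vs N m \<delta> =
     {V \<in> unitary_power N (length vs). moments_close \<tau> vs N m \<delta> (map V [0..<length vs])}"

definition chi_u :: "('h::complex_hilbert_space op \<Rightarrow> complex) \<Rightarrow> 'h op list \<Rightarrow> ereal" where
  "chi_u \<tau> vs =
     entropy_limit (\<lambda>N m \<delta>. log_ext (measure (haar_power N (length vs)) (Gamma_u \<tau> vs N m \<delta>)))"

end

theory Submission
  imports Defs
begin

text \<open>
  The first two inequalities compare microstate spaces directly: forgetting the unitaries enlarges
  the set, and so does passing from matrix models of all of \<open>X\<close> to sub-tuples.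

  For the last one, let \<open>A\<close> be a matrix model of \<open>X\<close>. By Voiculescu's asymptotic freeness, for every
  \<open>V\<close> in \<open>Gamma_u\<close> a Haar unitary \<open>W\<close> makes the joint moments of \<open>(W A W\<^sup>*, V)\<close> close to those of the
  free pair \<open>(X, v)\<close> with probability at least \<open>1/2\<close>, uniformly in \<open>A\<close> and \<open>V\<close>. As
  \<open>(V\<^sub>1, \<dots>, V\<^sub>n, W) \<mapsto> (V\<^sub>1 W, \<dots>, V\<^sub>n W, W)\<close> preserves Haar measure and
  \<open>(V\<^sub>i W) A (V\<^sub>i W)\<^sup>*\<close> is a word in \<open>V\<^sub>i\<close> and \<open>W A W\<^sup>*\<close>, the orbital microstate space has at least half
  the measure of \<open>Gamma_u\<close>, and the factor \<open>1/2\<close> disappears on the scale \<open>N\<^sup>2\<close>.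

  Asymptotic freeness is obtained from the loop equation of the Haar measure: for the derivation
  \<open>\<partial>\<close> with \<open>\<partial>B = B \<otimes> 1 - 1 \<otimes> B\<close> on \<open>B = W A W\<^sup>*\<close> and \<open>\<partial>V = 0\<close>, left invariance shows that
  \<open>(tr \<otimes> tr)(\<partial> w)\<close> tends to 0 in \<open>L\<^sup>2\<close> for every word \<open>w\<close>, while \<open>(\<tau> \<otimes> \<tau>)(\<partial> w) = 0\<close> by freeness. For
  a word that starts in \<open>V\<close> and ends in \<open>B\<close> this equation expresses the moment of \<open>w\<close> through
  moments of shorter words, so the moments converge by induction on the length.
\<close>

section \<open>Operators on a Hilbert space\<close>

text \<open>Uniformity in A and V is obtained by contradiction: models that violate it at ever finer
  accuracy form one sequence of models along which all moments converge. The loop equation needs no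
  calculus on the unitary group. The Haar measure is moved by e^(\<i>tP) with P a projection of rank
  one; this changes unnormalised traces by O(t) whatever the size N, hence normalised ones by
  O(t/N). Summing over the N^2 matrix units and dividing by N^2 leaves a second moment of order 1/N.
  Off-diagonal matrix units are not self-adjoint and are recovered from rank one projections by
  polarization. \<open>haar_unitary\<close> is a choice, so a left invariant probability measure has
  to be exhibited: the law of the Gram-Schmidt basis of a random matrix drawn from a ball. The value
  of \<open>measure\<close> at a non-measurable set is 0, so each comparison of microstate sets
  rests on the measurability of the larger one. The existential quantifier over V in
  \<open>Gamma_orb_pres\<close> makes this the difficult case.\<close>

lemma cinner_add_right: "cinner (x::'a::complex_hilbert_space) (y + z) = cinner x y + cinner x z"
  by (metis cinner_add_left cinner_commute complex_cnj_add)

lemma cinner_scaleC_right: "cinner (x::'a::complex_hilbert_space) (c *\<^sub>C y) = cnj c * cinner x y"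
  by (metis cinner_scaleC_left cinner_commute complex_cnj_mult)

lemma cinner_scaleR_left: "cinner (r *\<^sub>R x) (y::'a::complex_hilbert_space) = of_real r * cinner x y"
  by (simp add: scaleR_scaleC cinner_scaleC_left)

lemma cinner_scaleR_right: "cinner x (r *\<^sub>R y::'a::complex_hilbert_space) = of_real r * cinner x y"
  by (simp add: scaleR_scaleC cinner_scaleC_right)

lemma cinner_minus_left: "cinner (- x) (y::'a::complex_hilbert_space) = - cinner x y"
  using cinner_scaleR_left[of "-1" x y] by simp

lemma cinner_minus_right: "cinner x (- y::'a::complex_hilbert_space) = - cinner x y"
  using cinner_scaleR_right[of x "-1" y] by simp

lemma cinner_diff_left: "cinner (x - z) (y::'a::complex_hilbert_space) = cinner x y - cinner z y"
  using cinner_add_left[of x "-z" y] by (simp add: cinner_minus_left)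

lemma norm_power2_cinner: "norm (x::'a::complex_hilbert_space) ^ 2 = Re (cinner x x)"
proof -
  have "0 \<le> Re (cinner x x)"
    using norm_eq_cinner[of x] norm_ge_zero[of x] by (metis real_sqrt_ge_0_iff)
  then show ?thesis by (simp add: norm_eq_cinner)
qed

lemma Re_cinner_commute: "Re (cinner x (y::'a::complex_hilbert_space)) = Re (cinner y x)"
  by (metis cinner_commute complex_cnj(1) cnj.sel(1))

lemma norm_add_power2: "norm (x + y::'a::complex_hilbert_space) ^ 2 = norm x ^ 2 + 2 * Re (cinner x y) + norm y ^ 2"
  by (simp add: norm_power2_cinner cinner_add_left cinner_add_right Re_cinner_commute[of y x])

lemma Re_cinner_le: "Re (cinner x (y::'a::complex_hilbert_space)) \<le> norm x * norm y"
proof -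
  have "norm (x + y) ^ 2 \<le> (norm x + norm y) ^ 2"
    by (rule power_mono) (auto simp: norm_triangle_ineq)
  then show ?thesis unfolding norm_add_power2 by (simp add: power2_sum)
qed

lemma cinner_left_eqI:
  assumes "\<And>y. cinner x y = cinner z (y::'a::complex_hilbert_space)"
  shows "x = z"
proof -
  have "cinner (x - z) (x - z) = 0"
    using assms[of "x - z"] by (simp add: cinner_diff_left)
  then have "norm (x - z) = 0" by (simp add: norm_eq_cinner)
  then show ?thesis by simp
qed

text \<open>First-order condition at a minimum, for the variational argument below: close to 0 the
  linear term outweighs the quadratic one.\<close>

lemma quadratic_nonneg_linear_zero:
  fixes a b :: real
  assumes "\<And>t. 0 \<le> t ^ 2 * a + 2 * t * b"
  shows "b = 0"
proof (rule ccontr)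
  assume b: "b \<noteq> 0"
  \<comment> \<open>Dividing by |a| + 1 instead of a covers a = 0 and a < 0 and ensures a / c < 2,
    which makes the value at \<open>t\<close> negative.\<close>
  define c where "c = \<bar>a\<bar> + 1"
  define t where "t = - b / c"
  have pos: "c > 0" "a < 2 * c" unfolding c_def by (auto simp: abs_if)
  have "t ^ 2 * a + 2 * t * b = b ^ 2 / c * (a / c - 2)"
    using pos by (simp add: t_def field_simps power2_eq_square)
  moreover have "a / c < 2" using pos by (simp add: field_simps)
  moreover have "b ^ 2 / c > 0" using pos b by simp
  ultimately have "t ^ 2 * a + 2 * t * b < 0" by (metis diff_less_0_iff_less mult_pos_neg)
  then show False using assms[of t] by linarith
qed

text \<open>The representing vector minimises the energy functional \<open>J\<close>; minimising sequences are
  Cauchy by the parallelogram law.\<close>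

lemma riesz_representation:
  fixes f :: "'a::complex_hilbert_space \<Rightarrow> complex"
  assumes add: "\<And>x y. f (x + y) = f x + f y"
    and scale: "\<And>c x. f (c *\<^sub>C x) = c * f x"
    and bound: "\<And>x. Re (f x) \<le> K * norm x"
  obtains u where "\<And>x. f x = cinner x u"
proof -
  define J where "J = (\<lambda>x. norm x ^ 2 - 2 * Re (f x))"
  have fR: "f (r *\<^sub>R x) = of_real r * f x" for r x
    by (simp add: scaleR_scaleC scale)
  have J_lower: "J x \<ge> - (K ^ 2)" for x
  proof -
    have "0 \<le> (norm x - K) ^ 2" by simp
    then have "0 \<le> norm x ^ 2 - 2 * (K * norm x) + K ^ 2" by (simp add: power2_diff algebra_simps)
    then show ?thesis unfolding J_def using bound[of x] by linarith
  qed
  define d where "d = (INF x. J x)"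
  have bdd: "bdd_below (range J)" using J_lower by (auto intro!: bdd_belowI)
  have d_le: "d \<le> J x" for x unfolding d_def by (rule cINF_lower[OF bdd]) simp
  have "\<exists>x. J x < d + 1 / (real n + 1)" for n
  proof -
    have "\<exists>y\<in>range J. y < d + 1 / (real n + 1)"
      by (rule cInf_lessD) (auto simp: d_def)
    then show ?thesis by auto
  qed
  then obtain s where s: "\<And>n. J (s n) < d + 1 / (real n + 1)" by metis
  \<comment> \<open>The midpoint of x and y also has energy at least \<open>d\<close>; inserted into
    the parallelogram law this bounds the distance of two near-minimisers.\<close>
  have par: "norm (x - y) ^ 2 \<le> 2 * (J x - d) + 2 * (J y - d)" for x y
  proof -
    have 1: "norm (x - y) ^ 2 = 2 * norm x ^ 2 + 2 * norm y ^ 2 - norm (x + y) ^ 2"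
      using norm_add_power2[of x "-y"] norm_add_power2[of x y] by (simp add: cinner_minus_right)
    have 2: "norm ((1/2) *\<^sub>R (x + y)) ^ 2 = norm (x + y) ^ 2 / 4"
      by (simp add: power_divide)
    have "d \<le> norm (x + y) ^ 2 / 4 - (Re (f x) + Re (f y))"
      using d_le[of "(1/2) *\<^sub>R (x + y)"] unfolding J_def 2 fR add by (simp add: add_divide_distrib)
    then show ?thesis using 1 unfolding J_def by simp
  qed
  have "Cauchy s"
  proof (rule metric_CauchyI)
    fix e :: real assume e: "e > 0"
    obtain n0 where n0: "1 / (real n0 + 1) < e ^ 2 / 4"
      by (metis e add.commute of_nat_Suc divide_pos_pos nat_approx_posE zero_less_numeral zero_less_power)
    show "\<exists>M. \<forall>m\<ge>M. \<forall>n\<ge>M. dist (s m) (s n) < e"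
    proof (intro exI allI impI)
      fix m n assume "m \<ge> n0" "n \<ge> n0"
      then have "1 / (real m + 1) \<le> 1 / (real n0 + 1)" "1 / (real n + 1) \<le> 1 / (real n0 + 1)"
        by (auto simp: divide_simps)
      moreover have "norm (s m - s n) ^ 2 < 2 * (1 / (real m + 1)) + 2 * (1 / (real n + 1))"
        using par[of "s m" "s n"] s[of m] s[of n] by argo
      ultimately have "norm (s m - s n) ^ 2 < e ^ 2"
        using n0 by argo
      then show "dist (s m) (s n) < e"
        using e by (simp add: dist_norm power_less_imp_less_base)
    qed
  qed
  then obtain u where u: "s \<longlonglongrightarrow> u" using Cauchy_convergent_iff convergent_def by blast
  have f_diff: "f (x - y) = f x - f y" for x y
    using add[of "x - y" y] by simp
  have ReK: "\<bar>Re (f x)\<bar> \<le> K * norm x" for x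
    using bound[of x] bound[of "-x"] f_diff[of 0 x] f_diff[of x x] by (auto simp: abs_le_iff)
  have "(\<lambda>n. Re (f (s n))) \<longlonglongrightarrow> Re (f u)"
  proof (rule LIM_zero_cancel, rule Lim_null_comparison)
    show "\<forall>\<^sub>F n in sequentially. norm (Re (f (s n)) - Re (f u)) \<le> K * norm (s n - u)"
      using ReK[of "s _ - u"] by (auto simp: f_diff)
    show "(\<lambda>n. K * norm (s n - u)) \<longlonglongrightarrow> 0"
      using tendsto_mult_right_zero[OF tendsto_norm_zero[OF LIM_zero[OF u]], of K] by simp
  qed
  then have "(\<lambda>n. J (s n)) \<longlonglongrightarrow> J u"
    unfolding J_def by (intro tendsto_diff tendsto_power tendsto_mult tendsto_const tendsto_norm u)
  moreover have "(\<lambda>n. d + 1 / (real n + 1)) \<longlonglongrightarrow> d + 0"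
    by (intro tendsto_intros) (use LIMSEQ_inverse_real_of_nat in \<open>simp add: inverse_eq_divide add.commute\<close>)
  ultimately have "J u \<le> d + 0"
    by (rule LIMSEQ_le) (use s less_imp_le in blast)
  then have min: "J u \<le> J x" for x using d_le[of x] by simp
  have Re_eq: "Re (f x) = Re (cinner x u)" for x
  proof -
    \<comment> \<open>The minimiser u is compared with u + t x.\<close>
    have "0 \<le> t ^ 2 * norm x ^ 2 + 2 * t * (Re (cinner x u) - Re (f x))" for t
      using min[of "u + t *\<^sub>R x"] unfolding J_def norm_add_power2
      by (simp add: add fR cinner_scaleR_right Re_cinner_commute[of u x] power_mult_distrib algebra_simps)
    then have "Re (cinner x u) - Re (f x) = 0" by (rule quadratic_nonneg_linear_zero)
    then show ?thesis by simp
  qed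
  \<comment> \<open>The imaginary part of a complex-linear functional at x is its real part at -\<i>
    x.\<close>
  have "f x = cinner x u" for x
    using Re_eq[of x] Re_eq[of "(- \<i>) *\<^sub>C x"]
    by (auto simp: scale cinner_scaleC_left intro: complex_eqI)
  then show thesis by (rule that)
qed

lemma norm_scaleC: "norm (c *\<^sub>C (x::'a::complex_hilbert_space)) = cmod c * norm x"
proof -
  have "cinner (c *\<^sub>C x) (c *\<^sub>C x) = of_real (cmod c ^ 2) * cinner x x"
    by (simp only: cinner_scaleC_left cinner_scaleC_right complex_norm_square) (simp add: ac_simps)
  then have "norm (c *\<^sub>C x) ^ 2 = (cmod c * norm x) ^ 2"
    by (simp add: norm_power2_cinner power_mult_distrib)
  then show ?thesis by (simp add: power2_eq_iff_nonneg)
qed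

lemma blinfun_apply_op_scaleC:
  "blinfun_apply (op_scaleC c T) x = c *\<^sub>C blinfun_apply T (x::'a::complex_hilbert_space)"
proof -
  have "bounded_linear (\<lambda>x. c *\<^sub>C blinfun_apply T x)"
  proof (rule bounded_linear_compose[of "\<lambda>x. c *\<^sub>C x"])
    show "bounded_linear (\<lambda>x::'a. c *\<^sub>C x)"
    proof (rule bounded_linear_intro)
      show "c *\<^sub>C (r *\<^sub>R x) = r *\<^sub>R (c *\<^sub>C x)" for r and x :: 'a
        by (simp add: scaleR_scaleC scaleC_scaleC mult.commute)
      show "norm (c *\<^sub>C x) \<le> norm x * cmod c" for x :: 'a
        by (simp add: norm_scaleC mult.commute)
    qed (simp add: scaleC_add_right)
  qed (rule blinfun.bounded_linear_right)
  then show ?thesis unfolding op_scaleC_def by (simp add: bounded_linear_Blinfun_apply)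
qed

lemma op_adj_eqI:
  fixes S T :: "'h::complex_hilbert_space op"
  assumes "\<And>x y. cinner (blinfun_apply S x) y = cinner x (blinfun_apply T y)"
  shows "op_adj T = S"
  unfolding op_adj_def
proof (rule the_equality)
  show "\<forall>x y. cinner (blinfun_apply S x) y = cinner x (blinfun_apply T y)" using assms by blast
  fix S' :: "'h op" assume "\<forall>x y. cinner (blinfun_apply S' x) y = cinner x (blinfun_apply T y)"
  then have "blinfun_apply S' x = blinfun_apply S x" for x
    using assms by (intro cinner_left_eqI) simp
  then show "S' = S" by (rule blinfun_eqI)
qed

text \<open>Existence of the adjoint, by Riesz representation of the functional that sends y to
  \<open>cinner (T y) x\<close>. Complex linearity of T is forced by the defining equation of
  \<open>op_adj\<close>: for any other operator the definite description has no witness.\<close>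

lemma cinner_op_adj_left:
  fixes T :: "'h::complex_hilbert_space op"
  assumes "T \<in> clinear_ops"
  shows "cinner (blinfun_apply (op_adj T) x) y = cinner x (blinfun_apply T y)"
proof -
  have T: "blinfun_apply T (c *\<^sub>C x) = c *\<^sub>C blinfun_apply T x" for c x
    using assms by (simp add: clinear_ops_def)
  have "\<exists>u. \<forall>y. cinner (blinfun_apply T y) x = cinner y u" for x
  proof -
    have "Re (cinner (blinfun_apply T y) x) \<le> (norm T * norm x) * norm y" for y
    proof -
      have "Re (cinner (blinfun_apply T y) x) \<le> norm (blinfun_apply T y) * norm x" by (rule Re_cinner_le)
      also have "\<dots> \<le> norm T * norm y * norm x" by (intro mult_right_mono norm_blinfun norm_ge_zero)
      finally show ?thesis by (simp add: ac_simps)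
    qed
    from riesz_representation[of "\<lambda>y. cinner (blinfun_apply T y) x", OF _ _ this] show ?thesis
      by (auto simp: blinfun.add_right cinner_add_left T cinner_scaleC_left)
  qed
  then obtain S where S: "\<And>x y. cinner (blinfun_apply T y) x = cinner y (S x)" by metis
  then have S': "cinner (S x) y = cinner x (blinfun_apply T y)" for x y
    by (metis cinner_commute)
  have "bounded_linear S"
  proof (rule bounded_linear_intro)
    show "S (x + y) = S x + S y" for x y
      by (rule cinner_left_eqI) (simp add: S' cinner_add_left)
    show "S (r *\<^sub>R x) = r *\<^sub>R S x" for r x
      by (rule cinner_left_eqI) (simp add: S' cinner_scaleR_left)
    show "norm (S x) \<le> norm x * norm T" for x
    proof -
      have "norm (S x) ^ 2 = Re (cinner x (blinfun_apply T (S x)))"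
        by (simp add: norm_power2_cinner S')
      also have "\<dots> \<le> norm x * norm (blinfun_apply T (S x))" by (rule Re_cinner_le)
      also have "\<dots> \<le> norm x * (norm T * norm (S x))" by (intro mult_left_mono norm_blinfun norm_ge_zero)
      finally have "norm (S x) * norm (S x) \<le> (norm x * norm T) * norm (S x)"
        by (simp add: power2_eq_square ac_simps)
      then show ?thesis
        by (cases "S x = 0") auto
    qed
  qed
  then have "op_adj T = Blinfun S"
    by (intro op_adj_eqI) (simp add: bounded_linear_Blinfun_apply S')
  with \<open>bounded_linear S\<close> show ?thesis by (simp add: bounded_linear_Blinfun_apply S')
qed

lemma cinner_op_adj_right:
  assumes "T \<in> clinear_ops"
  shows "cinner x (blinfun_apply (op_adj T) y) = cinner (blinfun_apply T x) y"
  by (metis assms cinner_commute cinner_op_adj_left)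

lemma clinear_ops_id: "id_blinfun \<in> clinear_ops"
  by (simp add: clinear_ops_def)

lemma clinear_ops_compose: "S \<in> clinear_ops \<Longrightarrow> T \<in> clinear_ops \<Longrightarrow> S o\<^sub>L T \<in> clinear_ops"
  by (simp add: clinear_ops_def)

lemma clinear_ops_add: "S \<in> clinear_ops \<Longrightarrow> T \<in> clinear_ops \<Longrightarrow> S + T \<in> clinear_ops"
  by (simp add: clinear_ops_def blinfun.add_left scaleC_add_right)

lemma clinear_ops_scaleC: "T \<in> clinear_ops \<Longrightarrow> op_scaleC c T \<in> clinear_ops"
  by (simp add: clinear_ops_def blinfun_apply_op_scaleC scaleC_scaleC mult.commute)

lemma op_adj_compose:
  "S \<in> clinear_ops \<Longrightarrow> T \<in> clinear_ops \<Longrightarrow> op_adj (S o\<^sub>L T) = op_adj T o\<^sub>L op_adj S"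
  by (rule op_adj_eqI) (simp add: cinner_op_adj_left)

lemma op_adj_op_adj: "T \<in> clinear_ops \<Longrightarrow> op_adj (op_adj T) = T"
  by (rule op_adj_eqI) (simp add: cinner_op_adj_right)

lemma blinfun_compose_assoc: "(A o\<^sub>L B) o\<^sub>L C = A o\<^sub>L (B o\<^sub>L C)"
  by (rule blinfun_eqI) simp

lemma blinfun_compose_id [simp]: "id_blinfun o\<^sub>L A = A" "A o\<^sub>L id_blinfun = A"
  by (rule blinfun_eqI; simp)+

lemma commutant_compose:
  assumes "A \<in> commutant S" "B \<in> commutant S" shows "A o\<^sub>L B \<in> commutant S"
proof -
  have "A o\<^sub>L B o\<^sub>L C = C o\<^sub>L (A o\<^sub>L B)" if "C \<in> S" for C
  proof -
    have "A o\<^sub>L B o\<^sub>L C = A o\<^sub>L (C o\<^sub>L B)" using assms that by (simp add: commutant_def blinfun_compose_assoc)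
    also have "\<dots> = C o\<^sub>L A o\<^sub>L B" using assms that by (simp add: commutant_def blinfun_compose_assoc[symmetric])
    finally show ?thesis by (simp add: blinfun_compose_assoc)
  qed
  then show ?thesis using assms by (simp add: commutant_def clinear_ops_compose)
qed

lemma commutant_scaleC:
  assumes "A \<in> commutant S" "S \<subseteq> clinear_ops" shows "op_scaleC c A \<in> commutant S"
proof -
  have "op_scaleC c A o\<^sub>L B = B o\<^sub>L op_scaleC c A" if "B \<in> S" for B
  proof (rule blinfun_eqI)
    fix x
    have "A o\<^sub>L B = B o\<^sub>L A" using assms that by (simp add: commutant_def)
    then have "blinfun_apply A (blinfun_apply B x) = blinfun_apply B (blinfun_apply A x)"
      by (metis blinfun_apply_blinfun_compose)
    moreover have "B \<in> clinear_ops" using assms that by auto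
    ultimately show "blinfun_apply (op_scaleC c A o\<^sub>L B) x = blinfun_apply (B o\<^sub>L op_scaleC c A) x"
      by (simp add: blinfun_apply_op_scaleC clinear_ops_def)
  qed
  then show ?thesis using assms by (simp add: commutant_def clinear_ops_scaleC)
qed

lemma commutant_add:
  assumes "A \<in> commutant S" "B \<in> commutant S" shows "A + B \<in> commutant S"
  using assms by (auto simp: commutant_def clinear_ops_add
      bounded_bilinear.add_left[OF bounded_bilinear_blinfun_compose]
      bounded_bilinear.add_right[OF bounded_bilinear_blinfun_compose])

text \<open>All but closure under adjoints comes from M being itself a commutant, that of
  \<open>commutant M\<close>, and commutants are unital algebras. Scalars require the operators
  commuted with to be complex-linear, which \<open>commutant\<close> builds in.\<close>

lemma von_neumann_algebra_closed:
  assumes "von_neumann_algebra M"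
  shows "id_blinfun \<in> M" and "A \<in> M \<Longrightarrow> B \<in> M \<Longrightarrow> A o\<^sub>L B \<in> M"
    and "A \<in> M \<Longrightarrow> B \<in> M \<Longrightarrow> A + B \<in> M" and "A \<in> M \<Longrightarrow> op_scaleC c A \<in> M"
    and "A \<in> M \<Longrightarrow> op_adj A \<in> M" and "A \<in> M \<Longrightarrow> A \<in> clinear_ops"
proof -
  have M: "M = commutant (commutant M)" using assms by (simp add: von_neumann_algebra_def)
  have C: "commutant M \<subseteq> clinear_ops" by (auto simp: commutant_def)
  have "id_blinfun \<in> commutant (commutant M)" by (simp add: commutant_def clinear_ops_id)
  then show "id_blinfun \<in> M" using M by simp
  show "A \<in> M \<Longrightarrow> B \<in> M \<Longrightarrow> A o\<^sub>L B \<in> M" using M commutant_compose by blast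
  show "A \<in> M \<Longrightarrow> B \<in> M \<Longrightarrow> A + B \<in> M" using M commutant_add by blast
  show "A \<in> M \<Longrightarrow> op_scaleC c A \<in> M" using M commutant_scaleC[OF _ C] by blast
  show "A \<in> M \<Longrightarrow> op_adj A \<in> M" "A \<in> M \<Longrightarrow> A \<in> clinear_ops"
    using assms by (auto simp: von_neumann_algebra_def)
qed

lemma star_algebra_subset:
  assumes "von_neumann_algebra M" "S \<subseteq> M"
  shows "star_algebra S \<subseteq> M"
proof
  fix T assume "T \<in> star_algebra S"
  then show "T \<in> M"
    by induction (use assms von_neumann_algebra_closed[OF assms(1)] in auto)
qed

section \<open>The derivation of a free pair\<close>

text \<open>The product occurring in \<open>free_family\<close>; the first components are colours
  and do not affect it.\<close>

definition op_prod :: "('i \<times> 'h::complex_hilbert_space op) list \<Rightarrow> 'h op" where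
  "op_prod ps = foldr (\<lambda>p b. snd p o\<^sub>L b) ps id_blinfun"

lemma op_prod_simps [simp]: "op_prod [] = id_blinfun" "op_prod (p # ps) = snd p o\<^sub>L op_prod ps"
  by (simp_all add: op_prod_def)

lemma op_prod_append: "op_prod (ps @ qs) = op_prod ps o\<^sub>L op_prod qs"
  by (induction ps) (simp_all add: blinfun_compose_assoc)

text \<open>For the derivation \<open>\<partial>\<close> with \<open>\<partial>a = a \<otimes> 1 - 1 \<otimes> a\<close> on letters of colour \<open>True\<close> and
  \<open>\<partial>a = 0\<close> on the others, this is \<open>(\<tau> \<otimes> \<tau>) (L \<cdot> \<partial>(product of the list) \<cdot> R)\<close>.\<close>

primrec op_der ::
    "('h::complex_hilbert_space op \<Rightarrow> complex) \<Rightarrow> 'h op \<Rightarrow> (bool \<times> 'h op) list \<Rightarrow> 'h op \<Rightarrow> complex" where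
  "op_der \<tau> L [] R = 0"
| "op_der \<tau> L (p # ps) R =
     (if fst p then \<tau> (L o\<^sub>L snd p) * \<tau> (op_prod ps o\<^sub>L R) - \<tau> L * \<tau> (snd p o\<^sub>L (op_prod ps o\<^sub>L R))
      else 0) + op_der \<tau> (L o\<^sub>L snd p) ps R"

text \<open>Leibniz rule: the part of the product that is not differentiated is absorbed into
  \<open>R\<close> or \<open>L\<close>. The two outer factors are arguments of \<open>op_der\<close>
  for this reason.\<close>

lemma op_der_append:
  "op_der \<tau> L (ps @ qs) R = op_der \<tau> L ps (op_prod qs o\<^sub>L R) + op_der \<tau> (L o\<^sub>L op_prod ps) qs R"
  by (induction ps arbitrary: L) (simp_all add: op_prod_append blinfun_compose_assoc)

text \<open>For neighbours x, y of colour \<open>True\<close> the term \<tau>(L x) \<tau>(y R)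
  arises once with each sign, and what is left is the derivative of the single letter x y.\<close>

lemma op_der_merge:
  "op_der \<tau> L (ps @ (b, x) # (b, y) # qs) R = op_der \<tau> L (ps @ (b, x o\<^sub>L y) # qs) R"
  by (simp add: op_der_append blinfun_compose_assoc)

lemma op_der_id: "op_der \<tau> L (ps @ (b, id_blinfun) # qs) R = op_der \<tau> L (ps @ qs) R"
  by (simp add: op_der_append)

text \<open>The value of \<open>op_der\<close> with trivial outer factors, written in terms of
  moments only: indices below r carry the colour \<open>True\<close>. The functional \<phi> is kept
  abstract because the formula is needed both for the moments of \<tau> and for the random matrix
  moments.\<close>

definition wsum :: "(star_word \<Rightarrow> complex) \<Rightarrow> nat \<Rightarrow> star_word \<Rightarrow> complex" where
  "wsum \<phi> r w = (\<Sum>i<length w. if fst (w ! i) < r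
     then \<phi> (take (Suc i) w) * \<phi> (drop (Suc i) w) - \<phi> (take i w) * \<phi> (drop i w) else 0)"

lemma op_der_index:
  "op_der \<tau> L ps id_blinfun = (\<Sum>i<length ps. if fst (ps ! i)
     then \<tau> (L o\<^sub>L op_prod (take (Suc i) ps)) * \<tau> (op_prod (drop (Suc i) ps))
        - \<tau> (L o\<^sub>L op_prod (take i ps)) * \<tau> (op_prod (drop i ps)) else 0)"
  by (induction ps arbitrary: L)
    (simp_all add: sum.lessThan_Suc_shift blinfun_compose_assoc del: sum.lessThan_Suc cong: if_cong)

lemma compose_op_scaleC_right: "S \<in> clinear_ops \<Longrightarrow> S o\<^sub>L op_scaleC c T = op_scaleC c (S o\<^sub>L T)"
  by (rule blinfun_eqI) (simp add: blinfun_apply_op_scaleC clinear_ops_def)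

lemma compose_op_scaleC_left: "op_scaleC c S o\<^sub>L T = op_scaleC c (S o\<^sub>L T)"
  by (rule blinfun_eqI) (simp add: blinfun_apply_op_scaleC)

lemmas compose_add_left = bounded_bilinear.add_left[OF bounded_bilinear_blinfun_compose]
lemmas compose_add_right = bounded_bilinear.add_right[OF bounded_bilinear_blinfun_compose]

lemma not_successively_decomp:
  assumes "\<not> successively P xs"
  obtains ys x y zs where "xs = ys @ x # y # zs" "\<not> P x y"
proof -
  have "\<exists>ys x y zs. xs = ys @ x # y # zs \<and> \<not> P x y"
    using assms
  proof (induction P xs rule: successively.induct)
    case (3 P x y xs)
    show ?case
    proof (cases "P x y")
      case True
      then obtain ys a b zs where "y # xs = ys @ a # b # zs" "\<not> P a b" using 3 by auto
      then have "x # y # xs = (x # ys) @ a # b # zs \<and> \<not> P a b" by simp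
      then show ?thesis by blast
    qed (metis append_Nil)
  qed auto
  then show thesis using that by blast
qed

context
  fixes M :: "'h::complex_hilbert_space op set" and \<tau> :: "'h op \<Rightarrow> complex"
  assumes vN: "von_neumann_algebra M" and st: "state_on M \<tau>"
begin

lemma state_add: "S \<in> M \<Longrightarrow> T \<in> M \<Longrightarrow> \<tau> (S + T) = \<tau> S + \<tau> T"
  and state_scaleC: "T \<in> M \<Longrightarrow> \<tau> (op_scaleC c T) = c * \<tau> T"
  and state_id: "\<tau> id_blinfun = 1"
  using st by (auto simp: state_on_def)

lemma op_prod_in: "snd ` set ps \<subseteq> M \<Longrightarrow> op_prod ps \<in> M"
  by (induction ps) (auto simp: von_neumann_algebra_closed[OF vN])

lemma op_der_linear_left:
  assumes "L \<in> M" "L' \<in> M" "snd ` set ps \<subseteq> M" "R \<in> M"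
  shows "op_der \<tau> (L + op_scaleC c L') ps R = op_der \<tau> L ps R + c * op_der \<tau> L' ps R"
  using assms
proof (induction ps arbitrary: L L')
  case (Cons p ps)
  have "op_der \<tau> ((L o\<^sub>L snd p) + op_scaleC c (L' o\<^sub>L snd p)) ps R
      = op_der \<tau> (L o\<^sub>L snd p) ps R + c * op_der \<tau> (L' o\<^sub>L snd p) ps R"
    using Cons.IH[of "L o\<^sub>L snd p" "L' o\<^sub>L snd p"] Cons.prems
    by (simp add: von_neumann_algebra_closed[OF vN])
  then show ?case using Cons.prems
    by (auto simp: compose_add_left compose_op_scaleC_left state_add state_scaleC
        von_neumann_algebra_closed[OF vN] algebra_simps)
qed simp

lemma op_der_linear_right:
  assumes "R \<in> M" "R' \<in> M" "snd ` set ps \<subseteq> M" "L \<in> M"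
  shows "op_der \<tau> L ps (R + op_scaleC c R') = op_der \<tau> L ps R + c * op_der \<tau> L ps R'"
  using assms
proof (induction ps arbitrary: L)
  case (Cons p ps)
  have "op_prod ps \<in> M" using Cons.prems by (intro op_prod_in) auto
  moreover have "op_der \<tau> (L o\<^sub>L snd p) ps (R + op_scaleC c R')
      = op_der \<tau> (L o\<^sub>L snd p) ps R + c * op_der \<tau> (L o\<^sub>L snd p) ps R'"
    using Cons.prems by (intro Cons.IH) (auto simp: von_neumann_algebra_closed[OF vN])
  ultimately show ?case using Cons.prems
    by (auto simp: compose_add_right compose_op_scaleC_right state_add state_scaleC
        von_neumann_algebra_closed[OF vN] algebra_simps)
qed simp

text \<open>The Leibniz rule isolates the slot that varies: it enters as right factor of the part
  before it, in its own term, and as left factor of the part after it, each time linearly.\<close>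

lemma op_der_linear:
  assumes "snd ` set ps \<subseteq> M" "snd ` set qs \<subseteq> M" "x \<in> M" "y \<in> M"
  shows "op_der \<tau> id_blinfun (ps @ (b, x + op_scaleC c y) # qs) id_blinfun
     = op_der \<tau> id_blinfun (ps @ (b, x) # qs) id_blinfun
       + c * op_der \<tau> id_blinfun (ps @ (b, y) # qs) id_blinfun"
proof -
  let ?p = "op_prod ps" and ?q = "op_prod qs"
  have in_M: "?p \<in> M" "?q \<in> M" "?p \<in> clinear_ops" "id_blinfun \<in> M" "?p o\<^sub>L z \<in> M" "z o\<^sub>L ?q \<in> M" if "z \<in> M" for z
    using op_prod_in[OF assms(1)] op_prod_in[OF assms(2)] that by (simp_all add: von_neumann_algebra_closed[OF vN])
  note in_xy = in_M[OF assms(3)] in_M[OF assms(4)]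
  have 1: "op_der \<tau> id_blinfun ps ((x + op_scaleC c y) o\<^sub>L ?q)
      = op_der \<tau> id_blinfun ps (x o\<^sub>L ?q) + c * op_der \<tau> id_blinfun ps (y o\<^sub>L ?q)"
    unfolding compose_add_left compose_op_scaleC_left by (intro op_der_linear_right assms in_xy)
  have 2: "op_der \<tau> (?p o\<^sub>L (x + op_scaleC c y)) qs id_blinfun
      = op_der \<tau> (?p o\<^sub>L x) qs id_blinfun + c * op_der \<tau> (?p o\<^sub>L y) qs id_blinfun"
    unfolding compose_add_right compose_op_scaleC_right[OF in_xy(3)] by (intro op_der_linear_left assms in_xy)
  have 3: "\<tau> (?p o\<^sub>L (x + op_scaleC c y)) = \<tau> (?p o\<^sub>L x) + c * \<tau> (?p o\<^sub>L y)"
    unfolding compose_add_right compose_op_scaleC_right[OF in_xy(3)]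
    using in_xy by (simp add: state_add state_scaleC von_neumann_algebra_closed(4)[OF vN])
  have 4: "\<tau> ((x + op_scaleC c y) o\<^sub>L ?q) = \<tau> (x o\<^sub>L ?q) + c * \<tau> (y o\<^sub>L ?q)"
    unfolding compose_add_left compose_op_scaleC_left
    using in_xy by (simp add: state_add state_scaleC von_neumann_algebra_closed(4)[OF vN])
  show ?thesis
    by (simp add: op_der_append 1 2 3 4 algebra_simps)
qed

text \<open>A letter of colour \<open>True\<close> lies in exactly one factor of each of its two
  terms. That factor is the trace of a nonempty alternating product of centred elements, hence
  0.\<close>

lemma op_der_alternating:
  fixes \<A> :: "bool \<Rightarrow> 'h op set"
  assumes free: "free_family \<tau> UNIV \<A>"
    and "\<forall>(b, a)\<in>set (ps @ qs). a \<in> \<A> b \<and> \<tau> a = 0"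
    and "successively (\<lambda>p q. fst p \<noteq> fst q) (ps @ qs)"
  shows "op_der \<tau> (op_prod ps) qs id_blinfun = 0"
  using assms(2,3)
proof (induction qs arbitrary: ps)
  case (Cons q qs)
  have zero: "\<tau> (op_prod rs) = 0"
    if "rs \<noteq> []" "\<forall>(b, a)\<in>set rs. a \<in> \<A> b \<and> \<tau> a = 0" "successively (\<lambda>p q. fst p \<noteq> fst q) rs" for rs
    using free that unfolding free_family_def op_prod_def by fast
  have succ: "successively (\<lambda>p q. fst p \<noteq> fst q) (ps @ [q])" "successively (\<lambda>p q. fst p \<noteq> fst q) (q # qs)"
    using Cons.prems(2) by (auto simp: successively_append_iff successively_Cons)
  have "\<tau> (op_prod (ps @ [q])) = 0" by (rule zero) (use Cons.prems(1) succ in auto)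
  moreover have "\<tau> (op_prod (q # qs)) = 0" by (rule zero) (use Cons.prems(1) succ in auto)
  moreover have "op_der \<tau> (op_prod (ps @ [q])) qs id_blinfun = 0"
    using Cons.prems by (intro Cons.IH) auto
  ultimately show ?case by (simp add: op_prod_append)
qed simp

text \<open>Both sides are multilinear and compatible with merging neighbours of equal colour and with
  dropping scalars, so it suffices to consider alternating products of centred elements.\<close>

lemma op_der_free:
  fixes \<A> :: "bool \<Rightarrow> 'h op set"
  assumes free: "free_family \<tau> UNIV \<A>"
    and sub: "\<And>b. \<A> b \<subseteq> M"
    and closed: "\<And>b x y. x \<in> \<A> b \<Longrightarrow> y \<in> \<A> b \<Longrightarrow> x o\<^sub>L y \<in> \<A> b \<and> x + y \<in> \<A> b"
      "\<And>b x c. x \<in> \<A> b \<Longrightarrow> op_scaleC c x \<in> \<A> b" "\<And>b. id_blinfun \<in> \<A> b"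
    and "\<forall>(b, a)\<in>set ps. a \<in> \<A> b"
  shows "op_der \<tau> id_blinfun ps id_blinfun = 0"
  using assms(6)
\<comment> \<open>Merging two letters shortens the list by one but may create one letter that is not
  centred, so the length is counted twice. Centring a letter keeps the length and lowers the second
  count.\<close>
proof (induction ps rule: measure_induct_rule[where f = "\<lambda>ps. 2 * length ps + length (filter (\<lambda>p. \<tau> (snd p) \<noteq> 0) ps)"])
  case (less ps)
  show ?case
  proof (cases "successively (\<lambda>p q. fst p \<noteq> fst q) ps")
    case False
    then obtain xs p q ys where ps: "ps = xs @ p # q # ys" "\<not> fst p \<noteq> fst q"
      by (rule not_successively_decomp)
    define b x y where "b = fst p" and "x = snd p" and "y = snd q"
    have ps': "ps = xs @ (b, x) # (b, y) # ys" using ps by (simp add: b_def x_def y_def prod_eq_iff)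
    have "op_der \<tau> id_blinfun (xs @ (b, x o\<^sub>L y) # ys) id_blinfun = 0"
      using less.prems closed(1)[of x b y] by (intro less.IH) (auto simp: ps')
    then show ?thesis by (simp add: ps' op_der_merge)
  next
    case alt: True
    show ?thesis
    proof (cases "\<forall>p\<in>set ps. \<tau> (snd p) = 0")
      case True
      then show ?thesis
        using op_der_alternating[OF free, of "[]" ps] alt less.prems by (auto simp: case_prod_beta)
    next
      case False
      then obtain b x xs ys where ps: "ps = xs @ (b, x) # ys" and nz: "\<tau> x \<noteq> 0"
        by (metis split_list surj_pair snd_conv)
      have inM: "snd ` set xs \<subseteq> M" "snd ` set ys \<subseteq> M" "x \<in> M" "id_blinfun \<in> M" and x: "x \<in> \<A> b"
        using less.prems sub closed(3) unfolding ps by fastforce+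
      \<comment> \<open>Splitting off the mean of x: the centred part has one non-centred letter
        fewer, and the scalar part loses the letter altogether.\<close>
      define x0 where "x0 = x + op_scaleC (- \<tau> x) id_blinfun"
      have x0: "x0 \<in> \<A> b" "\<tau> x0 = 0" "x0 \<in> M"
        using x closed sub inM state_id by (auto simp: x0_def state_add state_scaleC von_neumann_algebra_closed[OF vN])
      have "x = x0 + op_scaleC (\<tau> x) id_blinfun"
      proof (rule blinfun_eqI)
        fix y :: "'h"
        have "(- \<tau> x) *\<^sub>C y + \<tau> x *\<^sub>C y = 0"
          using scaleC_add_left[of "- \<tau> x" "\<tau> x" y] scaleR_scaleC[of 0 y] by simp
        then show "blinfun_apply x y = blinfun_apply (x0 + op_scaleC (\<tau> x) id_blinfun) y"
          by (simp add: x0_def blinfun.add_left blinfun_apply_op_scaleC add.assoc)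
      qed
      then have "op_der \<tau> id_blinfun ps id_blinfun
          = op_der \<tau> id_blinfun (xs @ (b, x0) # ys) id_blinfun
            + \<tau> x * op_der \<tau> id_blinfun (xs @ (b, id_blinfun) # ys) id_blinfun"
        using op_der_linear[OF inM(1,2) x0(3) inM(4), of b "\<tau> x"] by (simp add: ps)
      also have "op_der \<tau> id_blinfun (xs @ (b, x0) # ys) id_blinfun = 0"
        using less.prems x0 nz by (intro less.IH) (auto simp: ps)
      also have "op_der \<tau> id_blinfun (xs @ (b, id_blinfun) # ys) id_blinfun = 0"
        unfolding op_der_id using less.prems by (intro less.IH) (auto simp: ps)
      finally show ?thesis by simp
    qed
  qed
qed

end

lemma op_eval_simps [simp]: "op_eval Ys [] = id_blinfun"
  "op_eval Ys ((j, b) # w) = (if b then op_adj (Ys ! j) else Ys ! j) o\<^sub>L op_eval Ys w"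
  by (simp_all add: op_eval_def)

lemma op_eval_append: "op_eval Ys (u @ w) = op_eval Ys u o\<^sub>L op_eval Ys w"
  by (induction u) (auto simp: blinfun_compose_assoc)

lemma op_eval_conv_op_prod:
  "op_eval Ys w = op_prod (map (\<lambda>(j, b). (j < r, if b then op_adj (Ys ! j) else Ys ! j)) w)"
  by (induction w) auto

lemma wsum_free:
  fixes \<tau> :: "'h::complex_hilbert_space op \<Rightarrow> complex"
  assumes "von_neumann_algebra M" "state_on M \<tau>" "set Xs \<subseteq> M" "set vs \<subseteq> M"
    and free: "freely_independent \<tau> Xs vs" and w: "\<forall>(j, b)\<in>set w. j < length (Xs @ vs)"
  shows "wsum (\<lambda>w. \<tau> (op_eval (Xs @ vs) w)) (length Xs) w = 0"
proof -
  let ?A = "\<lambda>b::bool. star_algebra (set (if b then Xs else vs))"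
  define ps where "ps = map (\<lambda>(j, b). (j < length Xs, if b then op_adj ((Xs @ vs) ! j) else (Xs @ vs) ! j)) w"
  have "wsum (\<lambda>w. \<tau> (op_eval (Xs @ vs) w)) (length Xs) w = op_der \<tau> id_blinfun ps id_blinfun"
    unfolding op_der_index wsum_def op_eval_conv_op_prod[where r = "length Xs"]
    by (auto simp: ps_def take_map drop_map case_prod_beta intro!: sum.cong)
  also have "\<dots> = 0"
  proof (rule op_der_free[OF assms(1,2) free[unfolded freely_independent_def]])
    show "?A b \<subseteq> M" for b
      using assms(3,4) by (intro star_algebra_subset[OF assms(1)]) auto
    have "(Xs @ vs) ! j \<in> set (if j < length Xs then Xs else vs)" if "j < length (Xs @ vs)" for j
      using that by (auto simp: nth_append)
    then have "(Xs @ vs) ! j \<in> ?A (j < length Xs)" if "j < length (Xs @ vs)" for j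
      using that by (intro star_algebra.gen) simp
    then show "\<forall>(b, a)\<in>set ps. a \<in> ?A b"
      using w star_algebra.adj by (fastforce simp: ps_def)
  qed (auto intro: star_algebra.intros)
  finally show ?thesis .
qed

section \<open>Complex matrices\<close>

lemma dim_mat_adjoint [simp]: "dim_row (mat_adjoint A) = dim_col A" "dim_col (mat_adjoint A) = dim_row A"
  by (simp_all add: mat_adjoint_def)

lemma index_mat_adjoint [simp]:
  "i < dim_col A \<Longrightarrow> j < dim_row A \<Longrightarrow> mat_adjoint A $$ (i, j) = conjugate (A $$ (j, i))"
  by (simp add: mat_adjoint_def mat_of_rows_index)

lemma mat_adjoint_carrier [simp]: "mat_adjoint A \<in> carrier_mat n m \<longleftrightarrow> A \<in> carrier_mat m n"
  by (simp only: carrier_mat_def mem_Collect_eq dim_mat_adjoint) blast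

lemma index_mat_mult_sum:
  "A \<in> carrier_mat n k \<Longrightarrow> B \<in> carrier_mat k m \<Longrightarrow> i < n \<Longrightarrow> j < m \<Longrightarrow>
    (A * B) $$ (i, j) = (\<Sum>l<k. A $$ (i, l) * B $$ (l, j))"
  by (simp add: scalar_prod_def atLeast0LessThan)

lemma mat_adjoint_mult:
  fixes A B :: "complex mat"
  assumes "A \<in> carrier_mat n k" "B \<in> carrier_mat k m"
  shows "mat_adjoint (A * B) = mat_adjoint B * mat_adjoint A"
proof (rule eq_matI)
  fix i j assume "i < dim_row (mat_adjoint B * mat_adjoint A)" "j < dim_col (mat_adjoint B * mat_adjoint A)"
  with assms have ij: "i < m" "j < n" by auto
  show "mat_adjoint (A * B) $$ (i, j) = (mat_adjoint B * mat_adjoint A) $$ (i, j)"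
    using assms ij by (subst index_mat_mult_sum[where n = m and k = k and m = n])
      (auto simp: index_mat_mult_sum[OF assms] mult.commute simp del: index_mult_mat(1))
qed (use assms in auto)

lemma mat_adjoint_adjoint [simp]: "mat_adjoint (mat_adjoint A) = (A :: complex mat)"
  by (rule eq_matI) auto

lemma mat_adjoint_one [simp]: "mat_adjoint (1\<^sub>m n) = (1\<^sub>m n :: complex mat)"
  by (rule eq_matI) auto

lemma mult_carrier_square [simp]: "A \<in> carrier_mat n n \<Longrightarrow> B \<in> carrier_mat n n \<Longrightarrow> A * B \<in> carrier_mat n n"
  by simp

lemma unitary_group_carrier: "U \<in> unitary_group N \<Longrightarrow> U \<in> carrier_mat N N"
  by (simp add: unitary_group_def)

lemma one_unitary_group: "1\<^sub>m N \<in> unitary_group N"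
  by (simp add: unitary_group_def)

lemma adjoint_unitary_group: "U \<in> unitary_group N \<Longrightarrow> mat_adjoint U \<in> unitary_group N"
  by (simp add: unitary_group_def)

lemma mult_cancel_middle:
  fixes A B C D :: "'a::comm_ring_1 mat"
  assumes "A \<in> carrier_mat N N" "B \<in> carrier_mat N N" "C \<in> carrier_mat N N" "D \<in> carrier_mat N N"
    and "B * C = 1\<^sub>m N"
  shows "(A * B) * (C * D) = A * D"
proof -
  have "(A * B) * (C * D) = A * (B * C) * D"
    using assms(1-4) by (simp add: assoc_mult_mat[of _ N N _ N _ N])
  then show ?thesis using assms by simp
qed

lemma mult_unitary_group:
  assumes "U \<in> unitary_group N" "V \<in> unitary_group N"
  shows "U * V \<in> unitary_group N"
proof -
  have c: "U \<in> carrier_mat N N" "V \<in> carrier_mat N N" "mat_adjoint U \<in> carrier_mat N N" "mat_adjoint V \<in> carrier_mat N N"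
    and e: "U * mat_adjoint U = 1\<^sub>m N" "mat_adjoint U * U = 1\<^sub>m N" "V * mat_adjoint V = 1\<^sub>m N" "mat_adjoint V * V = 1\<^sub>m N"
    using assms by (auto simp: unitary_group_def)
  have "U * V * (mat_adjoint V * mat_adjoint U) = 1\<^sub>m N" "mat_adjoint V * mat_adjoint U * (U * V) = 1\<^sub>m N"
    using mult_cancel_middle[OF c(1,2,4,3) e(3)] mult_cancel_middle[OF c(4,3,1,2) e(2)] e by simp_all
  then show ?thesis using c by (simp add: unitary_group_def mat_adjoint_mult[OF c(1,2)])
qed

lemma ntrace_comm:
  assumes "A \<in> carrier_mat N N" "B \<in> carrier_mat N N"
  shows "ntrace N (A * B) = ntrace N (B * A)"
proof -
  have "(\<Sum>i<N. (A * B) $$ (i, i)) = (\<Sum>i<N. \<Sum>j<N. A $$ (i, j) * B $$ (j, i))"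
    by (intro sum.cong) (auto simp: index_mat_mult_sum[OF assms])
  also have "\<dots> = (\<Sum>j<N. \<Sum>i<N. A $$ (i, j) * B $$ (j, i))" by (rule sum.swap)
  also have "\<dots> = (\<Sum>j<N. (B * A) $$ (j, j))"
    by (intro sum.cong) (auto simp: index_mat_mult_sum[OF assms(2,1)] mult.commute)
  finally show ?thesis by (simp add: ntrace_def)
qed

lemma unitary_group_cols:
  assumes "W \<in> unitary_group N" "k < N" "l < N"
  shows "(\<Sum>i<N. W $$ (i, k) * cnj (W $$ (i, l))) = (if k = l then 1 else 0)"
proof -
  have c: "W \<in> carrier_mat N N" "mat_adjoint W \<in> carrier_mat N N" and e: "mat_adjoint W * W = 1\<^sub>m N"
    using assms by (auto simp: unitary_group_def)
  have "(mat_adjoint W * W) $$ (l, k) = (\<Sum>i<N. mat_adjoint W $$ (l, i) * W $$ (i, k))"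
    using assms by (intro index_mat_mult_sum[OF c(2,1)])
  also have "\<dots> = (\<Sum>i<N. W $$ (i, k) * cnj (W $$ (i, l)))"
    using assms c by (intro sum.cong) (auto simp: mult.commute)
  finally show ?thesis using e assms by auto
qed

text \<open>The standard inner product of complex N-space on functions, of which only the values
  below N matter; columns of matrices and Gram-Schmidt residuals come as functions.\<close>

definition ip :: "nat \<Rightarrow> (nat \<Rightarrow> complex) \<Rightarrow> (nat \<Rightarrow> complex) \<Rightarrow> complex" where
  "ip N u w = (\<Sum>i<N. u i * cnj (w i))"

lemma ip_unitary:
  assumes "W \<in> unitary_group N"
  shows "ip N (\<lambda>i. \<Sum>k<N. W $$ (i, k) * u k) (\<lambda>i. \<Sum>k<N. W $$ (i, k) * w k) = ip N u w"
proof -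
  have "ip N (\<lambda>i. \<Sum>k<N. W $$ (i, k) * u k) (\<lambda>i. \<Sum>k<N. W $$ (i, k) * w k)
      = (\<Sum>i<N. \<Sum>k<N. \<Sum>l<N. (u k * cnj (w l)) * (W $$ (i, k) * cnj (W $$ (i, l))))"
    unfolding ip_def by (simp add: sum_product ac_simps)
  also have "\<dots> = (\<Sum>k<N. \<Sum>l<N. \<Sum>i<N. (u k * cnj (w l)) * (W $$ (i, k) * cnj (W $$ (i, l))))"
    by (subst sum.swap, intro sum.cong refl sum.swap)
  also have "\<dots> = (\<Sum>k<N. \<Sum>l<N. (u k * cnj (w l)) * (if k = l then 1 else 0))"
    by (intro sum.cong refl, subst sum_distrib_left[symmetric])
      (use unitary_group_cols[OF assms] in auto)
  also have "\<dots> = ip N u w" by (simp add: ip_def if_distrib cong: if_cong)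
  finally show ?thesis .
qed

lemma ip_cong: "(\<And>i. i < N \<Longrightarrow> u i = u' i) \<Longrightarrow> (\<And>i. i < N \<Longrightarrow> w i = w' i) \<Longrightarrow> ip N u w = ip N u' w'"
  by (simp add: ip_def)

lemma ip_self: "ip N u u = of_real (\<Sum>i<N. cmod (u i) ^ 2)"
  unfolding ip_def of_real_sum by (intro sum.cong refl) (simp only: complex_norm_square)

lemma ip_self_eq_0: "ip N u u = 0 \<longleftrightarrow> (\<forall>i<N. u i = 0)"
  by (simp only: ip_self of_real_eq_0_iff) (simp add: sum_nonneg_eq_0_iff Ball_def)

lemma ip_commute: "ip N u w = cnj (ip N w u)"
  by (simp add: ip_def mult.commute)

section \<open>Haar measure on the unitary group\<close>

abbreviation sq_index :: "nat \<Rightarrow> (nat \<times> nat) set" where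
  "sq_index N \<equiv> {..<N} \<times> {..<N}"

text \<open>Matrices appear as extensional functions on pairs of indices, so that Lebesgue measure
  is a finite product measure.\<close>

definition leb_mat :: "nat \<Rightarrow> (nat \<times> nat \<Rightarrow> complex) measure" where
  "leb_mat N = (\<Pi>\<^sub>M p\<in>sq_index N. lborel)"

definition fn_add :: "nat \<Rightarrow> (nat \<times> nat \<Rightarrow> complex) \<Rightarrow> (nat \<times> nat \<Rightarrow> complex) \<Rightarrow> nat \<times> nat \<Rightarrow> complex" where
  "fn_add N x y = (\<lambda>p\<in>sq_index N. x p + y p)"

definition fn_diff :: "nat \<Rightarrow> (nat \<times> nat \<Rightarrow> complex) \<Rightarrow> (nat \<times> nat \<Rightarrow> complex) \<Rightarrow> nat \<times> nat \<Rightarrow> complex" where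
  "fn_diff N x y = (\<lambda>p\<in>sq_index N. x p - y p)"

definition fn_act :: "nat \<Rightarrow> complex mat \<Rightarrow> (nat \<times> nat \<Rightarrow> complex) \<Rightarrow> nat \<times> nat \<Rightarrow> complex" where
  "fn_act N W x = (\<lambda>(i, j)\<in>sq_index N. \<Sum>k<N. W $$ (i, k) * x (k, j))"

definition fn_sqnorm :: "nat \<Rightarrow> (nat \<times> nat \<Rightarrow> complex) \<Rightarrow> real" where
  "fn_sqnorm N x = (\<Sum>p\<in>sq_index N. cmod (x p) ^ 2)"

lemma lborel_complex_sigma_finite: "product_sigma_finite (\<lambda>_. lborel :: complex measure)"
  by standard

lemma sigma_finite_leb_mat: "sigma_finite_measure (leb_mat N)"
  unfolding leb_mat_def by (rule product_sigma_finite.sigma_finite[OF lborel_complex_sigma_finite]) simp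

lemma pair_sigma_finite_leb_mat: "pair_sigma_finite (leb_mat N) (leb_mat N)"
  by (simp add: pair_sigma_finite_def sigma_finite_leb_mat)

lemma space_leb_mat: "space (leb_mat N) = extensional (sq_index N)"
  by (simp add: leb_mat_def space_PiM PiE_UNIV_domain PiE_def)

lemma measurable_into_leb_mat:
  assumes "\<And>p. p \<in> sq_index N \<Longrightarrow> (\<lambda>x. f x p) \<in> borel_measurable M" "\<And>x. x \<in> space M \<Longrightarrow> f x \<in> extensional (sq_index N)"
  shows "f \<in> measurable M (leb_mat N)"
proof -
  have "(\<lambda>x. \<lambda>p\<in>sq_index N. f x p) \<in> measurable M (leb_mat N)"
    unfolding leb_mat_def by (rule measurable_restrict) (use assms in auto)
  moreover have "(\<lambda>p\<in>sq_index N. f x p) = f x" if "x \<in> space M" for x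
    using assms(2)[OF that] by (simp add: extensional_restrict)
  ultimately show ?thesis by (simp cong: measurable_cong)
qed

lemma measurable_leb_mat_component:
  "p \<in> sq_index N \<Longrightarrow> (\<lambda>x. x p) \<in> borel_measurable (leb_mat N)"
  using measurable_component_singleton[of p "sq_index N" "\<lambda>_. lborel :: complex measure"]
  by (simp add: leb_mat_def)

lemma measurable_component_compose:
  assumes "f \<in> measurable M (leb_mat N)" "p \<in> sq_index N"
  shows "(\<lambda>x. f x p) \<in> borel_measurable M"
  using measurable_compose[OF assms(1) measurable_leb_mat_component[OF assms(2)]] .

lemma measurable_fn_add:
  assumes "f \<in> measurable M (leb_mat N)" "g \<in> measurable M (leb_mat N)"
  shows "(\<lambda>x. fn_add N (f x) (g x)) \<in> measurable M (leb_mat N)"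
proof (rule measurable_into_leb_mat)
  fix p assume p: "p \<in> sq_index N"
  show "(\<lambda>x. fn_add N (f x) (g x) p) \<in> borel_measurable M"
    using measurable_component_compose[OF assms(1) p] measurable_component_compose[OF assms(2) p] p
    by (simp add: fn_add_def)
qed (simp add: fn_add_def)

lemma measurable_fn_diff:
  assumes "f \<in> measurable M (leb_mat N)" "g \<in> measurable M (leb_mat N)"
  shows "(\<lambda>x. fn_diff N (f x) (g x)) \<in> measurable M (leb_mat N)"
proof (rule measurable_into_leb_mat)
  fix p assume p: "p \<in> sq_index N"
  show "(\<lambda>x. fn_diff N (f x) (g x) p) \<in> borel_measurable M"
    using measurable_component_compose[OF assms(1) p] measurable_component_compose[OF assms(2) p] p
    by (simp add: fn_diff_def)
qed (simp add: fn_diff_def)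

lemma measurable_fn_act:
  assumes "f \<in> measurable M (leb_mat N)"
  shows "(\<lambda>x. fn_act N W (f x)) \<in> measurable M (leb_mat N)"
proof (rule measurable_into_leb_mat)
  fix p assume p: "p \<in> sq_index N"
  have "(\<lambda>x. f x (k, snd p)) \<in> borel_measurable M" if "k < N" for k
    using measurable_component_compose[OF assms, of "(k, snd p)"] p that by auto
  then show "(\<lambda>x. fn_act N W (f x) p) \<in> borel_measurable M"
    using p by (auto simp: fn_act_def)
qed (simp add: fn_act_def)

lemma measurable_fn_sqnorm: "fn_sqnorm N \<in> borel_measurable (leb_mat N)"
  unfolding fn_sqnorm_def
proof (intro borel_measurable_sum borel_measurable_power)
  fix p assume "p \<in> sq_index N"
  from measurable_leb_mat_component[OF this] show "(\<lambda>x. cmod (x p)) \<in> borel_measurable (leb_mat N)"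
    by (rule measurable_compose) simp
qed

text \<open>It suffices to compare the measures of boxes, where this is translation invariance of
  \<open>lborel\<close> in every coordinate.\<close>

lemma leb_mat_translate:
  assumes f: "f \<in> borel_measurable (leb_mat N)"
  shows "(\<integral>\<^sup>+x. f (fn_add N x y) \<partial>leb_mat N) = (\<integral>\<^sup>+x. f x \<partial>leb_mat N)"
proof -
  have m: "(\<lambda>x. fn_add N x y) \<in> measurable (leb_mat N) (leb_mat N)"
  proof (rule measurable_into_leb_mat)
    fix p assume p: "p \<in> sq_index N"
    then show "(\<lambda>x. fn_add N x y p) \<in> borel_measurable (leb_mat N)"
      using measurable_leb_mat_component[OF p] by (simp add: fn_add_def)
  qed (simp add: fn_add_def)
  have "distr (leb_mat N) (leb_mat N) (\<lambda>x. fn_add N x y) = (\<Pi>\<^sub>M p\<in>sq_index N. lborel)"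
  proof (rule product_sigma_finite.PiM_eqI[OF lborel_complex_sigma_finite])
    fix A assume A: "\<And>p. p \<in> sq_index N \<Longrightarrow> A p \<in> sets (lborel :: complex measure)"
    have pre: "(\<lambda>x. fn_add N x y) -` PiE (sq_index N) A \<inter> space (leb_mat N)
        = PiE (sq_index N) (\<lambda>p. (+) (y p) -` A p)"
      by (auto simp: space_leb_mat fn_add_def PiE_def Pi_def extensional_def add.commute)
    have A': "(+) (y p) -` A p \<in> sets lborel" if "p \<in> sq_index N" for p
      using measurable_sets[of "(+) (y p)" borel borel "A p"] A[OF that] by simp
    have "PiE (sq_index N) A \<in> sets (leb_mat N)"
      unfolding leb_mat_def by (rule sets_PiM_I_finite) (use A in auto)
    then have "emeasure (distr (leb_mat N) (leb_mat N) (\<lambda>x. fn_add N x y)) (PiE (sq_index N) A)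
        = emeasure (leb_mat N) (PiE (sq_index N) (\<lambda>p. (+) (y p) -` A p))"
      by (simp add: emeasure_distr[OF m] pre)
    also have "\<dots> = (\<Prod>p\<in>sq_index N. emeasure lborel ((+) (y p) -` A p))"
      unfolding leb_mat_def
      by (rule product_sigma_finite.emeasure_PiM[OF lborel_complex_sigma_finite]) (use A' in auto)
    also have "\<dots> = (\<Prod>p\<in>sq_index N. emeasure lborel (A p))"
    proof (rule prod.cong[OF refl])
      fix p assume "p \<in> sq_index N"
      then have "emeasure (distr lborel borel ((+) (y p))) (A p) = emeasure lborel ((+) (y p) -` A p)"
        using A by (subst emeasure_distr) auto
      then show "emeasure lborel ((+) (y p) -` A p) = emeasure lborel (A p)"
        by (simp add: lborel_distr_plus)
    qed
    finally show "emeasure (distr (leb_mat N) (leb_mat N) (\<lambda>x. fn_add N x y)) (PiE (sq_index N) A)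
        = (\<Prod>p\<in>sq_index N. emeasure lborel (A p))" .
  qed (simp_all add: leb_mat_def)
  then have d: "distr (leb_mat N) (leb_mat N) (\<lambda>x. fn_add N x y) = leb_mat N"
    by (simp add: leb_mat_def)
  have "(\<integral>\<^sup>+x. f x \<partial>leb_mat N) = (\<integral>\<^sup>+x. f x \<partial>distr (leb_mat N) (leb_mat N) (\<lambda>x. fn_add N x y))"
    by (simp only: d)
  also have "\<dots> = (\<integral>\<^sup>+x. f (fn_add N x y) \<partial>leb_mat N)"
    by (rule nn_integral_distr[OF m]) (simp add: f)
  finally show ?thesis by simp
qed

lemma fn_act_act:
  assumes "U \<in> carrier_mat N N" "V \<in> carrier_mat N N"
  shows "fn_act N U (fn_act N V x) = fn_act N (U * V) x"
proof (rule ext, clarify)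
  fix i j
  show "fn_act N U (fn_act N V x) (i, j) = fn_act N (U * V) x (i, j)"
  proof (cases "i < N \<and> j < N")
    case True
    then have "fn_act N U (fn_act N V x) (i, j) = (\<Sum>k<N. U $$ (i, k) * (\<Sum>l<N. V $$ (k, l) * x (l, j)))"
      by (simp add: fn_act_def)
    also have "\<dots> = (\<Sum>l<N. (\<Sum>k<N. U $$ (i, k) * V $$ (k, l)) * x (l, j))"
      unfolding sum_distrib_left sum_distrib_right by (subst sum.swap) (simp add: mult.assoc)
    also have "\<dots> = (\<Sum>l<N. (U * V) $$ (i, l) * x (l, j))"
      using True by (intro sum.cong) (auto simp: index_mat_mult_sum[OF assms] simp del: index_mult_mat)
    finally show ?thesis using True by (simp add: fn_act_def)
  qed (auto simp: fn_act_def)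
qed

lemma fn_act_one: "x \<in> extensional (sq_index N) \<Longrightarrow> fn_act N (1\<^sub>m N) x = x"
proof (rule ext, clarify)
  fix i j assume x: "x \<in> extensional (sq_index N)"
  show "fn_act N (1\<^sub>m N) x (i, j) = x (i, j)"
  proof (cases "i < N \<and> j < N")
    case True
    then show ?thesis by (simp add: fn_act_def if_distrib[of "\<lambda>z. z * _"] cong: if_cong)
  qed (use x in \<open>auto simp: fn_act_def extensional_def\<close>)
qed

lemma fn_sqnorm_act:
  assumes "W \<in> unitary_group N"
  shows "fn_sqnorm N (fn_act N W x) = fn_sqnorm N x"
proof -
  have col: "fn_sqnorm N z = (\<Sum>j<N. \<Sum>i<N. cmod (z (i, j)) ^ 2)" for z
    unfolding fn_sqnorm_def by (subst sum.swap) (simp add: sum.cartesian_product)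
  have "(\<Sum>i<N. cmod (fn_act N W x (i, j)) ^ 2) = (\<Sum>i<N. cmod (x (i, j)) ^ 2)" if "j < N" for j
  proof -
    have "ip N (\<lambda>i. fn_act N W x (i, j)) (\<lambda>i. fn_act N W x (i, j)) = ip N (\<lambda>i. x (i, j)) (\<lambda>i. x (i, j))"
      using that by (subst ip_unitary[OF assms, symmetric], intro ip_cong) (auto simp: fn_act_def)
    then show ?thesis unfolding ip_self of_real_eq_iff .
  qed
  then show ?thesis by (simp add: col)
qed

text \<open>Uniqueness of translation invariant measures by Fubini's theorem: test against a ball,
  which is invariant under \<open>W\<close> and under the reflection at the origin.\<close>

lemma leb_mat_unitary_invariant:
  assumes W: "W \<in> unitary_group N" and f[measurable]: "f \<in> borel_measurable (leb_mat N)"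
    and ball: "emeasure (leb_mat N) {x\<in>space (leb_mat N). fn_sqnorm N x \<le> r} \<noteq> 0"
      "emeasure (leb_mat N) {x\<in>space (leb_mat N). fn_sqnorm N x \<le> r} \<noteq> \<infinity>"
  shows "(\<integral>\<^sup>+x. f (fn_act N W x) \<partial>leb_mat N) = (\<integral>\<^sup>+x. f x \<partial>leb_mat N)"
proof -
  let ?L = "leb_mat N"
  let ?B = "{x\<in>space ?L. fn_sqnorm N x \<le> r}"
  define g :: "_ \<Rightarrow> ennreal" where "g = indicator ?B"
  have B[measurable]: "?B \<in> sets ?L" using measurable_fn_sqnorm by measurable
  have g[measurable]: "g \<in> borel_measurable ?L" unfolding g_def by measurable
  have W': "mat_adjoint W \<in> unitary_group N" by (rule adjoint_unitary_group[OF W])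
  define T where "T = fn_act N W"
  define T' where "T' = fn_act N (mat_adjoint W)"
  have TT': "T (T' y) = y" if "y \<in> space ?L" for y
    using W that fn_act_act[of W N "mat_adjoint W" y] fn_act_one[of y N]
    by (simp add: T_def T'_def unitary_group_def space_leb_mat)
  note [measurable (raw)] = measurable_fn_add measurable_fn_diff measurable_fn_act
  have T_add: "fn_add N (T x) y = T (fn_add N x (T' y))" if "y \<in> space ?L" for x y
  proof -
    have "T (fn_add N x (T' y)) = fn_add N (T x) (T (T' y))"
      by (auto simp: T_def fn_act_def fn_add_def fun_eq_iff sum.distrib distrib_left restrict_def)
    then show ?thesis by (simp add: TT'[OF that])
  qed
  \<comment> \<open>Both invariances of the ball are used here: y - T x = T (T' y - x) has the norm
    of x - T' y. In the variable x this is a translation, to which \<open>leb_mat_translate\<close>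
    applies.\<close>
  have g_diff: "g (fn_diff N y (T x)) = g (fn_add N x (fn_diff N (\<lambda>_. 0) (T' y)))" if y: "y \<in> space ?L" for x y
  proof -
    have "fn_diff N y (T x) = fn_diff N (T (T' y)) (T x)" by (simp add: TT'[OF y])
    also have "\<dots> = T (fn_diff N (T' y) x)"
      by (auto simp: T_def fn_act_def fn_diff_def fun_eq_iff sum_subtractf right_diff_distrib restrict_def)
    finally have "fn_sqnorm N (fn_diff N y (T x)) = fn_sqnorm N (fn_diff N (T' y) x)"
      using fn_sqnorm_act[OF W] by (simp add: T_def)
    also have "\<dots> = fn_sqnorm N (fn_add N x (fn_diff N (\<lambda>_. 0) (T' y)))"
      unfolding fn_sqnorm_def by (intro sum.cong) (auto simp: fn_diff_def fn_add_def norm_minus_commute)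
    finally show ?thesis
      by (auto simp: g_def indicator_def space_leb_mat fn_diff_def fn_add_def)
  qed
  have "(\<integral>\<^sup>+y. g y * (\<integral>\<^sup>+x. f (T x) \<partial>?L) \<partial>?L) = (\<integral>\<^sup>+y. \<integral>\<^sup>+x. g y * f (fn_add N (T x) y) \<partial>?L \<partial>?L)"
  proof (rule nn_integral_cong)
    fix y assume y: "y \<in> space ?L"
    have "(\<integral>\<^sup>+x. g y * f (fn_add N (T x) y) \<partial>?L) = g y * (\<integral>\<^sup>+x. f (fn_add N (T x) y) \<partial>?L)"
      using y by (intro nn_integral_cmult) (auto simp: T_def)
    also have "(\<integral>\<^sup>+x. f (fn_add N (T x) y) \<partial>?L) = (\<integral>\<^sup>+x. f (T (fn_add N x (T' y))) \<partial>?L)"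
      by (simp add: T_add[OF y])
    also have "\<dots> = (\<integral>\<^sup>+x. f (T x) \<partial>?L)"
      by (rule leb_mat_translate[of "\<lambda>x. f (T x)"]) (simp add: T_def)
    finally show "g y * (\<integral>\<^sup>+x. f (T x) \<partial>?L) = (\<integral>\<^sup>+x. g y * f (fn_add N (T x) y) \<partial>?L)" by simp
  qed
  also have "\<dots> = (\<integral>\<^sup>+x. \<integral>\<^sup>+y. g y * f (fn_add N (T x) y) \<partial>?L \<partial>?L)"
    by (rule pair_sigma_finite.Fubini'[OF pair_sigma_finite_leb_mat]) (simp add: T_def)
  \<comment> \<open>Translating y by T x moves the dependence on x from f to the indicator of the
    ball.\<close>
  also have "\<dots> = (\<integral>\<^sup>+x. \<integral>\<^sup>+y. g (fn_diff N y (T x)) * f y \<partial>?L \<partial>?L)"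
  proof (rule nn_integral_cong)
    fix x assume x: "x \<in> space ?L"
    have *: "fn_diff N (fn_add N y (T x)) (T x) = y" "fn_add N (T x) y = fn_add N y (T x)" if "y \<in> space ?L" for y
      using that by (auto simp: fn_diff_def fn_add_def space_leb_mat extensional_def fun_eq_iff)
    have "(\<integral>\<^sup>+y. g y * f (fn_add N (T x) y) \<partial>?L)
        = (\<integral>\<^sup>+y. (\<lambda>y. g (fn_diff N y (T x)) * f y) (fn_add N y (T x)) \<partial>?L)"
      by (intro nn_integral_cong) (simp add: *)
    also have "\<dots> = (\<integral>\<^sup>+y. g (fn_diff N y (T x)) * f y \<partial>?L)"
      by (rule leb_mat_translate) (use x in \<open>simp add: T_def\<close>)
    finally show "(\<integral>\<^sup>+y. g y * f (fn_add N (T x) y) \<partial>?L) = (\<integral>\<^sup>+y. g (fn_diff N y (T x)) * f y \<partial>?L)" .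
  qed
  also have "\<dots> = (\<integral>\<^sup>+y. \<integral>\<^sup>+x. g (fn_diff N y (T x)) * f y \<partial>?L \<partial>?L)"
    by (rule pair_sigma_finite.Fubini'[OF pair_sigma_finite_leb_mat, symmetric]) (simp add: T_def)
  also have "\<dots> = (\<integral>\<^sup>+y. (\<integral>\<^sup>+x. g x \<partial>?L) * f y \<partial>?L)"
  proof (rule nn_integral_cong)
    fix y assume y: "y \<in> space ?L"
    have "(\<integral>\<^sup>+x. g (fn_diff N y (T x)) * f y \<partial>?L) = (\<integral>\<^sup>+x. g (fn_diff N y (T x)) \<partial>?L) * f y"
      using y by (intro nn_integral_multc) (simp add: T_def)
    also have "(\<integral>\<^sup>+x. g (fn_diff N y (T x)) \<partial>?L) = (\<integral>\<^sup>+x. g x \<partial>?L)"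
      by (simp add: g_diff[OF y] leb_mat_translate)
    finally show "(\<integral>\<^sup>+x. g (fn_diff N y (T x)) * f y \<partial>?L) = (\<integral>\<^sup>+x. g x \<partial>?L) * f y" .
  qed
  also have "\<dots> = (\<integral>\<^sup>+x. g x \<partial>?L) * (\<integral>\<^sup>+y. f y \<partial>?L)"
    by (rule nn_integral_cmult) measurable
  also have "(\<integral>\<^sup>+y. g y * (\<integral>\<^sup>+x. f (T x) \<partial>?L) \<partial>?L) = (\<integral>\<^sup>+x. g x \<partial>?L) * (\<integral>\<^sup>+x. f (T x) \<partial>?L)"
    by (rule nn_integral_multc) measurable
  finally have "emeasure ?L ?B * (\<integral>\<^sup>+x. f (T x) \<partial>?L) = emeasure ?L ?B * (\<integral>\<^sup>+x. f x \<partial>?L)"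
    unfolding g_def using B by simp
  \<comment> \<open>The ball has positive finite measure, so it cancels.\<close>
  then show ?thesis
    using ball by (simp add: T_def ennreal_mult_cancel_left)
qed

text \<open>Gram--Schmidt residuals: column \<open>j\<close> minus its projection onto the previous columns. They are
  equivariant under \<open>fn_act N W\<close> for unitary \<open>W\<close>.\<close>

function gs_res :: "nat \<Rightarrow> (nat \<times> nat \<Rightarrow> complex) \<Rightarrow> nat \<Rightarrow> nat \<Rightarrow> complex" where
  "gs_res N x j = (\<lambda>i. x (i, j) - (\<Sum>k<j. ip N (\<lambda>i. x (i, j)) (gs_res N x k)
      / ip N (gs_res N x k) (gs_res N x k) * gs_res N x k i))"
  by auto
termination by (relation "Wellfounded.measure (\<lambda>(N, x, j). j)") auto

declare gs_res.simps [simp del]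

lemma ip_diff_sum_left: "ip N (\<lambda>i. u i - (\<Sum>k\<in>K. c k * w k i)) z = ip N u z - (\<Sum>k\<in>K. c k * ip N (w k) z)"
proof -
  have "ip N (\<lambda>i. u i - (\<Sum>k\<in>K. c k * w k i)) z
      = ip N u z - (\<Sum>i<N. \<Sum>k\<in>K. c k * (w k i * cnj (z i)))"
    by (simp add: ip_def left_diff_distrib sum_subtractf sum_distrib_right mult.assoc)
  also have "(\<Sum>i<N. \<Sum>k\<in>K. c k * (w k i * cnj (z i))) = (\<Sum>k\<in>K. c k * ip N (w k) z)"
    by (subst sum.swap) (simp add: ip_def sum_distrib_left)
  finally show ?thesis .
qed

text \<open>By induction all terms of the projection sum vanish against residual k except the k-th
  one, which removes exactly the component along residual k; for this its norm in the denominator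
  must not be 0.\<close>

lemma gs_res_orthogonal:
  assumes nz: "\<forall>k<n. ip N (gs_res N x k) (gs_res N x k) \<noteq> 0"
  shows "j < n \<Longrightarrow> k < j \<Longrightarrow> ip N (gs_res N x j) (gs_res N x k) = 0"
proof (induction j arbitrary: k rule: less_induct)
  case (less j)
  have off: "ip N (gs_res N x l) (gs_res N x k) = 0" if "l < j" "l \<noteq> k" for l
  proof (cases "k < l")
    case True
    then show ?thesis using less.IH[OF \<open>l < j\<close>, of k] less.prems that by simp
  next
    case False
    then have "ip N (gs_res N x k) (gs_res N x l) = 0" using less.IH[of k l] less.prems that by simp
    then show ?thesis by (subst ip_commute) simp
  qed
  let ?c = "\<lambda>l. ip N (\<lambda>i. x (i, j)) (gs_res N x l) / ip N (gs_res N x l) (gs_res N x l)"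
  have "ip N (gs_res N x j) (gs_res N x k) = ip N (\<lambda>i. x (i, j)) (gs_res N x k)
      - (\<Sum>l<j. ?c l * ip N (gs_res N x l) (gs_res N x k))"
    by (subst gs_res.simps[of N x j], rule ip_diff_sum_left)
  also have "(\<Sum>l<j. ?c l * ip N (gs_res N x l) (gs_res N x k))
      = (\<Sum>l<j. if l = k then ip N (\<lambda>i. x (i, j)) (gs_res N x k) else 0)"
    using off nz less.prems by (intro sum.cong refl) auto
  finally show ?case using less.prems by simp
qed

text \<open>Expresses the residual through the original columns instead of the earlier residuals. A
  vanishing residual thus becomes a linear relation between columns in which column j has
  coefficient 1.\<close>

lemma gs_res_span: "\<exists>c. \<forall>i. gs_res N x j i = x (i, j) - (\<Sum>k<j. c k * x (i, k))"
proof (induction j rule: less_induct)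
  case (less j)
  then have "\<forall>l. \<exists>c. l < j \<longrightarrow> (\<forall>i. gs_res N x l i = x (i, l) - (\<Sum>k<l. c k * x (i, k)))" by blast
  then obtain c where c: "\<And>l i. l < j \<Longrightarrow> gs_res N x l i = x (i, l) - (\<Sum>k<l. c l k * x (i, k))"
    by metis
  define d where "d l = ip N (\<lambda>i. x (i, j)) (gs_res N x l) / ip N (gs_res N x l) (gs_res N x l)" for l
  define e where "e k = d k - (\<Sum>l<j. if k < l then d l * c l k else 0)" for k
  have "gs_res N x j i = x (i, j) - (\<Sum>k<j. e k * x (i, k))" for i
  proof -
    have inner: "(\<Sum>k<l. c l k * x (i, k)) = (\<Sum>k<j. if k < l then c l k * x (i, k) else 0)" if "l < j" for l
      using that by (intro sum.mono_neutral_cong_left) auto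
    have "gs_res N x j i = x (i, j) - (\<Sum>l<j. d l * gs_res N x l i)"
      by (subst gs_res.simps[of N x j]) (simp add: d_def)
    also have "(\<Sum>l<j. d l * gs_res N x l i)
        = (\<Sum>l<j. d l * x (i, l)) - (\<Sum>l<j. \<Sum>k<j. (if k < l then d l * c l k else 0) * x (i, k))"
      unfolding sum_subtractf[symmetric]
    proof (rule sum.cong[OF refl])
      fix l assume "l \<in> {..<j}"
      then have "d l * gs_res N x l i = d l * x (i, l) - d l * (\<Sum>k<j. if k < l then c l k * x (i, k) else 0)"
        by (simp add: c inner right_diff_distrib)
      also have "d l * (\<Sum>k<j. if k < l then c l k * x (i, k) else 0)
          = (\<Sum>k<j. (if k < l then d l * c l k else 0) * x (i, k))"
        unfolding sum_distrib_left by (rule sum.cong) auto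
      finally show "d l * gs_res N x l i = d l * x (i, l) - (\<Sum>k<j. (if k < l then d l * c l k else 0) * x (i, k))" .
    qed
    also have "(\<Sum>l<j. \<Sum>k<j. (if k < l then d l * c l k else 0) * x (i, k))
        = (\<Sum>k<j. (\<Sum>l<j. if k < l then d l * c l k else 0) * x (i, k))"
      by (subst sum.swap) (simp add: sum_distrib_right)
    finally show ?thesis
      by (simp add: e_def left_diff_distrib sum_subtractf)
  qed
  then show ?case by blast
qed

text \<open>The projection coefficients are quotients of inner products, which
  \<open>ip_unitary\<close> preserves; the rest is linearity of multiplication by W.\<close>

lemma gs_res_act:
  assumes W: "W \<in> unitary_group N"
  shows "j < N \<Longrightarrow> i < N \<Longrightarrow> gs_res N (fn_act N W x) j i = (\<Sum>l<N. W $$ (i, l) * gs_res N x j l)"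
proof (induction j arbitrary: i rule: less_induct)
  case (less j)
  have IH: "gs_res N (fn_act N W x) k i = (\<Sum>l<N. W $$ (i, l) * gs_res N x k l)" if "k < j" "i < N" for k i
    using less.IH[of k i] less.prems that by simp
  have col: "fn_act N W x (i, j) = (\<Sum>l<N. W $$ (i, l) * x (l, j))" if "i < N" for i
    using that less.prems by (simp add: fn_act_def)
  have ip1: "ip N (\<lambda>i. fn_act N W x (i, j)) (gs_res N (fn_act N W x) k) = ip N (\<lambda>i. x (i, j)) (gs_res N x k)"
    and ip2: "ip N (gs_res N (fn_act N W x) k) (gs_res N (fn_act N W x) k) = ip N (gs_res N x k) (gs_res N x k)"
    if "k < j" for k
    using that by (subst ip_unitary[OF W, symmetric], intro ip_cong; simp add: col IH)+
  define q where "q k = ip N (\<lambda>i. x (i, j)) (gs_res N x k) / ip N (gs_res N x k) (gs_res N x k)" for k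
  have res: "gs_res N x j l = x (l, j) - (\<Sum>k<j. q k * gs_res N x k l)" for l
    unfolding q_def by (subst gs_res.simps[of N x j]) (rule refl)
  have "gs_res N (fn_act N W x) j i = fn_act N W x (i, j) - (\<Sum>k<j. q k * (\<Sum>l<N. W $$ (i, l) * gs_res N x k l))"
    by (subst gs_res.simps[of _ "fn_act N W x"]) (simp add: ip1 ip2 IH less.prems q_def)
  also have "(\<Sum>k<j. q k * (\<Sum>l<N. W $$ (i, l) * gs_res N x k l))
      = (\<Sum>l<N. \<Sum>k<j. W $$ (i, l) * (q k * gs_res N x k l))"
    unfolding sum_distrib_left by (subst sum.swap) (simp add: ac_simps)
  also have "fn_act N W x (i, j) - \<dots> = (\<Sum>l<N. W $$ (i, l) * gs_res N x j l)"
    by (simp add: res col less.prems right_diff_distrib sum_subtractf sum_distrib_left)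
  finally show ?case .
qed

lemma measurable_cnj: "f \<in> borel_measurable M \<Longrightarrow> (\<lambda>x. cnj (f x)) \<in> borel_measurable M"
  by (rule measurable_compose, assumption, rule borel_measurable_continuous_onI) (intro continuous_intros)

lemma measurable_ip:
  assumes "\<And>i. i < N \<Longrightarrow> (\<lambda>x. u x i) \<in> borel_measurable M" "\<And>i. i < N \<Longrightarrow> (\<lambda>x. w x i) \<in> borel_measurable M"
  shows "(\<lambda>x. ip N (u x) (w x)) \<in> borel_measurable M"
  unfolding ip_def
  by (intro borel_measurable_sum borel_measurable_times measurable_cnj) (use assms in auto)

lemma measurable_gs_res:
  "j < N \<Longrightarrow> i < N \<Longrightarrow> (\<lambda>x. gs_res N x j i) \<in> borel_measurable (leb_mat N)"
proof (induction j arbitrary: i rule: less_induct)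
  case (less j)
  have IH: "(\<lambda>x. gs_res N x k i) \<in> borel_measurable (leb_mat N)" if "k < j" "i < N" for k i
    using less.IH[of k i] less.prems that by simp
  have col: "(\<lambda>x. x (i, j)) \<in> borel_measurable (leb_mat N)" if "i < N" for i
    using that less.prems by (intro measurable_leb_mat_component) simp
  show ?case
    by (subst gs_res.simps, intro borel_measurable_diff borel_measurable_sum borel_measurable_times
        borel_measurable_divide measurable_ip) (use IH col less.prems in auto)
qed

text \<open>The matrices with linearly independent columns. In terms of residuals, measurability and
  invariance under unitaries are easy to see.\<close>

definition gs_good :: "nat \<Rightarrow> (nat \<times> nat \<Rightarrow> complex) set" where
  "gs_good N = {x\<in>space (leb_mat N). \<forall>j<N. ip N (gs_res N x j) (gs_res N x j) \<noteq> 0}"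

text \<open>The value \<open>1\<^sub>m N\<close> outside \<open>gs_good\<close> keeps the map total
  and unitary-valued.\<close>

definition gs_mat :: "nat \<Rightarrow> (nat \<times> nat \<Rightarrow> complex) \<Rightarrow> complex mat" where
  "gs_mat N x = (if x \<in> gs_good N
     then mat N N (\<lambda>(i, j). gs_res N x j i / of_real (sqrt (Re (ip N (gs_res N x j) (gs_res N x j)))))
     else 1\<^sub>m N)"

lemma sets_gs_good: "gs_good N \<in> sets (leb_mat N)"
proof -
  have "(\<lambda>x. ip N (gs_res N x j) (gs_res N x j)) \<in> borel_measurable (leb_mat N)" if "j < N" for j
    using that by (intro measurable_ip measurable_gs_res)
  then have "{x\<in>space (leb_mat N). ip N (gs_res N x j) (gs_res N x j) \<noteq> 0} \<in> sets (leb_mat N)" if "j < N" for j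
    using that by measurable
  then have "{x\<in>space (leb_mat N). \<forall>j\<in>{..<N}. ip N (gs_res N x j) (gs_res N x j) \<noteq> 0} \<in> sets (leb_mat N)"
    by (intro sets.sets_Collect_finite_All) auto
  then show ?thesis by (simp only: gs_good_def Ball_def lessThan_iff)
qed

lemma gs_mat_unitary: "gs_mat N x \<in> unitary_group N"
proof (cases "x \<in> gs_good N")
  case True
  let ?r = "gs_res N x"
  let ?U = "gs_mat N x"
  define s where "s j = sqrt (Re (ip N (?r j) (?r j)))" for j
  have nz: "\<forall>j<N. ip N (?r j) (?r j) \<noteq> 0" using True by (simp add: gs_good_def)
  have s: "of_real (s j) * of_real (s j) = ip N (?r j) (?r j)" for j
  proof -
    have "Re (ip N (?r j) (?r j)) \<ge> 0" by (simp add: ip_self sum_nonneg)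
    then have "s j * s j = Re (ip N (?r j) (?r j))" by (simp add: s_def)
    then have "of_real (s j * s j) = (of_real (Re (ip N (?r j) (?r j))) :: complex)" by simp
    also have "\<dots> = ip N (?r j) (?r j)" by (simp add: ip_self)
    finally show ?thesis by simp
  qed
  have U: "?U = mat N N (\<lambda>(i, j). ?r j i / of_real (s j))" using True by (simp add: gs_mat_def s_def)
  then have c: "?U \<in> carrier_mat N N" "mat_adjoint ?U \<in> carrier_mat N N" by simp_all
  have "mat_adjoint ?U * ?U = 1\<^sub>m N"
  proof (rule eq_matI)
    fix j k assume "j < dim_row (1\<^sub>m N :: complex mat)" "k < dim_col (1\<^sub>m N :: complex mat)"
    then have jk: "j < N" "k < N" by auto
    have "(mat_adjoint ?U * ?U) $$ (j, k) = (\<Sum>i<N. mat_adjoint ?U $$ (j, i) * ?U $$ (i, k))"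
      by (rule index_mat_mult_sum[OF c(2,1) jk])
    also have "\<dots> = (\<Sum>i<N. (?r k i * cnj (?r j i)) / (of_real (s j) * of_real (s k)))"
      using jk by (intro sum.cong refl) (simp add: U)
    also have "\<dots> = ip N (?r k) (?r j) / (of_real (s j) * of_real (s k))"
      by (simp add: ip_def sum_divide_distrib)
    also have "\<dots> = (if j = k then 1 else 0)"
    proof (cases "j = k")
      case True
      then show ?thesis using nz jk by (simp add: s)
    next
      case False
      then have "ip N (?r k) (?r j) = 0"
        using gs_res_orthogonal[OF nz, of k j] gs_res_orthogonal[OF nz, of j k] jk ip_commute[of N "?r k" "?r j"]
        by (metis complex_cnj_zero linorder_neqE_nat)
      then show ?thesis using False by simp
    qed
    finally show "(mat_adjoint ?U * ?U) $$ (j, k) = 1\<^sub>m N $$ (j, k)" using jk by simp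
  qed (use c in auto)
  then show ?thesis
    using mat_mult_left_right_inverse[OF c(2,1)] c by (simp add: unitary_group_def)
qed (simp add: gs_mat_def one_unitary_group)

lemma fn_act_space: "fn_act N W x \<in> space (leb_mat N)"
  by (simp add: space_leb_mat fn_act_def)

lemma ip_gs_res_act:
  assumes "W \<in> unitary_group N" "j < N"
  shows "ip N (gs_res N (fn_act N W x) j) (gs_res N (fn_act N W x) j) = ip N (gs_res N x j) (gs_res N x j)"
  by (subst ip_unitary[OF assms(1), symmetric], intro ip_cong) (simp_all add: gs_res_act[OF assms(1,2)])

lemma gs_good_act:
  assumes "W \<in> unitary_group N" "x \<in> space (leb_mat N)"
  shows "fn_act N W x \<in> gs_good N \<longleftrightarrow> x \<in> gs_good N"
  using assms by (simp add: gs_good_def fn_act_space ip_gs_res_act)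

lemma gs_mat_act:
  assumes "W \<in> unitary_group N" "x \<in> gs_good N"
  shows "gs_mat N (fn_act N W x) = W * gs_mat N x"
proof -
  have good: "fn_act N W x \<in> gs_good N" using assms gs_good_act by (auto simp: gs_good_def)
  have c: "W \<in> carrier_mat N N" "gs_mat N x \<in> carrier_mat N N"
    using assms gs_mat_unitary by (auto intro: unitary_group_carrier)
  show ?thesis
  proof (rule eq_matI)
    fix i j assume "i < dim_row (W * gs_mat N x)" "j < dim_col (W * gs_mat N x)"
    then have ij: "i < N" "j < N" using c by auto
    have "(W * gs_mat N x) $$ (i, j) = (\<Sum>l<N. W $$ (i, l) * gs_mat N x $$ (l, j))"
      by (rule index_mat_mult_sum[OF c ij])
    also have "\<dots> = gs_mat N (fn_act N W x) $$ (i, j)"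
      using good assms ij
      by (simp add: gs_mat_def gs_res_act[OF assms(1)] ip_gs_res_act sum_divide_distrib)
    finally show "gs_mat N (fn_act N W x) $$ (i, j) = (W * gs_mat N x) $$ (i, j)" by simp
  qed (use c good in \<open>auto simp: gs_mat_def\<close>)
qed

text \<open>Matrices close to the identity are diagonally dominant. In a relation between their
  columns, the row belonging to a coefficient of largest modulus bounds this modulus by N / (N + 2)
  times itself. So \<open>gs_good\<close> contains a box, which gives it positive measure.\<close>

lemma near_identity_gs_good:
  assumes x: "x \<in> PiE (sq_index N) (\<lambda>(i, j). ball (if i = j then 1 else 0) (1 / real (N + 2)))"
  shows "x \<in> gs_good N"
proof -
  let ?e = "1 / real (N + 2)"
  have near: "cmod (x (i, j) - (if i = j then 1 else 0)) < ?e" if "i < N" "j < N" for i j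
    using PiE_mem[OF x, of "(i, j)"] that by (auto simp: dist_norm norm_minus_commute)
  have False if j: "j < N" and zero: "ip N (gs_res N x j) (gs_res N x j) = 0" for j
  proof -
    obtain c where c: "\<And>i. gs_res N x j i = x (i, j) - (\<Sum>k<j. c k * x (i, k))"
      using gs_res_span[of N x j] by blast
    \<comment> \<open>The relation of \<open>gs_res_span\<close> extended to all N columns:
      coefficient 1 at j and 0 beyond.\<close>
    define a where "a k = (if k = j then 1 else if k < j then - c k else 0)" for k
    have rel: "(\<Sum>k<N. a k * x (i, k)) = 0" if "i < N" for i
    proof -
      have "(\<Sum>k<N. a k * x (i, k)) = (\<Sum>k<Suc j. a k * x (i, k))"
        using j by (intro sum.mono_neutral_right) (auto simp: a_def)
      also have "\<dots> = gs_res N x j i" by (simp add: c a_def sum_negf)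
      finally show ?thesis using zero that by (simp add: ip_self_eq_0)
    qed
    have "Max ((\<lambda>k. cmod (a k)) ` {..<N}) \<in> (\<lambda>k. cmod (a k)) ` {..<N}"
      using j by (intro Max_in) auto
    then obtain m where m: "m < N" "cmod (a m) = Max ((\<lambda>k. cmod (a k)) ` {..<N})" by auto
    have max: "cmod (a k) \<le> cmod (a m)" if "k < N" for k
      unfolding m(2) using that by (intro Max_ge) auto
    have pos: "cmod (a m) \<ge> 1" using max[OF j] by (simp add: a_def)
    have "a m = - (\<Sum>k<N. a k * (x (m, k) - (if m = k then 1 else 0)))"
    proof -
      have "(\<Sum>k<N. a k * (if m = k then 1 else 0)) = (\<Sum>k<N. if m = k then a k else 0)"
        by (rule sum.cong) auto
      then show ?thesis using rel[OF m(1)] m(1) by (simp only: right_diff_distrib sum_subtractf) simp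
    qed
    then have "cmod (a m) = cmod (\<Sum>k<N. a k * (x (m, k) - (if m = k then 1 else 0)))"
      by (metis norm_minus_cancel)
    also have "\<dots> \<le> (\<Sum>k<N. cmod (a m) * ?e)"
    proof (rule sum_norm_le)
      fix k assume "k \<in> {..<N}"
      then show "cmod (a k * (x (m, k) - (if m = k then 1 else 0))) \<le> cmod (a m) * ?e"
        unfolding norm_mult using max[of k] near[OF m(1), of k] by (intro mult_mono) auto
    qed
    also have "\<dots> = cmod (a m) * (real N / real (N + 2))" by simp
    finally have "cmod (a m) * 1 \<le> cmod (a m) * (real N / real (N + 2))" by simp
    then have "1 \<le> real N / real (N + 2)"
      using pos by (subst (asm) mult_le_cancel_left_pos) auto
    then show False by (simp add: field_simps)
  qed
  then show ?thesis using x by (auto simp: gs_good_def space_leb_mat PiE_def)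
qed

section \<open>Measurability of matrix-valued maps\<close>

lemma space_borel_unitary [simp]: "space (borel_unitary N) = unitary_group N"
  by (simp add: borel_unitary_def)

lemma measurable_into_borel_unitary:
  assumes "\<And>x. x \<in> space M \<Longrightarrow> f x \<in> unitary_group N"
    and "\<And>i j. i < N \<Longrightarrow> j < N \<Longrightarrow> (\<lambda>x. f x $$ (i, j)) \<in> borel_measurable M"
  shows "f \<in> measurable M (borel_unitary N)"
  unfolding borel_unitary_def
proof (rule measurable_vimage_algebra2)
  show "(\<lambda>x. restrict (\<lambda>p. f x $$ p) (sq_index N)) \<in> measurable M (\<Pi>\<^sub>M p\<in>sq_index N. borel)"
    by (rule measurable_restrict) (use assms in auto)
qed (use assms in auto)

lemma measurable_unitary_entry:
  assumes "i < N" "j < N"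
  shows "(\<lambda>U. U $$ (i, j)) \<in> borel_measurable (borel_unitary N)"
proof -
  let ?f = "\<lambda>U :: complex mat. restrict (\<lambda>p. U $$ p) (sq_index N)"
  have "?f \<in> measurable (borel_unitary N) (\<Pi>\<^sub>M p\<in>sq_index N. borel)"
    unfolding borel_unitary_def by (rule measurable_vimage_algebra1) (auto simp: space_PiM)
  from measurable_compose[OF this measurable_component_singleton[of "(i, j)"]]
  show ?thesis using assms by simp
qed

lemma measurable_unitary_entry_compose:
  assumes "f \<in> measurable M (borel_unitary N)" "i < N" "j < N"
  shows "(\<lambda>x. f x $$ (i, j)) \<in> borel_measurable M"
  using measurable_compose[OF assms(1) measurable_unitary_entry[OF assms(2,3)]] .

text \<open>Measurability entry by entry, for square matrices that need not be unitary, such as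
  conjugates of the matrix models.\<close>

definition mat_measurable :: "'a measure \<Rightarrow> nat \<Rightarrow> ('a \<Rightarrow> complex mat) \<Rightarrow> bool" where
  "mat_measurable M N f \<longleftrightarrow> (\<forall>x\<in>space M. f x \<in> carrier_mat N N) \<and>
     (\<forall>i<N. \<forall>j<N. (\<lambda>x. f x $$ (i, j)) \<in> borel_measurable M)"

lemma mat_measurable_const: "A \<in> carrier_mat N N \<Longrightarrow> mat_measurable M N (\<lambda>_. A)"
  by (simp add: mat_measurable_def)

lemma mat_measurable_mult:
  assumes f: "mat_measurable M N f" and g: "mat_measurable M N g"
  shows "mat_measurable M N (\<lambda>x. f x * g x)"
  unfolding mat_measurable_def
proof (intro conjI allI impI ballI)
  show "f x * g x \<in> carrier_mat N N" if "x \<in> space M" for x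
    using f g that by (simp add: mat_measurable_def)
  fix i j assume ij: "i < N" "j < N"
  have "(\<lambda>x. \<Sum>k<N. f x $$ (i, k) * g x $$ (k, j)) \<in> borel_measurable M"
    using f g ij by (intro borel_measurable_sum borel_measurable_times) (auto simp: mat_measurable_def)
  then show "(\<lambda>x. (f x * g x) $$ (i, j)) \<in> borel_measurable M"
    by (rule measurable_cong[THEN iffD1, rotated])
      (use f g ij in \<open>auto simp: mat_measurable_def intro!: index_mat_mult_sum[symmetric]\<close>)
qed

lemma mat_measurable_adjoint:
  assumes f: "mat_measurable M N f"
  shows "mat_measurable M N (\<lambda>x. mat_adjoint (f x))"
  unfolding mat_measurable_def
proof (intro conjI allI impI ballI)
  show "mat_adjoint (f x) \<in> carrier_mat N N" if "x \<in> space M" for x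
    using f that by (simp add: mat_measurable_def)
  fix i j assume ij: "i < N" "j < N"
  have "(\<lambda>x. cnj (f x $$ (j, i))) \<in> borel_measurable M"
    using f ij by (intro measurable_cnj) (auto simp: mat_measurable_def)
  then show "(\<lambda>x. mat_adjoint (f x) $$ (i, j)) \<in> borel_measurable M"
  proof (rule measurable_cong[THEN iffD1, rotated])
    fix x assume "x \<in> space M"
    then have "f x \<in> carrier_mat N N" using f by (simp add: mat_measurable_def)
    then show "cnj (f x $$ (j, i)) = mat_adjoint (f x) $$ (i, j)" using ij by auto
  qed
qed

lemma mat_measurable_unitary:
  "f \<in> measurable M (borel_unitary N) \<Longrightarrow> mat_measurable M N f"
  using measurable_space[of f M "borel_unitary N"]
  by (auto simp: mat_measurable_def intro: unitary_group_carrier measurable_unitary_entry_compose)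

lemma measurable_unitary_mult:
  assumes f: "f \<in> measurable M (borel_unitary N)" and g: "g \<in> measurable M (borel_unitary N)"
  shows "(\<lambda>x. f x * g x) \<in> measurable M (borel_unitary N)"
  using mat_measurable_mult[OF mat_measurable_unitary[OF f] mat_measurable_unitary[OF g]]
    measurable_space[OF f] measurable_space[OF g]
  by (intro measurable_into_borel_unitary) (simp_all add: mult_unitary_group mat_measurable_def)

lemma measurable_unitary_adjoint:
  assumes f: "f \<in> measurable M (borel_unitary N)"
  shows "(\<lambda>x. mat_adjoint (f x)) \<in> measurable M (borel_unitary N)"
  using mat_measurable_adjoint[OF mat_measurable_unitary[OF f]] measurable_space[OF f]
  by (intro measurable_into_borel_unitary) (simp_all add: adjoint_unitary_group mat_measurable_def)

lemma measurable_gs_mat: "gs_mat N \<in> measurable (leb_mat N) (borel_unitary N)"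
proof (rule measurable_into_borel_unitary)
  fix i j assume ij: "i < N" "j < N"
  have "(\<lambda>x. if x \<in> gs_good N then gs_res N x j i / of_real (sqrt (Re (ip N (gs_res N x j) (gs_res N x j))))
      else (1\<^sub>m N :: complex mat) $$ (i, j)) \<in> borel_measurable (leb_mat N)"
  proof (rule measurable_If_set)
    have [measurable]: "(\<lambda>x. ip N (gs_res N x j) (gs_res N x j)) \<in> borel_measurable (leb_mat N)"
      using ij by (intro measurable_ip measurable_gs_res)
    have "(\<lambda>x. sqrt (Re (ip N (gs_res N x j) (gs_res N x j)))) \<in> borel_measurable (leb_mat N)"
      by measurable
    then have "(\<lambda>x. complex_of_real (sqrt (Re (ip N (gs_res N x j) (gs_res N x j))))) \<in> borel_measurable (leb_mat N)"
      by measurable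
    then show "(\<lambda>x. gs_res N x j i / of_real (sqrt (Re (ip N (gs_res N x j) (gs_res N x j)))))
        \<in> borel_measurable (leb_mat N)"
      using measurable_gs_res[OF ij(2,1)] by (intro borel_measurable_divide)
    show "gs_good N \<inter> space (leb_mat N) \<in> sets (leb_mat N)" using sets_gs_good by auto
  qed simp
  moreover have "(if x \<in> gs_good N then gs_res N x j i / of_real (sqrt (Re (ip N (gs_res N x j) (gs_res N x j))))
      else (1\<^sub>m N :: complex mat) $$ (i, j)) = gs_mat N x $$ (i, j)" for x
    using ij by (simp add: gs_mat_def)
  ultimately show "(\<lambda>x. gs_mat N x $$ (i, j)) \<in> borel_measurable (leb_mat N)" by simp
qed (rule gs_mat_unitary)

text \<open>Normalising Lebesgue measure takes a unitarily invariant set of positive finite measure.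
  The squared radius 4 N^2 leaves room for N^2 entries of modulus at most 2, hence for the box of
  \<open>near_identity_gs_good\<close>; the measure is finite since the ball lies in a product of
  discs.\<close>

lemma leb_mat_ball:
  fixes N :: nat
  defines "B \<equiv> {x\<in>space (leb_mat N). fn_sqnorm N x \<le> 4 * real N ^ 2}"
  shows "emeasure (leb_mat N) (gs_good N \<inter> B) \<noteq> 0" "emeasure (leb_mat N) B \<noteq> \<infinity>"
    "B \<in> sets (leb_mat N)"
proof -
  show B: "B \<in> sets (leb_mat N)" unfolding B_def using measurable_fn_sqnorm by measurable
  let ?A = "\<lambda>(i, j). ball (if i = j then 1 else 0 :: complex) (1 / real (N + 2))"
  let ?K = "PiE (sq_index N) ?A"
  have "?K \<subseteq> gs_good N \<inter> B"
  proof
    fix x assume x: "x \<in> ?K"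
    then have good: "x \<in> gs_good N" by (rule near_identity_gs_good)
    have "cmod (x p) ^ 2 \<le> 4" if "p \<in> sq_index N" for p
    proof -
      let ?d = "if fst p = snd p then 1 else 0 :: complex"
      have "cmod (x p - ?d) < 1 / real (N + 2)"
        using PiE_mem[OF x that] by (auto simp: case_prod_beta dist_norm norm_minus_commute)
      also have "\<dots> \<le> 1" by simp
      finally have "cmod (x p) \<le> 1 + cmod ?d"
        using norm_triangle_sub[of "x p" ?d] by linarith
      then have "cmod (x p) \<le> 2" by (auto split: if_splits)
      then have "cmod (x p) ^ 2 \<le> 2 ^ 2" by (intro power_mono) auto
      then show ?thesis by simp
    qed
    then have "fn_sqnorm N x \<le> (\<Sum>p\<in>sq_index N. 4)" unfolding fn_sqnorm_def by (intro sum_mono)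
    also have "\<dots> = 4 * real N ^ 2" by (simp add: power2_eq_square)
    finally show "x \<in> gs_good N \<inter> B" using good by (auto simp: B_def gs_good_def)
  qed
  then have "emeasure (leb_mat N) ?K \<le> emeasure (leb_mat N) (gs_good N \<inter> B)"
    using B sets_gs_good by (intro emeasure_mono sets.Int)
  moreover have prod: "emeasure (leb_mat N) ?K = (\<Prod>p\<in>sq_index N. emeasure lborel (?A p))"
    unfolding leb_mat_def
    by (rule product_sigma_finite.emeasure_PiM[OF lborel_complex_sigma_finite]) auto
  moreover have "(\<Prod>p\<in>sq_index N. emeasure lborel (?A p)) \<noteq> 0"
  proof -
    have "unit_ball_vol 2 \<noteq> 0"
      using unit_ball_vol_pos[of 2] by (metis less_irrefl zero_le_numeral)
    then have nz: "emeasure lborel (?A p) \<noteq> 0" for p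
      by (auto simp: case_prod_beta emeasure_ball)
    have pr: "(\<Prod>p\<in>A. f p) \<noteq> 0" if "finite A" "\<And>p. f p \<noteq> 0" for A and f :: "nat \<times> nat \<Rightarrow> ennreal"
      using that by (induction A rule: finite_induct) auto
    show ?thesis by (intro pr nz) simp
  qed
  ultimately show "emeasure (leb_mat N) (gs_good N \<inter> B) \<noteq> 0" by auto
  let ?C = "PiE (sq_index N) (\<lambda>_. cball 0 (2 * real N) :: complex set)"
  have "B \<subseteq> ?C"
  proof
    fix x assume x: "x \<in> B"
    have "cmod (x p) \<le> 2 * real N" if "p \<in> sq_index N" for p
    proof -
      have "cmod (x p) ^ 2 \<le> fn_sqnorm N x"
        unfolding fn_sqnorm_def using that by (intro member_le_sum) auto
      also have "\<dots> \<le> (2 * real N) ^ 2" using x by (simp add: B_def power_mult_distrib)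
      finally show ?thesis by (rule power2_le_imp_le) simp
    qed
    then show "x \<in> ?C" using x by (auto simp: B_def space_leb_mat PiE_def)
  qed
  then have "emeasure (leb_mat N) B \<le> emeasure (leb_mat N) ?C"
    unfolding leb_mat_def by (rule emeasure_mono) (rule sets_PiM_I_finite; auto)
  also have "\<dots> = (\<Prod>p\<in>sq_index N. emeasure lborel (cball 0 (2 * real N) :: complex set))"
    unfolding leb_mat_def
    by (rule product_sigma_finite.emeasure_PiM[OF lborel_complex_sigma_finite]) auto
  also have "\<dots> < \<infinity>"
    using emeasure_lborel_cball_finite[of "0 :: complex" "2 * real N"]
    by (auto simp: less_top[symmetric] power_eq_top_ennreal)
  finally show "emeasure (leb_mat N) B \<noteq> \<infinity>" by simp
qed

text \<open>The uniform distribution on \<open>E\<close> is pushed forward along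
  \<open>gs_mat\<close>. Left multiplication by W preserves Lebesgue measure and \<open>E\<close>,
  and \<open>gs_mat\<close> turns it into left multiplication by W on the unitary group.\<close>

lemma haar_unitary_exists: "\<exists>\<mu>. is_haar_unitary N \<mu>"
proof -
  let ?L = "leb_mat N"
  define B where "B = {x\<in>space ?L. fn_sqnorm N x \<le> 4 * real N ^ 2}"
  define E where "E = gs_good N \<inter> B"
  have B: "B \<in> sets ?L" "emeasure ?L B \<noteq> \<infinity>" "emeasure ?L E \<noteq> 0"
    using leb_mat_ball[of N] by (simp_all add: B_def E_def)
  have E: "E \<in> sets ?L" unfolding E_def using B sets_gs_good by (intro sets.Int)
  have le: "emeasure ?L E \<le> emeasure ?L B" using B by (intro emeasure_mono) (auto simp: E_def)
  then have Efin: "emeasure ?L E \<noteq> \<infinity>" using B by (auto simp: top_unique)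
  have B0: "emeasure ?L B \<noteq> 0" using le B by auto
  define \<nu> where "\<nu> = uniform_measure ?L E"
  define \<mu> where "\<mu> = distr \<nu> (borel_unitary N) (gs_mat N)"
  have m: "gs_mat N \<in> measurable \<nu> (borel_unitary N)"
    using measurable_gs_mat by (simp add: \<nu>_def cong: measurable_cong_sets)
  have "prob_space \<nu>" unfolding \<nu>_def by (rule prob_space_uniform_measure) (use B Efin in auto)
  then have "prob_space \<mu>" unfolding \<mu>_def by (rule prob_space.prob_space_distr) (rule m)
  moreover have "distr \<mu> \<mu> (\<lambda>U. W * U) = \<mu>" if W: "W \<in> unitary_group N" for W
  proof (rule measure_eqI)
    fix S assume "S \<in> sets (distr \<mu> \<mu> (\<lambda>U. W * U))"
    then have S: "S \<in> sets (borel_unitary N)" by (simp add: \<mu>_def)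
    have idm: "(\<lambda>U. U) \<in> measurable (borel_unitary N) (borel_unitary N)" by simp
    have mW: "(\<lambda>U. W * U) \<in> measurable (borel_unitary N) (borel_unitary N)"
      using measurable_unitary_mult[OF measurable_const idm, of W] W by simp
    then have mW': "(\<lambda>U. W * U) \<in> measurable \<mu> \<mu>" by (simp add: \<mu>_def cong: measurable_cong_sets)
    have SW: "(\<lambda>U. W * U) -` S \<inter> unitary_group N \<in> sets (borel_unitary N)"
      using measurable_sets[OF mW S] by simp
    have emeasure_\<mu>: "emeasure \<mu> S' = emeasure ?L (E \<inter> gs_mat N -` S') / emeasure ?L E"
      if "S' \<in> sets (borel_unitary N)" for S'
    proof -
      have "gs_mat N -` S' \<inter> space ?L \<in> sets ?L" using measurable_gs_mat that by (rule measurable_sets)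
      then have "emeasure \<nu> (gs_mat N -` S' \<inter> space \<nu>)
          = emeasure ?L (E \<inter> (gs_mat N -` S' \<inter> space ?L)) / emeasure ?L E"
        using E by (simp add: \<nu>_def)
      moreover have "emeasure \<mu> S' = emeasure \<nu> (gs_mat N -` S' \<inter> space \<nu>)"
        unfolding \<mu>_def by (rule emeasure_distr[OF m that])
      moreover have "E \<inter> (gs_mat N -` S' \<inter> space ?L) = E \<inter> gs_mat N -` S'"
        using sets.sets_into_space[OF E] by auto
      ultimately show ?thesis by simp
    qed
    have sets_pre: "E \<inter> gs_mat N -` S' \<in> sets ?L" if "S' \<in> sets (borel_unitary N)" for S'
    proof -
      have "E \<inter> gs_mat N -` S' = E \<inter> (gs_mat N -` S' \<inter> space ?L)"
        using sets.sets_into_space[OF E] by auto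
      then show ?thesis using E measurable_sets[OF measurable_gs_mat that] by simp
    qed
    have "emeasure (distr \<mu> \<mu> (\<lambda>U. W * U)) S = emeasure \<mu> ((\<lambda>U. W * U) -` S \<inter> unitary_group N)"
      using S by (subst emeasure_distr[OF mW']) (simp_all add: \<mu>_def)
    also have "\<dots> = emeasure ?L (E \<inter> gs_mat N -` ((\<lambda>U. W * U) -` S \<inter> unitary_group N)) / emeasure ?L E"
      by (rule emeasure_\<mu>[OF SW])
    also have "emeasure ?L (E \<inter> gs_mat N -` ((\<lambda>U. W * U) -` S \<inter> unitary_group N))
        = (\<integral>\<^sup>+x. indicator (E \<inter> gs_mat N -` ((\<lambda>U. W * U) -` S \<inter> unitary_group N)) x \<partial>?L)"
      by (rule nn_integral_indicator[symmetric]) (rule sets_pre[OF SW])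
    \<comment> \<open>Equivariance of \<open>gs_mat\<close>: x lies in the first set if and only if
      W x lies in the second.\<close>
    also have "\<dots> = (\<integral>\<^sup>+x. indicator (E \<inter> gs_mat N -` S) (fn_act N W x) \<partial>?L)"
    proof (rule nn_integral_cong)
      fix x assume x: "x \<in> space ?L"
      have "fn_act N W x \<in> E \<longleftrightarrow> x \<in> E"
        using x gs_good_act[OF W x] fn_sqnorm_act[OF W] by (auto simp: E_def B_def fn_act_space)
      moreover have "gs_mat N (fn_act N W x) = W * gs_mat N x" if "x \<in> E"
        using that by (intro gs_mat_act[OF W]) (simp add: E_def)
      ultimately show "indicator (E \<inter> gs_mat N -` ((\<lambda>U. W * U) -` S \<inter> unitary_group N)) x
          = (indicator (E \<inter> gs_mat N -` S) (fn_act N W x) :: ennreal)"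
        using gs_mat_unitary by (auto simp: indicator_def)
    qed
    also have "\<dots> = (\<integral>\<^sup>+x. indicator (E \<inter> gs_mat N -` S) x \<partial>?L)"
      by (rule leb_mat_unitary_invariant[OF W _ B0[unfolded B_def] B(2)[unfolded B_def]])
        (use sets_pre[OF S] in simp)
    also have "\<dots> = emeasure ?L (E \<inter> gs_mat N -` S)"
      by (rule nn_integral_indicator) (rule sets_pre[OF S])
    also have "\<dots> / emeasure ?L E = emeasure \<mu> S" by (rule emeasure_\<mu>[OF S, symmetric])
    finally show "emeasure (distr \<mu> \<mu> (\<lambda>U. W * U)) S = emeasure \<mu> S" .
  qed simp
  ultimately have "is_haar_unitary N \<mu>"
    by (simp add: is_haar_unitary_def \<mu>_def)
  then show ?thesis ..
qed

section \<open>Invariances of the Haar measure\<close>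

lemma is_haar_haar_unitary: "is_haar_unitary N (haar_unitary N)"
  unfolding haar_unitary_def by (rule someI_ex) (rule haar_unitary_exists)

lemma prob_space_haar_unitary: "prob_space (haar_unitary N)"
  and sets_haar_unitary [measurable_cong, simp]: "sets (haar_unitary N) = sets (borel_unitary N)"
  using is_haar_haar_unitary by (simp_all add: is_haar_unitary_def)

lemma space_haar_unitary [simp]: "space (haar_unitary N) = unitary_group N"
  using sets_eq_imp_space_eq[OF sets_haar_unitary] by simp

lemma measurable_haar_ident: "(\<lambda>U. U) \<in> measurable (haar_unitary N) (borel_unitary N)"
  by (rule measurable_ident_sets) simp

lemma measurable_mult_left:
  assumes "W \<in> unitary_group N"
  shows "(\<lambda>U. W * U) \<in> measurable (haar_unitary N) (haar_unitary N)"
proof -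
  have "(\<lambda>U. W * U) \<in> measurable (haar_unitary N) (borel_unitary N)"
    by (rule measurable_unitary_mult[OF _ measurable_haar_ident]) (use assms in simp)
  then show ?thesis by (simp cong: measurable_cong_sets)
qed

lemma distr_haar_left: "W \<in> unitary_group N \<Longrightarrow> distr (haar_unitary N) (haar_unitary N) (\<lambda>U. W * U) = haar_unitary N"
  using is_haar_haar_unitary by (simp add: is_haar_unitary_def)

lemma nn_integral_haar_left:
  assumes "W \<in> unitary_group N" "f \<in> borel_measurable (borel_unitary N)"
  shows "(\<integral>\<^sup>+U. f (W * U) \<partial>haar_unitary N) = (\<integral>\<^sup>+U. f U \<partial>haar_unitary N)"
proof -
  have "(\<integral>\<^sup>+U. f U \<partial>distr (haar_unitary N) (haar_unitary N) (\<lambda>U. W * U)) = (\<integral>\<^sup>+U. f (W * U) \<partial>haar_unitary N)"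
    by (rule nn_integral_distr[OF measurable_mult_left[OF assms(1)]])
      (use assms(2) in \<open>simp cong: measurable_cong_sets\<close>)
  then show ?thesis by (simp add: distr_haar_left[OF assms(1)])
qed

lemma integral_haar_left:
  fixes f :: "complex mat \<Rightarrow> complex"
  assumes "W \<in> unitary_group N" "f \<in> borel_measurable (borel_unitary N)"
  shows "(\<integral>U. f (W * U) \<partial>haar_unitary N) = (\<integral>U. f U \<partial>haar_unitary N)"
proof -
  have "(\<integral>U. f U \<partial>distr (haar_unitary N) (haar_unitary N) (\<lambda>U. W * U)) = (\<integral>U. f (W * U) \<partial>haar_unitary N)"
    by (rule integral_distr[OF measurable_mult_left[OF assms(1)]])
      (use assms(2) in \<open>simp cong: measurable_cong_sets\<close>)
  then show ?thesis by (simp add: distr_haar_left[OF assms(1)])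
qed



text \<open>\<open>is_haar_unitary\<close> asks for left invariance only. Integrate f(V^* U) over
  both variables: integrating over U first gives the right-hand side, integrating over V first gives
  the left-hand side, since V^* U is the adjoint of U^* V.\<close>

lemma nn_integral_haar_adjoint:
  assumes f: "f \<in> borel_measurable (borel_unitary N)"
  shows "(\<integral>\<^sup>+U. f (mat_adjoint U) \<partial>haar_unitary N) = (\<integral>\<^sup>+U. f U \<partial>haar_unitary N)"
proof -
  let ?H = "haar_unitary N"
  interpret prob_space ?H by (rule prob_space_haar_unitary)
  interpret P: pair_sigma_finite ?H ?H by standard
  note compose = measurable_compose[OF measurable_unitary_mult[OF measurable_unitary_adjoint] f]
  have "(\<integral>\<^sup>+U. f U \<partial>?H) = (\<integral>\<^sup>+V. \<integral>\<^sup>+U. f (mat_adjoint V * U) \<partial>?H \<partial>?H)"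
  proof -
    have "(\<integral>\<^sup>+V. \<integral>\<^sup>+U. f (mat_adjoint V * U) \<partial>?H \<partial>?H) = (\<integral>\<^sup>+V. \<integral>\<^sup>+U. f U \<partial>?H \<partial>?H)"
      by (intro nn_integral_cong nn_integral_haar_left f adjoint_unitary_group) simp
    then show ?thesis by (simp add: emeasure_space_1[simplified])
  qed
  also have "\<dots> = (\<integral>\<^sup>+U. \<integral>\<^sup>+V. f (mat_adjoint V * U) \<partial>?H \<partial>?H)"
    by (rule P.Fubini'[symmetric]) (use compose[of "\<lambda>z. fst z" "?H \<Otimes>\<^sub>M ?H" "\<lambda>z. snd z"] in
      \<open>auto simp: case_prod_beta measurable_haar_ident intro!: compose measurable_compose[OF _ measurable_haar_ident]\<close>)
  also have "\<dots> = (\<integral>\<^sup>+U. \<integral>\<^sup>+V. f (mat_adjoint V) \<partial>?H \<partial>?H)"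
  proof (rule nn_integral_cong)
    fix U assume "U \<in> space ?H"
    then have U: "U \<in> unitary_group N" by simp
    have "(\<integral>\<^sup>+V. f (mat_adjoint V * U) \<partial>?H) = (\<integral>\<^sup>+V. f (mat_adjoint (mat_adjoint U * V)) \<partial>?H)"
      using U by (intro nn_integral_cong) (simp add: mat_adjoint_mult[of _ N N _ N] unitary_group_carrier)
    also have "\<dots> = (\<integral>\<^sup>+V. f (mat_adjoint V) \<partial>?H)"
      by (rule nn_integral_haar_left[OF adjoint_unitary_group[OF U], of "\<lambda>V. f (mat_adjoint V)"])
        (intro measurable_compose[OF measurable_unitary_adjoint f], simp)
    finally show "(\<integral>\<^sup>+V. f (mat_adjoint V * U) \<partial>?H) = (\<integral>\<^sup>+V. f (mat_adjoint V) \<partial>?H)" .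
  qed
  also have "\<dots> = (\<integral>\<^sup>+V. f (mat_adjoint V) \<partial>?H)"
    by (simp add: emeasure_space_1[simplified])
  finally show ?thesis by simp
qed

text \<open>Taking adjoints turns right translation by W into left translation by the adjoint of
  W.\<close>

lemma nn_integral_haar_right:
  assumes W: "W \<in> unitary_group N" and f: "f \<in> borel_measurable (borel_unitary N)"
  shows "(\<integral>\<^sup>+U. f (U * W) \<partial>haar_unitary N) = (\<integral>\<^sup>+U. f U \<partial>haar_unitary N)"
proof -
  let ?H = "haar_unitary N"
  have m: "(\<lambda>U. U) \<in> measurable (borel_unitary N) (borel_unitary N)" by simp
  have "(\<integral>\<^sup>+U. f (U * W) \<partial>?H) = (\<integral>\<^sup>+U. f (mat_adjoint U * W) \<partial>?H)"
    by (rule nn_integral_haar_adjoint[symmetric, of "\<lambda>U. f (U * W)"])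
      (intro measurable_compose[OF measurable_unitary_mult[OF m] f], use W in simp)
  also have "\<dots> = (\<integral>\<^sup>+U. f (mat_adjoint (mat_adjoint W * U)) \<partial>?H)"
  proof (rule nn_integral_cong)
    fix U assume "U \<in> space ?H"
    then have "mat_adjoint W \<in> carrier_mat N N" "U \<in> carrier_mat N N"
      using W by (simp_all add: unitary_group_carrier)
    then show "f (mat_adjoint U * W) = f (mat_adjoint (mat_adjoint W * U))"
      by (simp add: mat_adjoint_mult[of _ N N _ N])
  qed
  also have "\<dots> = (\<integral>\<^sup>+U. f (mat_adjoint U) \<partial>?H)"
    by (rule nn_integral_haar_left[OF adjoint_unitary_group[OF W], of "\<lambda>V. f (mat_adjoint V)"])
      (intro measurable_compose[OF measurable_unitary_adjoint f], simp)
  also have "\<dots> = (\<integral>\<^sup>+U. f U \<partial>?H)" by (rule nn_integral_haar_adjoint[OF f])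
  finally show ?thesis .
qed

section \<open>Conjugation by small rotations\<close>

text \<open>A bound on the operator norm as a predicate: it composes without the supremum in
  \<open>mat_opnorm\<close> and carries the dimension along.\<close>

definition opnorm_le :: "nat \<Rightarrow> complex mat \<Rightarrow> real \<Rightarrow> bool" where
  "opnorm_le N A c \<longleftrightarrow> A \<in> carrier_mat N N \<and> (\<forall>x\<in>carrier_vec N. vec_l2norm (A *\<^sub>v x) \<le> c * vec_l2norm x)"

lemma opnorm_le_carrier: "opnorm_le N A c \<Longrightarrow> A \<in> carrier_mat N N"
  by (simp add: opnorm_le_def)

lemma vec_l2norm_nonneg [simp]: "0 \<le> vec_l2norm x"
  by (simp add: vec_l2norm_def)

lemma vec_l2norm_smult: "vec_l2norm (k \<cdot>\<^sub>v x) = cmod k * vec_l2norm x"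
  by (simp add: vec_l2norm_def norm_mult L2_set_right_distrib cong: L2_set_cong_simp)

lemma cmod_le_vec_l2norm: "i < dim_vec x \<Longrightarrow> cmod (x $ i) \<le> vec_l2norm x"
  unfolding vec_l2norm_def L2_set_def
  by (rule order_trans[OF _ real_sqrt_le_mono[OF member_le_sum[of i]]]) auto

lemma vec_l2norm_unit_vec: "j < N \<Longrightarrow> vec_l2norm (unit_vec N j) = 1"
  by (simp add: vec_l2norm_def L2_set_def unit_vec_def if_distrib[of cmod] if_distrib[of "\<lambda>z. z ^ 2"] cong: if_cong)

lemma opnorm_le_mult:
  assumes "opnorm_le N A a" "opnorm_le N B b" "0 \<le> a"
  shows "opnorm_le N (A * B) (a * b)"
proof -
  have c: "A \<in> carrier_mat N N" "B \<in> carrier_mat N N" using assms by (auto dest: opnorm_le_carrier)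
  have "vec_l2norm (A * B *\<^sub>v x) \<le> a * b * vec_l2norm x" if "x \<in> carrier_vec N" for x
  proof -
    have "vec_l2norm (A * B *\<^sub>v x) = vec_l2norm (A *\<^sub>v (B *\<^sub>v x))" using c that by simp
    also have "\<dots> \<le> a * vec_l2norm (B *\<^sub>v x)" using assms(1) c that by (simp add: opnorm_le_def)
    also have "\<dots> \<le> a * (b * vec_l2norm x)" using assms c that by (intro mult_left_mono) (auto simp: opnorm_le_def)
    finally show ?thesis by (simp add: mult.assoc)
  qed
  then show ?thesis using c by (simp add: opnorm_le_def)
qed

lemma opnorm_le_mono: "opnorm_le N A a \<Longrightarrow> a \<le> b \<Longrightarrow> opnorm_le N A b"
  unfolding opnorm_le_def by (meson mult_right_mono order_trans vec_l2norm_nonneg)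

lemma opnorm_le_unitary:
  assumes "U \<in> unitary_group N"
  shows "opnorm_le N U 1"
proof -
  have c: "U \<in> carrier_mat N N" by (rule unitary_group_carrier[OF assms])
  have sq: "of_real (vec_l2norm x ^ 2) = ip N (\<lambda>i. x $ i) (\<lambda>i. x $ i)" if "x \<in> carrier_vec N" for x
    using that by (simp add: ip_self vec_l2norm_def L2_set_def sum_nonneg del: of_real_power)
  have "vec_l2norm (U *\<^sub>v x) = vec_l2norm x" if x: "x \<in> carrier_vec N" for x
  proof -
    have "ip N (\<lambda>i. (U *\<^sub>v x) $ i) (\<lambda>i. (U *\<^sub>v x) $ i) = ip N (\<lambda>i. x $ i) (\<lambda>i. x $ i)"
      by (subst ip_unitary[OF assms, symmetric], intro ip_cong)
        (use c x in \<open>auto simp: scalar_prod_def atLeast0LessThan\<close>)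
    then have "complex_of_real (vec_l2norm (U *\<^sub>v x) ^ 2) = of_real (vec_l2norm x ^ 2)"
      using c x by (simp only: sq[OF x] sq[OF mult_mat_vec_carrier[OF c x]])
    then have "vec_l2norm (U *\<^sub>v x) ^ 2 = vec_l2norm x ^ 2" by (simp only: of_real_eq_iff)
    then show ?thesis by simp
  qed
  then show ?thesis using c by (simp add: opnorm_le_def)
qed

lemma opnorm_le_entry:
  assumes "opnorm_le N A c" "i < N" "j < N"
  shows "cmod (A $$ (i, j)) \<le> c"
proof -
  have A: "A \<in> carrier_mat N N" using assms by (simp add: opnorm_le_def)
  have "A $$ (i, j) = (A *\<^sub>v unit_vec N j) $ i"
    using A assms by (simp add: scalar_prod_right_unit)
  also have "cmod \<dots> \<le> vec_l2norm (A *\<^sub>v unit_vec N j)"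
    using A assms by (intro cmod_le_vec_l2norm) auto
  also have "\<dots> \<le> c * vec_l2norm (unit_vec N j :: complex vec)"
    using assms(1) unit_vec_carrier unfolding opnorm_le_def by blast
  finally show ?thesis using assms by (simp add: vec_l2norm_unit_vec)
qed

lemma cmod_ntrace_le:
  assumes "opnorm_le N A c" "N > 0"
  shows "cmod (ntrace N A) \<le> c"
proof -
  have "cmod (\<Sum>i<N. A $$ (i, i)) \<le> (\<Sum>i<N. c)"
    by (rule sum_norm_le) (use opnorm_le_entry[OF assms(1)] in auto)
  then show ?thesis using assms(2) by (simp add: ntrace_def norm_divide field_simps)
qed

text \<open>Passing from the supremum to a bound at each vector needs the set of values to be
  bounded above; the sum of the moduli of all entries serves for that. Other vectors are reached by
  rescaling.\<close>

lemma opnorm_le_of_mat_opnorm: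
  assumes A: "A \<in> carrier_mat N N" and R: "mat_opnorm A \<le> R"
  shows "opnorm_le N A R"
proof -
  let ?S = "{vec_l2norm (A *\<^sub>v x) | x. x \<in> carrier_vec (dim_col A) \<and> vec_l2norm x \<le> 1}"
  define B where "B = (\<Sum>i<N. \<Sum>j<N. cmod (A $$ (i, j)))"
  have bound: "vec_l2norm (A *\<^sub>v x) \<le> B" if x: "x \<in> carrier_vec N" "vec_l2norm x \<le> 1" for x
  proof -
    have "vec_l2norm (A *\<^sub>v x) \<le> (\<Sum>i<N. \<bar>cmod ((A *\<^sub>v x) $ i)\<bar>)"
      using L2_set_le_sum_abs[of "\<lambda>i. cmod ((A *\<^sub>v x) $ i)" "{..<N}"] A
      unfolding vec_l2norm_def dim_mult_mat_vec by (simp only: carrier_matD)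
    also have "\<dots> \<le> B" unfolding B_def
    proof (rule sum_mono)
      fix i assume i: "i \<in> {..<N}"
      have "cmod ((A *\<^sub>v x) $ i) \<le> (\<Sum>j<N. cmod (A $$ (i, j) * x $ j))"
        using A x i by (auto simp: scalar_prod_def atLeast0LessThan intro!: norm_sum)
      also have "\<dots> \<le> (\<Sum>j<N. cmod (A $$ (i, j)))"
      proof (rule sum_mono)
        fix j assume "j \<in> {..<N}"
        then have "cmod (x $ j) \<le> 1" using cmod_le_vec_l2norm[of j x] x by auto
        then show "cmod (A $$ (i, j) * x $ j) \<le> cmod (A $$ (i, j))"
          by (simp add: norm_mult mult_left_le)
      qed
      finally show "\<bar>cmod ((A *\<^sub>v x) $ i)\<bar> \<le> (\<Sum>j<N. cmod (A $$ (i, j)))" by simp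
    qed
    finally show ?thesis .
  qed
  have bdd: "bdd_above ?S" by (rule bdd_aboveI[of _ B]) (use bound A in auto)
  have "vec_l2norm (A *\<^sub>v x) \<le> R * vec_l2norm x" if x: "x \<in> carrier_vec N" for x
  proof (cases "vec_l2norm x = 0")
    case True
    then have "x = 0\<^sub>v N"
      using x cmod_le_vec_l2norm[of _ x] by (intro eq_vecI) force+
    then have "A *\<^sub>v x = 0\<^sub>v N" using A by (intro eq_vecI) auto
    then show ?thesis using True by (simp add: vec_l2norm_def L2_set_def)
  next
    case False
    define k where "k = complex_of_real (1 / vec_l2norm x)"
    have pos: "vec_l2norm x > 0" using False vec_l2norm_nonneg[of x] by linarith
    have kx: "k \<cdot>\<^sub>v x \<in> carrier_vec N" "vec_l2norm (k \<cdot>\<^sub>v x) \<le> 1"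
      using x pos by (simp_all add: vec_l2norm_smult k_def norm_divide)
    have "vec_l2norm (A *\<^sub>v (k \<cdot>\<^sub>v x)) \<le> mat_opnorm A"
      unfolding mat_opnorm_def by (rule cSup_upper[OF _ bdd]) (use kx A in auto)
    moreover have "A *\<^sub>v (k \<cdot>\<^sub>v x) = k \<cdot>\<^sub>v (A *\<^sub>v x)" using A x by (rule mult_mat_vec)
    ultimately have "vec_l2norm (A *\<^sub>v x) / vec_l2norm x \<le> R"
      using R pos by (simp add: vec_l2norm_smult k_def norm_divide)
    then show ?thesis using pos by (simp add: field_simps)
  qed
  then show ?thesis using A by (simp add: opnorm_le_def)
qed

text \<open>The unnormalised trace is kept apart because its change under a rank one perturbation
  does not grow with N.\<close>

definition mtr :: "nat \<Rightarrow> complex mat \<Rightarrow> complex" where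
  "mtr N A = (\<Sum>i<N. A $$ (i, i))"

lemma ntrace_mtr: "ntrace N A = mtr N A / of_nat N"
  by (simp add: ntrace_def mtr_def)

lemma mtr_comm: "A \<in> carrier_mat N N \<Longrightarrow> B \<in> carrier_mat N N \<Longrightarrow> mtr N (A * B) = mtr N (B * A)"
  using ntrace_comm[of A N B] by (cases "N = 0") (auto simp: ntrace_mtr mtr_def)

lemma mtr_add: "A \<in> carrier_mat N N \<Longrightarrow> B \<in> carrier_mat N N \<Longrightarrow> mtr N (A + B) = mtr N A + mtr N B"
  by (simp add: mtr_def sum.distrib)

lemma mtr_smult: "A \<in> carrier_mat N N \<Longrightarrow> mtr N (k \<cdot>\<^sub>m A) = k * mtr N A"
  by (simp add: mtr_def sum_distrib_left)

definition rank1 :: "nat \<Rightarrow> (nat \<Rightarrow> complex) \<Rightarrow> complex mat" where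
  "rank1 N x = mat N N (\<lambda>(i, j). x i * cnj (x j))"

lemma rank1_carrier [simp]: "rank1 N x \<in> carrier_mat N N"
  by (simp add: rank1_def)

text \<open>For a unit vector x the trace is the quadratic form of Y at x, and Cauchy-Schwarz
  applies.\<close>

lemma cmod_mtr_rank1_le:
  assumes Y: "opnorm_le N Y c" and x: "(\<Sum>i<N. cmod (x i) ^ 2) = 1"
  shows "cmod (mtr N (rank1 N x * Y)) \<le> c"
proof -
  have c: "Y \<in> carrier_mat N N" using Y by (rule opnorm_le_carrier)
  define v where "v = vec N x"
  have v: "v \<in> carrier_vec N" "vec_l2norm v = 1" using x by (simp_all add: v_def vec_l2norm_def L2_set_def)
  have "mtr N (rank1 N x * Y) = (\<Sum>i<N. \<Sum>j<N. x i * cnj (x j) * Y $$ (j, i))"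
    unfolding mtr_def by (intro sum.cong refl, subst index_mat_mult_sum[OF rank1_carrier c])
      (auto simp: rank1_def)
  also have "\<dots> = (\<Sum>j<N. \<Sum>i<N. x i * cnj (x j) * Y $$ (j, i))" by (rule sum.swap)
  also have "\<dots> = (\<Sum>j<N. cnj (x j) * (Y *\<^sub>v v) $ j)"
    using c by (intro sum.cong) (auto simp: v_def scalar_prod_def atLeast0LessThan sum_distrib_left ac_simps)
  also have "cmod \<dots> \<le> (\<Sum>j<N. \<bar>cmod (x j)\<bar> * \<bar>cmod ((Y *\<^sub>v v) $ j)\<bar>)"
    by (intro sum_norm_le) (simp add: norm_mult)
  also have "\<dots> \<le> L2_set (\<lambda>j. cmod (x j)) {..<N} * L2_set (\<lambda>j. cmod ((Y *\<^sub>v v) $ j)) {..<N}"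
    by (rule L2_set_mult_ineq)
  also have "\<dots> = vec_l2norm (Y *\<^sub>v v)" using x c by (simp add: L2_set_def vec_l2norm_def)
  also have "\<dots> \<le> c" using Y v unfolding opnorm_le_def by force
  finally show ?thesis .
qed

text \<open>For a unit vector x this is e^(\<i>tP), where P is the projection onto the line of
  x.\<close>

definition rot :: "nat \<Rightarrow> (nat \<Rightarrow> complex) \<Rightarrow> real \<Rightarrow> complex mat" where
  "rot N x t = 1\<^sub>m N + (cis t - 1) \<cdot>\<^sub>m rank1 N x"

lemma rot_carrier [simp]: "rot N x t \<in> carrier_mat N N"
  by (simp add: rot_def)

lemma adjoint_rot: "mat_adjoint (rot N x t) = 1\<^sub>m N + cnj (cis t - 1) \<cdot>\<^sub>m rank1 N x"
  by (rule eq_matI) (auto simp: rot_def rank1_def mult.commute)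

lemma rot_unitary:
  assumes x: "(\<Sum>i<N. cmod (x i) ^ 2) = 1"
  shows "rot N x t \<in> unitary_group N"
proof -
  define a where "a = cis t - 1"
  let ?G = "rot N x t" and ?G' = "mat_adjoint (rot N x t)"
  have G: "?G = 1\<^sub>m N + a \<cdot>\<^sub>m rank1 N x" and G': "?G' = 1\<^sub>m N + cnj a \<cdot>\<^sub>m rank1 N x"
    by (simp_all only: adjoint_rot a_def) (simp only: rot_def)
  have xx: "(\<Sum>k<N. x k * cnj (x k)) = 1"
    using ip_self[of N x] x by (simp add: ip_def)
  \<comment> \<open>This restates that 1 + a = e^(\<i>t) has modulus 1.\<close>
  have a: "a + cnj a + a * cnj a = 0"
  proof -
    have "(1 + a) * cnj (1 + a) = 1" by (simp add: a_def cis_mult cis_cnj)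
    then show ?thesis by (simp add: algebra_simps)
  qed
  have PP: "rank1 N x * rank1 N x = rank1 N x"
  proof (rule eq_matI)
    fix i j assume "i < dim_row (rank1 N x)" "j < dim_col (rank1 N x)"
    then have ij: "i < N" "j < N" by (simp_all add: rank1_def)
    have "(rank1 N x * rank1 N x) $$ (i, j) = (\<Sum>k<N. x i * cnj (x k) * (x k * cnj (x j)))"
      using ij by (subst index_mat_mult_sum[OF rank1_carrier rank1_carrier ij]) (simp add: rank1_def)
    also have "\<dots> = (x i * cnj (x j)) * (\<Sum>k<N. x k * cnj (x k))"
      by (simp add: sum_distrib_left ac_simps)
    finally show "(rank1 N x * rank1 N x) $$ (i, j) = rank1 N x $$ (i, j)"
      using ij by (simp add: xx rank1_def)
  qed (simp_all add: rank1_def)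
  have "?G * ?G' = ?G' + a \<cdot>\<^sub>m (rank1 N x * ?G')"
    unfolding G by (subst add_mult_distrib_mat[where nr = N and n = N and nc = N]) (simp_all add: mult_smult_assoc_mat[of _ N N _ N] left_mult_one_mat[of _ N N])
  also have "rank1 N x * ?G' = rank1 N x + cnj a \<cdot>\<^sub>m rank1 N x"
    unfolding G' by (subst mult_add_distrib_mat[where nr = N and n = N and nc = N]) (simp_all add: mult_smult_distrib[of _ N N _ N] right_mult_one_mat[of _ N N] PP)
  also have "?G' + a \<cdot>\<^sub>m (rank1 N x + cnj a \<cdot>\<^sub>m rank1 N x) = 1\<^sub>m N"
  proof (rule eq_matI)
    fix i j assume "i < dim_row (1\<^sub>m N :: complex mat)" "j < dim_col (1\<^sub>m N :: complex mat)"
    then have ij: "i < N" "j < N" by auto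
    define r where "r = rank1 N x $$ (i, j)"
    have "(?G' + a \<cdot>\<^sub>m (rank1 N x + cnj a \<cdot>\<^sub>m rank1 N x)) $$ (i, j)
        = (1\<^sub>m N :: complex mat) $$ (i, j) + (a + cnj a + a * cnj a) * r"
      using ij unfolding G' by (simp add: r_def rank1_def algebra_simps)
    then show "(?G' + a \<cdot>\<^sub>m (rank1 N x + cnj a \<cdot>\<^sub>m rank1 N x)) $$ (i, j) = 1\<^sub>m N $$ (i, j)"
      by (simp add: a)
  qed (simp_all add: G' rank1_def)
  finally have "?G * ?G' = 1\<^sub>m N" .
  then show ?thesis
    using mat_mult_left_right_inverse[of ?G N ?G'] by (simp add: unitary_group_def)
qed

lemma cmod_cis_minus_one_le: "cmod (cis t - 1) \<le> \<bar>t\<bar>"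
proof -
  have "cmod (cis t - 1) ^ 2 = 2 - 2 * cos t"
    using sin_cos_squared_add[of t] by (simp add: cmod_power2 power2_diff)
  also have "\<dots> = (2 * sin (t / 2)) ^ 2"
    using cos_double_sin[of "t / 2"] by (simp add: power_mult_distrib)
  also have "\<dots> \<le> \<bar>t\<bar> ^ 2"
    using abs_sin_x_le_abs_x[of "t / 2"] by (intro power2_le_iff_abs_le[THEN iffD2]) (auto simp: abs_mult)
  finally show ?thesis by (rule power2_le_imp_le) simp
qed

text \<open>Lists of coloured matrices, parallel to the operator lists of \<open>op_der\<close>;
  conjugation will affect only the letters of colour \<open>True\<close>.\<close>

definition mprod :: "nat \<Rightarrow> (bool \<times> complex mat) list \<Rightarrow> complex mat" where
  "mprod N cs = foldr (\<lambda>p B. snd p * B) cs (1\<^sub>m N)"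

lemma mprod_simps [simp]: "mprod N [] = 1\<^sub>m N" "mprod N (p # cs) = snd p * mprod N cs"
  by (simp_all add: mprod_def)

definition mconj :: "complex mat \<Rightarrow> (bool \<times> complex mat) list \<Rightarrow> (bool \<times> complex mat) list" where
  "mconj G cs = map (\<lambda>(b, M). (b, if b then G * M * mat_adjoint G else M)) cs"

lemma mconj_simps [simp]: "mconj G [] = []" "length (mconj G cs) = length cs"
  "mconj G (p # cs) = (fst p, if fst p then G * snd p * mat_adjoint G else snd p) # mconj G cs"
  by (simp_all add: mconj_def case_prod_beta)

lemma take_mconj: "take i (mconj G cs) = mconj G (take i cs)"
  and drop_mconj: "drop i (mconj G cs) = mconj G (drop i cs)"
  by (simp_all add: mconj_def take_map drop_map)

definition mbound :: "nat \<Rightarrow> real \<Rightarrow> (bool \<times> complex mat) list \<Rightarrow> bool" where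
  "mbound N c cs \<longleftrightarrow> (\<forall>p\<in>set cs. opnorm_le N (snd p) c)"

lemma mbound_simps [simp]: "mbound N c []" "mbound N c (p # cs) \<longleftrightarrow> opnorm_le N (snd p) c \<and> mbound N c cs"
  by (auto simp: mbound_def)

lemma mbound_take: "mbound N c cs \<Longrightarrow> mbound N c (take i cs)"
  and mbound_drop: "mbound N c cs \<Longrightarrow> mbound N c (drop i cs)"
  by (auto simp: mbound_def dest: in_set_takeD in_set_dropD)

lemma mprod_bound:
  assumes "mbound N c cs" "0 \<le> c"
  shows "opnorm_le N (mprod N cs) (c ^ length cs)"
  using assms by (induction cs) (auto intro: opnorm_le_mult opnorm_le_unitary one_unitary_group)

lemma mprod_carrier: "mbound N c cs \<Longrightarrow> mprod N cs \<in> carrier_mat N N"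
  by (induction cs) (auto dest: opnorm_le_carrier)

lemma mconj_bound:
  assumes "mbound N c cs" "G \<in> unitary_group N" "0 \<le> c"
  shows "mbound N c (mconj G cs)"
proof -
  have "opnorm_le N (G * M * mat_adjoint G) c" if "opnorm_le N M c" for M
    using opnorm_le_mult[OF opnorm_le_mult[OF opnorm_le_unitary[OF assms(2)] that] opnorm_le_unitary[OF adjoint_unitary_group[OF assms(2)]]] assms(3)
    by simp
  then show ?thesis using assms(1) by (induction cs) auto
qed

lemma mconj_mult:
  assumes "mbound N c cs" "G \<in> unitary_group N" "W \<in> unitary_group N"
  shows "mconj (G * W) cs = mconj G (mconj W cs)"
proof -
  note c = unitary_group_carrier[OF assms(2)] unitary_group_carrier[OF assms(3)]
  have "G * W * M * mat_adjoint (G * W) = G * (W * M * mat_adjoint W) * mat_adjoint G" if "opnorm_le N M c" for M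
  proof -
    have M: "M \<in> carrier_mat N N" using that by (rule opnorm_le_carrier)
    show ?thesis using c M by (simp add: mat_adjoint_mult[OF c] assoc_mult_mat[of _ N N _ N _ N])
  qed
  then show ?thesis using assms(1) by (induction cs) auto
qed

text \<open>Writing the rotation as 1 + a P on both sides leaves two corrections, each with a factor
  P and a scalar a or its conjugate. The adjoint rotation is kept whole in the first one, where it
  costs nothing in norm.\<close>

lemma conj_rot_expand:
  assumes M: "M \<in> carrier_mat N N"
  shows "rot N x t * M * mat_adjoint (rot N x t) = M + ((cis t - 1) \<cdot>\<^sub>m (rank1 N x * (M * mat_adjoint (rot N x t)))
     + cnj (cis t - 1) \<cdot>\<^sub>m (M * rank1 N x))"
proof -
  define a where "a = cis t - 1"
  let ?G' = "mat_adjoint (rot N x t)" and ?P = "rank1 N x"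
  have MG: "M * ?G' = M + cnj a \<cdot>\<^sub>m (M * ?P)"
    unfolding adjoint_rot a_def[symmetric]
    using M by (subst mult_add_distrib_mat[where nr = N and n = N and nc = N]) (simp_all add: mult_smult_distrib[of _ N N _ N])
  have "rot N x t * M * ?G' = rot N x t * (M * ?G')"
    using M by (simp add: assoc_mult_mat[of _ N N _ N _ N])
  also have "\<dots> = M * ?G' + a \<cdot>\<^sub>m (?P * (M * ?G'))"
    unfolding rot_def[of N x t] a_def[symmetric]
    using M by (subst add_mult_distrib_mat[where nr = N and n = N and nc = N]) (simp_all add: mult_smult_assoc_mat[of _ N N _ N] rot_def adjoint_rot)
  also have "\<dots> = M + (a \<cdot>\<^sub>m (?P * (M * ?G')) + cnj a \<cdot>\<^sub>m (M * ?P))"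
  proof -
    have "A + B + C = A + (C + B)" if "A \<in> carrier_mat N N" "B \<in> carrier_mat N N" "C \<in> carrier_mat N N"
      for A B C :: "complex mat"
      using that by (intro eq_matI) auto
    from this[of M "cnj a \<cdot>\<^sub>m (M * ?P)" "a \<cdot>\<^sub>m (?P * (M * ?G'))"] M show ?thesis by (simp add: MG[symmetric])
  qed
  finally show ?thesis by (simp add: a_def)
qed

text \<open>The perturbation has rank one, so the unnormalised trace changes only by a bounded multiple
  of \<open>cis t - 1\<close>, independently of the dimension.\<close>

lemma mtr_rot_diff:
  assumes x: "(\<Sum>i<N. cmod (x i) ^ 2) = 1" and c: "1 \<le> c"
  shows "mbound N c cs \<Longrightarrow> opnorm_le N X b \<Longrightarrow> 0 \<le> b \<Longrightarrow>
    cmod (mtr N (X * mprod N (mconj (rot N x t) cs)) - mtr N (X * mprod N cs))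
      \<le> 2 * cmod (cis t - 1) * real (length cs) * c ^ length cs * b"
proof (induction cs arbitrary: X b)
  case (Cons p cs)
  let ?G = "rot N x t" and ?P = "rank1 N x" and ?a = "cis t - 1"
  let ?R' = "mprod N (mconj ?G cs)" and ?R = "mprod N cs" and ?n = "length cs"
  have G: "?G \<in> unitary_group N" by (rule rot_unitary[OF x])
  define M where "M = snd p"
  have M: "opnorm_le N M c" and cs: "mbound N c cs" using Cons.prems by (auto simp: M_def)
  have R': "opnorm_le N ?R' (c ^ ?n)"
    using mprod_bound[OF mconj_bound[OF cs G]] c by simp
  have C: "M \<in> carrier_mat N N" "X \<in> carrier_mat N N" "?R' \<in> carrier_mat N N" "?R \<in> carrier_mat N N"
    using M Cons.prems R' mprod_carrier[OF cs] by (auto dest: opnorm_le_carrier)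
  note A = assoc_mult_mat[of _ N N _ N _ N]
  have cn: "c ^ ?n \<ge> 0" using c by simp
  have XM: "opnorm_le N (X * M) (b * c)" using opnorm_le_mult[OF Cons.prems(2) M Cons.prems(3)] .
  \<comment> \<open>The head letter moves unrotated into the prefix \<open>X\<close>, so the bound
    of the prefix becomes b c.\<close>
  have IH: "cmod (mtr N (X * M * ?R') - mtr N (X * M * ?R)) \<le> 2 * cmod ?a * real ?n * c ^ ?n * (b * c)"
    by (rule Cons.IH[OF cs XM]) (use Cons.prems c in simp)
  show ?case
  proof (cases "fst p")
    case False
    have "cmod (mtr N (X * M * ?R') - mtr N (X * M * ?R)) \<le> 2 * cmod ?a * real (Suc ?n) * c ^ Suc ?n * b"
      by (rule order_trans[OF IH]) (use c Cons.prems in \<open>auto simp: algebra_simps intro!: mult_left_mono\<close>)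
    then show ?thesis using False C by (simp add: M_def[symmetric] A)
  next
    case True
    have Gc: "mat_adjoint ?G \<in> carrier_mat N N" by simp
    have "X * (?G * M * mat_adjoint ?G * ?R') = X * M * ?R'
        + (?a \<cdot>\<^sub>m (X * (?P * (M * mat_adjoint ?G * ?R'))) + cnj ?a \<cdot>\<^sub>m (X * M * (?P * ?R')))"
      unfolding conj_rot_expand[OF C(1)] using C Gc
      by (simp add: add_mult_distrib_mat[where nr = N and n = N and nc = N] mult_add_distrib_mat[where nr = N and n = N and nc = N] mult_smult_assoc_mat[of _ N N _ N]
          mult_smult_distrib[of _ N N _ N] A)
    then have "mtr N (X * (?G * M * mat_adjoint ?G * ?R')) = mtr N (X * M * ?R')
        + (?a * mtr N (X * (?P * (M * mat_adjoint ?G * ?R'))) + cnj ?a * mtr N (X * M * (?P * ?R')))"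
      using C Gc by (simp add: mtr_add mtr_smult)
    \<comment> \<open>Cyclicity brings the projection to the front, where
      \<open>cmod_mtr_rank1_le\<close> bounds the trace by an operator norm.\<close>
    also have "mtr N (X * (?P * (M * mat_adjoint ?G * ?R'))) = mtr N (?P * (M * mat_adjoint ?G * ?R' * X))"
      using C Gc mtr_comm[of X N "?P * (M * mat_adjoint ?G * ?R')"] by (simp add: A)
    also have "mtr N (X * M * (?P * ?R')) = mtr N (?P * (?R' * (X * M)))"
      using C mtr_comm[of "X * M" N "?P * ?R'"] by (simp add: A)
    finally have eq: "mtr N (X * (?G * M * mat_adjoint ?G * ?R')) - mtr N (X * M * ?R')
        = ?a * mtr N (?P * (M * mat_adjoint ?G * ?R' * X)) + cnj ?a * mtr N (?P * (?R' * (X * M)))" by simp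
    have "opnorm_le N (M * mat_adjoint ?G * ?R' * X) (c * 1 * c ^ ?n * b)"
      using c by (intro opnorm_le_mult M R' Cons.prems opnorm_le_unitary adjoint_unitary_group G) auto
    then have 1: "cmod (mtr N (?P * (M * mat_adjoint ?G * ?R' * X))) \<le> c ^ Suc ?n * b"
      using cmod_mtr_rank1_le[OF _ x] by fastforce
    have "opnorm_le N (?R' * (X * M)) (c ^ ?n * (b * c))"
      by (intro opnorm_le_mult XM R' cn)
    then have 2: "cmod (mtr N (?P * (?R' * (X * M)))) \<le> c ^ Suc ?n * b"
      using cmod_mtr_rank1_le[OF _ x, of "?R' * (X * M)" "c ^ ?n * (b * c)"] by (simp add: ac_simps)
    have "cmod (mtr N (X * (?G * M * mat_adjoint ?G * ?R')) - mtr N (X * M * ?R'))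
        \<le> cmod ?a * (c ^ Suc ?n * b) + cmod ?a * (c ^ Suc ?n * b)"
      unfolding eq using 1 2
      by (intro order_trans[OF norm_triangle_ineq] add_mono) (auto simp: norm_mult complex_mod_cnj simp del: complex_cnj_diff intro!: mult_left_mono)
    then have "cmod (mtr N (X * (?G * M * mat_adjoint ?G * ?R')) - mtr N (X * M * ?R))
        \<le> 2 * cmod ?a * (c ^ Suc ?n * b) + 2 * cmod ?a * real ?n * c ^ ?n * (b * c)"
      using IH by norm
    also have "\<dots> = 2 * cmod ?a * real (Suc ?n) * c ^ Suc ?n * b" by (simp add: algebra_simps)
    finally show ?thesis using True C by (simp add: M_def[symmetric] A)
  qed
qed simp

section \<open>The loop equation\<close>

text \<open>The (a, b) entry of the product A P B. The middle factor is a plain kernel, so that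
  linear combinations of rank one kernels can be formed freely.\<close>

definition tri :: "nat \<Rightarrow> complex mat \<Rightarrow> (nat \<Rightarrow> nat \<Rightarrow> complex) \<Rightarrow> complex mat \<Rightarrow> nat \<Rightarrow> nat \<Rightarrow> complex" where
  "tri N A P B a b = (\<Sum>k<N. \<Sum>l<N. A $$ (a, k) * P k l * B $$ (l, b))"

text \<open>The \<open>(a, b)\<close> entry of the derivative of \<open>mprod N cs\<close> when every matrix \<open>B\<close> of colour
  \<open>True\<close> moves along \<open>P * B - B * P\<close>.\<close>

definition der_entry :: "nat \<Rightarrow> (nat \<Rightarrow> nat \<Rightarrow> complex) \<Rightarrow> (bool \<times> complex mat) list \<Rightarrow> nat \<Rightarrow> nat \<Rightarrow> complex" where
  "der_entry N P cs a b = (\<Sum>i<length cs. if fst (cs ! i)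
     then tri N (mprod N (take i cs)) P (mprod N (drop i cs)) a b
        - tri N (mprod N (take (Suc i) cs)) P (mprod N (drop (Suc i) cs)) a b else 0)"

lemma tri_mult_left:
  assumes "M \<in> carrier_mat N N" "A \<in> carrier_mat N N" "a < N"
  shows "tri N (M * A) P B a b = (\<Sum>m<N. M $$ (a, m) * tri N A P B m b)"
proof -
  have "tri N (M * A) P B a b = (\<Sum>k<N. \<Sum>l<N. \<Sum>m<N. M $$ (a, m) * (A $$ (m, k) * P k l * B $$ (l, b)))"
    unfolding tri_def
    by (intro sum.cong refl) (simp add: index_mat_mult_sum[OF assms(1,2,3)] sum_distrib_right mult.assoc
        del: index_mult_mat)
  also have "\<dots> = (\<Sum>k<N. \<Sum>m<N. \<Sum>l<N. M $$ (a, m) * (A $$ (m, k) * P k l * B $$ (l, b)))"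
    by (intro sum.cong refl sum.swap)
  also have "\<dots> = (\<Sum>m<N. \<Sum>k<N. \<Sum>l<N. M $$ (a, m) * (A $$ (m, k) * P k l * B $$ (l, b)))"
    by (rule sum.swap)
  finally show ?thesis by (simp add: tri_def sum_distrib_left)
qed

lemma der_entry_Cons:
  assumes "mbound N c (p # cs)" "a < N"
  shows "der_entry N P (p # cs) a b = (if fst p then tri N (1\<^sub>m N) P (mprod N (p # cs)) a b
      - tri N (snd p) P (mprod N cs) a b else 0) + (\<Sum>k<N. snd p $$ (a, k) * der_entry N P cs k b)"
proof -
  have M: "snd p \<in> carrier_mat N N" using assms by (auto dest: opnorm_le_carrier)
  have T: "mprod N (take i cs) \<in> carrier_mat N N" for i
    using assms by (intro mprod_carrier mbound_take) auto
  have "(\<Sum>i<length cs. if fst (cs ! i) then tri N (snd p * mprod N (take i cs)) P (mprod N (drop i cs)) a b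
        - tri N (snd p * mprod N (take (Suc i) cs)) P (mprod N (drop (Suc i) cs)) a b else 0)
      = (\<Sum>i<length cs. \<Sum>k<N. snd p $$ (a, k) * (if fst (cs ! i) then tri N (mprod N (take i cs)) P (mprod N (drop i cs)) k b
        - tri N (mprod N (take (Suc i) cs)) P (mprod N (drop (Suc i) cs)) k b else 0))"
    by (intro sum.cong refl) (simp add: tri_mult_left[OF M T assms(2)] sum_subtractf right_diff_distrib)
  also have "\<dots> = (\<Sum>k<N. snd p $$ (a, k) * der_entry N P cs k b)"
    by (subst sum.swap) (simp add: der_entry_def sum_distrib_left)
  finally show ?thesis
    using M by (simp add: der_entry_def sum.lessThan_Suc_shift right_mult_one_mat[of _ N N]
        del: sum.lessThan_Suc cong: if_cong)
qed

lemma tri_one_left: "a < N \<Longrightarrow> tri N (1\<^sub>m N) P B a b = (\<Sum>l<N. P a l * B $$ (l, b))"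
proof -
  assume a: "a < N"
  have "tri N (1\<^sub>m N) P B a b = (\<Sum>k<N. if k = a then (\<Sum>l<N. P k l * B $$ (l, b)) else 0)"
    unfolding tri_def using a by (intro sum.cong refl) auto
  then show ?thesis using a by simp
qed

lemma rot_entry:
  "i < N \<Longrightarrow> j < N \<Longrightarrow> rot N x t $$ (i, j) = (if i = j then 1 else 0) + (cis t - 1) * (x i * cnj (x j))"
  by (simp add: rot_def rank1_def)

lemma rot_entry_derivative:
  assumes "i < N" "j < N"
  shows "((\<lambda>t. rot N x t $$ (i, j)) has_vector_derivative \<i> * (x i * cnj (x j))) (at 0)"
    and "((\<lambda>t. cnj (rot N x t $$ (i, j))) has_vector_derivative - \<i> * (x j * cnj (x i))) (at 0)"
proof -
  have cis: "(cis has_vector_derivative \<i>) (at 0)"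
    using has_derivative_cis[OF has_derivative_ident, of 0 UNIV] by (simp add: has_vector_derivative_def)
  have "((\<lambda>t. (if i = j then 1 else 0) + (cis t - 1) * (x i * cnj (x j))) has_vector_derivative
      0 + (\<i> - 0) * (x i * cnj (x j))) (at 0)"
    by (intro has_vector_derivative_add has_vector_derivative_const has_vector_derivative_mult_left
        has_vector_derivative_diff cis)
  then show d: "((\<lambda>t. rot N x t $$ (i, j)) has_vector_derivative \<i> * (x i * cnj (x j))) (at 0)"
    using assms by (simp add: rot_entry)
  have "((\<lambda>t. cnj (rot N x t $$ (i, j))) has_vector_derivative cnj (\<i> * (x i * cnj (x j)))) (at 0)"
    by (rule has_vector_derivative_cnj[OF d])
  then show "((\<lambda>t. cnj (rot N x t $$ (i, j))) has_vector_derivative - \<i> * (x j * cnj (x i))) (at 0)"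
    by (simp add: ac_simps)
qed

lemma conj_entry:
  fixes G M :: "complex mat"
  assumes "G \<in> carrier_mat N N" "M \<in> carrier_mat N N" "a < N" "k < N"
  shows "(G * M * mat_adjoint G) $$ (a, k) = (\<Sum>m<N. (\<Sum>l<N. G $$ (a, l) * M $$ (l, m)) * cnj (G $$ (k, m)))"
proof -
  have GM: "G * M \<in> carrier_mat N N" and G': "mat_adjoint G \<in> carrier_mat N N" using assms by simp_all
  show ?thesis
    unfolding index_mat_mult_sum[OF GM G' assms(3,4)]
    using assms by (intro sum.cong refl) (simp add: index_mat_mult_sum[OF assms(1,2,3)] del: index_mult_mat(1))
qed

lemma sum_delta_mult: "(a::nat) < N \<Longrightarrow> (\<Sum>l<N. (if a = l then 1 else 0) * f l) = (f a :: complex)"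
proof -
  assume a: "a < N"
  have "(\<Sum>l<N. (if a = l then 1 else 0) * f l) = (\<Sum>l<N. if a = l then f l else 0)"
    by (rule sum.cong) auto
  also have "\<dots> = f a" using a by (subst sum.delta') auto
  finally show ?thesis .
qed

text \<open>The derivative of e^(\<i>tP) M e^(-\<i>tP) at t = 0 is \<i> (P M - M P).\<close>

lemma conj_rot_entry_derivative:
  assumes M: "M \<in> carrier_mat N N" and ak: "a < N" "k < N"
  shows "((\<lambda>t. (rot N x t * M * mat_adjoint (rot N x t)) $$ (a, k)) has_vector_derivative
      \<i> * ((\<Sum>l<N. x a * cnj (x l) * M $$ (l, k)) - (\<Sum>m<N. M $$ (a, m) * (x m * cnj (x k))))) (at 0)"
proof -
  define P where "P i j = x i * cnj (x j)" for i j
  let ?\<delta> = "\<lambda>i j. if i = j then 1 else 0 :: complex"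
  have inner0: "(\<Sum>l<N. rot N x 0 $$ (a, l) * M $$ (l, m)) = M $$ (a, m)" for m
  proof -
    have "(\<Sum>l<N. rot N x 0 $$ (a, l) * M $$ (l, m)) = (\<Sum>l<N. ?\<delta> a l * M $$ (l, m))"
      using ak by (intro sum.cong) (auto simp: rot_entry)
    also have "\<dots> = M $$ (a, m)" by (rule sum_delta_mult[OF ak(1)])
    finally show ?thesis .
  qed
  have "((\<lambda>t. \<Sum>m<N. (\<Sum>l<N. rot N x t $$ (a, l) * M $$ (l, m)) * cnj (rot N x t $$ (k, m)))
      has_vector_derivative (\<Sum>m<N. (\<Sum>l<N. rot N x 0 $$ (a, l) * M $$ (l, m)) * (- \<i> * P m k)
        + (\<Sum>l<N. (\<i> * P a l) * M $$ (l, m)) * cnj (rot N x 0 $$ (k, m)))) (at 0)"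
    unfolding P_def
    by (intro has_vector_derivative_sum has_vector_derivative_mult has_vector_derivative_mult_left rot_entry_derivative)
      (use ak in auto)
  also have "(\<Sum>m<N. (\<Sum>l<N. rot N x 0 $$ (a, l) * M $$ (l, m)) * (- \<i> * P m k)
        + (\<Sum>l<N. (\<i> * P a l) * M $$ (l, m)) * cnj (rot N x 0 $$ (k, m)))
      = (\<Sum>m<N. - \<i> * (M $$ (a, m) * P m k) + ?\<delta> k m * (\<Sum>l<N. (\<i> * P a l) * M $$ (l, m)))"
    using ak by (intro sum.cong refl) (auto simp: inner0 rot_entry[OF ak(2)])
  also have "\<dots> = - (\<Sum>m<N. \<i> * (M $$ (a, m) * P m k)) + (\<Sum>l<N. (\<i> * P a l) * M $$ (l, k))"
    by (simp only: sum.distrib sum_delta_mult[OF ak(2)]) (simp add: sum_negf)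
  also have "\<dots> = \<i> * ((\<Sum>l<N. P a l * M $$ (l, k)) - (\<Sum>m<N. M $$ (a, m) * P m k))"
    by (simp add: sum_distrib_left right_diff_distrib mult.assoc)
  finally show ?thesis
    unfolding P_def using M ak by (simp add: conj_entry[OF rot_carrier M ak])
qed

lemma rot_zero: "rot N x 0 = 1\<^sub>m N"
  by (rule eq_matI) (auto simp: rot_def rank1_def)

lemma mconj_rot_zero: "mbound N c cs \<Longrightarrow> mconj (rot N x 0) cs = cs"
  by (induction cs) (auto simp: rot_zero dest!: opnorm_le_carrier)

text \<open>The product rule along the list: up to the factor \<i>, the derivation in
  \<open>der_entry\<close> is the infinitesimal form of conjugation by rotations.\<close>

lemma mprod_rot_derivative:
  assumes "\<And>t. rot N x t \<in> unitary_group N" "0 \<le> c"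
  shows "mbound N c cs \<Longrightarrow> a < N \<Longrightarrow> b < N \<Longrightarrow>
    ((\<lambda>t. mprod N (mconj (rot N x t) cs) $$ (a, b)) has_vector_derivative
      \<i> * der_entry N (\<lambda>k l. x k * cnj (x l)) cs a b) (at 0)"
proof (induction cs arbitrary: a)
  case Nil
  then show ?case by (simp add: der_entry_def)
next
  case (Cons p cs)
  define P where "P k l = x k * cnj (x l)" for k l
  define M where "M = snd p"
  define C where "C t = (if fst p then rot N x t * M * mat_adjoint (rot N x t) else M)" for t
  let ?R = "\<lambda>t. mprod N (mconj (rot N x t) cs)"
  have M: "M \<in> carrier_mat N N" and cs: "mbound N c cs" using Cons.prems by (auto simp: M_def dest: opnorm_le_carrier)
  have R: "?R t \<in> carrier_mat N N" for t
    by (rule mprod_carrier[OF mconj_bound[OF cs assms]])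
  have C: "C t \<in> carrier_mat N N" for t using M by (auto simp: C_def)
  define D where "D k = (if fst p then (\<Sum>l<N. P a l * M $$ (l, k)) - (\<Sum>m<N. M $$ (a, m) * P m k) else 0)" for k
  have dC: "((\<lambda>t. C t $$ (a, k)) has_vector_derivative \<i> * D k) (at 0)" if "k < N" for k
    using conj_rot_entry_derivative[OF M Cons.prems(2) that, of x] by (auto simp: C_def D_def P_def)
  have C0: "C 0 = M" using M by (auto simp: C_def rot_zero)
  have R0: "?R 0 = mprod N cs" by (simp add: mconj_rot_zero[OF cs])
  have R0c: "mprod N cs \<in> carrier_mat N N" by (rule mprod_carrier[OF cs])
  have "((\<lambda>t. \<Sum>k<N. C t $$ (a, k) * ?R t $$ (k, b)) has_vector_derivative
      (\<Sum>k<N. C 0 $$ (a, k) * (\<i> * der_entry N P cs k b) + (\<i> * D k) * ?R 0 $$ (k, b))) (at 0)"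
    using Cons.IH[OF cs _ Cons.prems(3)] unfolding P_def[symmetric]
    by (intro has_vector_derivative_sum has_vector_derivative_mult dC) auto
  also have "(\<lambda>t. \<Sum>k<N. C t $$ (a, k) * ?R t $$ (k, b)) = (\<lambda>t. mprod N (mconj (rot N x t) (p # cs)) $$ (a, b))"
    by (rule ext, subst index_mat_mult_sum[OF C R Cons.prems(2,3), symmetric]) (simp add: C_def M_def)
  also have "(\<Sum>k<N. C 0 $$ (a, k) * (\<i> * der_entry N P cs k b) + (\<i> * D k) * ?R 0 $$ (k, b))
      = \<i> * ((\<Sum>k<N. D k * mprod N cs $$ (k, b)) + (\<Sum>k<N. M $$ (a, k) * der_entry N P cs k b))"
    by (simp add: C0 R0 sum.distrib distrib_left sum_distrib_left ac_simps)
  also have "(\<Sum>k<N. D k * mprod N cs $$ (k, b)) = (if fst p then tri N (1\<^sub>m N) P (mprod N (p # cs)) a b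
      - tri N (snd p) P (mprod N cs) a b else 0)"
  proof (cases "fst p")
    case True
    have "(\<Sum>k<N. D k * mprod N cs $$ (k, b)) = (\<Sum>k<N. \<Sum>l<N. P a l * M $$ (l, k) * mprod N cs $$ (k, b))
        - (\<Sum>k<N. \<Sum>m<N. M $$ (a, m) * P m k * mprod N cs $$ (k, b))"
      using True by (simp add: D_def left_diff_distrib sum_subtractf sum_distrib_right)
    also have "(\<Sum>k<N. \<Sum>m<N. M $$ (a, m) * P m k * mprod N cs $$ (k, b)) = tri N M P (mprod N cs) a b"
      unfolding tri_def by (rule sum.swap)
    also have "(\<Sum>k<N. \<Sum>l<N. P a l * M $$ (l, k) * mprod N cs $$ (k, b))
        = (\<Sum>l<N. P a l * (M * mprod N cs) $$ (l, b))"
      by (subst sum.swap, intro sum.cong refl)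
        (simp add: index_mat_mult_sum[OF M R0c _ Cons.prems(3)] sum_distrib_left mult.assoc del: index_mult_mat(1))
    finally show ?thesis using True by (simp add: tri_one_left[OF Cons.prems(2)] M_def)
  qed (simp add: D_def)
  also have "\<dots> + (\<Sum>k<N. M $$ (a, k) * der_entry N P cs k b) = der_entry N P (p # cs) a b"
    using der_entry_Cons[OF Cons.prems(1,2), of P b] by (simp add: M_def)
  finally show ?case unfolding P_def .
qed

text \<open>The matrix form of \<open>wsum\<close>: the normalised trace on both legs of the
  derivative of the word.\<close>

definition dtr :: "nat \<Rightarrow> (bool \<times> complex mat) list \<Rightarrow> complex" where
  "dtr N cs = (\<Sum>i<length cs. if fst (cs ! i)
     then ntrace N (mprod N (take (Suc i) cs)) * ntrace N (mprod N (drop (Suc i) cs))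
        - ntrace N (mprod N (take i cs)) * ntrace N (mprod N (drop i cs)) else 0)"

text \<open>Contraction with the matrix units E_ab separates the two legs: the (a, b) entries of A
  E_ab B sum to the trace of A times the trace of B. The sign is due to \<open>der_entry\<close>
  differentiating along P B - B P.\<close>

lemma der_entry_matrix_units:
  assumes "N > 0"
  shows "(\<Sum>a<N. \<Sum>b<N. der_entry N (\<lambda>k l. if k = a \<and> l = b then 1 else 0) cs a b) = - (of_nat N ^ 2 * dtr N cs)"
proof -
  have tri: "tri N A (\<lambda>k l. if k = a \<and> l = b then 1 else 0) B a b = A $$ (a, a) * B $$ (b, b)"
    if "a < N" "b < N" for A B a b
  proof -
    have "tri N A (\<lambda>k l. if k = a \<and> l = b then 1 else 0) B a b
        = (\<Sum>k<N. \<Sum>l<N. if b = l then (if a = k then A $$ (a, k) * B $$ (l, b) else 0) else 0)"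
      unfolding tri_def by (intro sum.cong refl) auto
    also have "\<dots> = A $$ (a, a) * B $$ (b, b)" using that by simp
    finally show ?thesis .
  qed
  have tr: "(\<Sum>a<N. \<Sum>b<N. A $$ (a, a) * B $$ (b, b)) = of_nat N ^ 2 * (ntrace N A * ntrace N B)" for A B
    using assms by (simp add: sum_product[symmetric] ntrace_mtr mtr_def power2_eq_square)
  have "(\<Sum>a<N. \<Sum>b<N. der_entry N (\<lambda>k l. if k = a \<and> l = b then 1 else 0) cs a b)
      = (\<Sum>a<N. \<Sum>b<N. \<Sum>i<length cs. if fst (cs ! i)
          then mprod N (take i cs) $$ (a, a) * mprod N (drop i cs) $$ (b, b)
            - mprod N (take (Suc i) cs) $$ (a, a) * mprod N (drop (Suc i) cs) $$ (b, b) else 0)"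
    unfolding der_entry_def by (intro sum.cong refl) (simp add: tri)
  also have "\<dots> = (\<Sum>i<length cs. \<Sum>a<N. \<Sum>b<N. if fst (cs ! i)
          then mprod N (take i cs) $$ (a, a) * mprod N (drop i cs) $$ (b, b)
            - mprod N (take (Suc i) cs) $$ (a, a) * mprod N (drop (Suc i) cs) $$ (b, b) else 0)"
    by (rule trans[OF sum.cong[OF refl sum.swap] sum.swap])
  also have "\<dots> = (\<Sum>i<length cs. - (of_nat N ^ 2 * (if fst (cs ! i)
      then ntrace N (mprod N (take (Suc i) cs)) * ntrace N (mprod N (drop (Suc i) cs))
        - ntrace N (mprod N (take i cs)) * ntrace N (mprod N (drop i cs)) else 0)))"
    by (intro sum.cong refl) (auto simp: sum_subtractf tr right_diff_distrib)
  finally show ?thesis by (simp add: dtr_def sum_negf sum_distrib_left)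
qed

lemma tri_sum: "tri N A (\<lambda>k l. \<Sum>s\<in>S. q s * P s k l) B a b = (\<Sum>s\<in>S. q s * tri N A (P s) B a b)"
proof -
  have "tri N A (\<lambda>k l. \<Sum>s\<in>S. q s * P s k l) B a b
      = (\<Sum>k<N. \<Sum>l<N. \<Sum>s\<in>S. q s * (A $$ (a, k) * P s k l * B $$ (l, b)))"
    unfolding tri_def by (simp add: sum_distrib_left sum_distrib_right ac_simps)
  also have "\<dots> = (\<Sum>s\<in>S. \<Sum>k<N. \<Sum>l<N. q s * (A $$ (a, k) * P s k l * B $$ (l, b)))"
    by (rule trans[OF sum.cong[OF refl sum.swap] sum.swap])
  finally show ?thesis by (simp add: tri_def sum_distrib_left)
qed

lemma der_entry_sum: "der_entry N (\<lambda>k l. \<Sum>s\<in>S. q s * P s k l) cs a b = (\<Sum>s\<in>S. q s * der_entry N (P s) cs a b)"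
proof -
  have "der_entry N (\<lambda>k l. \<Sum>s\<in>S. q s * P s k l) cs a b = (\<Sum>i<length cs. \<Sum>s\<in>S. q s * (if fst (cs ! i)
     then tri N (mprod N (take i cs)) (P s) (mprod N (drop i cs)) a b
        - tri N (mprod N (take (Suc i) cs)) (P s) (mprod N (drop (Suc i) cs)) a b else 0))"
    unfolding der_entry_def by (intro sum.cong refl) (simp add: tri_sum sum_subtractf right_diff_distrib)
  also have "\<dots> = (\<Sum>s\<in>S. q s * der_entry N (P s) cs a b)"
    by (subst sum.swap) (simp add: der_entry_def sum_distrib_left)
  finally show ?thesis .
qed

text \<open>Rotations are available only for kernels x x^* with a unit vector x. The polarization
  identity with the vectors (e_a + \<i>^s e_b) / sqrt 2 for s < 4 recovers the off-diagonal
  units.\<close>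

lemma matrix_unit_polarization:
  assumes "a \<noteq> b"
  shows "(\<lambda>k l. if k = a \<and> l = b then 1 else 0) = (\<lambda>k l. \<Sum>s<(4::nat). (\<i> ^ s / 2) *
     ((if k = a then 1 else if k = b then \<i> ^ s else 0) / of_real (sqrt 2)
      * cnj ((if l = a then 1 else if l = b then \<i> ^ s else 0) / of_real (sqrt 2))))"
proof (intro ext)
  fix k l
  have s2: "complex_of_real (sqrt 2) * complex_of_real (sqrt 2) = 2"
    by (metis of_real_mult of_real_numeral real_sqrt_mult_self abs_numeral)
  have "x / complex_of_real (sqrt 2) * cnj (y / complex_of_real (sqrt 2)) = x * cnj y / 2" for x y
    using s2 by (simp add: field_simps)
  then show "(if k = a \<and> l = b then 1 else 0) = (\<Sum>s<(4::nat). (\<i> ^ s / 2) *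
     ((if k = a then 1 else if k = b then \<i> ^ s else 0) / of_real (sqrt 2)
      * cnj ((if l = a then 1 else if l = b then \<i> ^ s else 0) / of_real (sqrt 2))))"
    using assms by (simp add: eval_nat_numeral power2_eq_square s2)
qed

lemma mat_measurable_ntrace:
  "mat_measurable M N f \<Longrightarrow> (\<lambda>x. ntrace N (f x)) \<in> borel_measurable M"
  unfolding ntrace_def
  by (intro borel_measurable_divide borel_measurable_sum borel_measurable_const) (auto simp: mat_measurable_def)

lemma mat_measurable_mprod_mconj:
  "mbound N c cs \<Longrightarrow> mat_measurable (borel_unitary N) N (\<lambda>W. mprod N (mconj W cs))"
proof (induction cs)
  case Nil
  then show ?case by (simp add: mat_measurable_const)
next
  case (Cons p cs)
  have W: "mat_measurable (borel_unitary N) N (\<lambda>W. W)"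
    by (rule mat_measurable_unitary) simp
  have p: "snd p \<in> carrier_mat N N" using Cons.prems by (auto dest: opnorm_le_carrier)
  have "mat_measurable (borel_unitary N) N (\<lambda>W. if fst p then W * snd p * mat_adjoint W else snd p)"
    using mat_measurable_mult[OF mat_measurable_mult[OF W mat_measurable_const[OF p]] mat_measurable_adjoint[OF W]]
      mat_measurable_const[OF p, of "borel_unitary N"] by (cases "fst p") simp_all
  from mat_measurable_mult[OF this Cons.IH] show ?case using Cons.prems by simp
qed

lemma cmod_ntrace_take_drop_le: "1 \<le> (c::real) \<Longrightarrow> mbound N c cs \<Longrightarrow> N > 0 \<Longrightarrow>
    cmod (ntrace N (mprod N (take i cs))) \<le> c ^ length cs \<and> cmod (ntrace N (mprod N (drop i cs))) \<le> c ^ length cs"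
proof -
  assume c: "1 \<le> c" and cs: "mbound N c cs" and N: "N > 0"
  have "cmod (ntrace N (mprod N (take i cs))) \<le> c ^ length (take i cs)"
    by (rule cmod_ntrace_le[OF mprod_bound[OF mbound_take[OF cs]] N]) (use c in simp)
  also have "\<dots> \<le> c ^ length cs" by (rule power_increasing) (use c in auto)
  finally have 1: "cmod (ntrace N (mprod N (take i cs))) \<le> c ^ length cs" .
  have "cmod (ntrace N (mprod N (drop i cs))) \<le> c ^ length (drop i cs)"
    by (rule cmod_ntrace_le[OF mprod_bound[OF mbound_drop[OF cs]] N]) (use c in simp)
  also have "\<dots> \<le> c ^ length cs" by (rule power_increasing) (use c in auto)
  finally show ?thesis using 1 by simp
qed

lemma cmod_mult_diff_le:
  fixes a b a' b' :: complex
  assumes "cmod a' \<le> K" "cmod b \<le> K" "cmod (a - a') \<le> d" "cmod (b - b') \<le> d"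
  shows "cmod (a * b - a' * b') \<le> 2 * (K * d)"
proof -
  have "a * b - a' * b' = (a - a') * b + a' * (b - b')" by (simp add: algebra_simps)
  then have "cmod (a * b - a' * b') \<le> cmod (a - a') * cmod b + cmod a' * cmod (b - b')"
    by (metis norm_triangle_ineq norm_mult)
  also have "\<dots> \<le> d * K + K * d"
    using assms by (intro add_mono mult_mono) (auto intro: order_trans[OF norm_ge_zero])
  finally show ?thesis by simp
qed

text \<open>A crude bound without decay in N, good enough for integrability, domination and uniform
  boundedness.\<close>

lemma cmod_dtr_le:
  assumes c: "1 \<le> c" and cs: "mbound N c cs" and N: "N > 0"
  shows "cmod (dtr N cs) \<le> real (length cs) * (2 * (c ^ length cs) ^ 2)"
proof -
  let ?K = "c ^ length cs"
  have "cmod (dtr N cs) \<le> (\<Sum>i<length cs. 2 * ?K ^ 2)"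
    unfolding dtr_def
  proof (rule sum_norm_le)
    fix i
    note b = cmod_ntrace_take_drop_le[OF c cs N]
    have "cmod (ntrace N (mprod N (take (Suc i) cs)) * ntrace N (mprod N (drop (Suc i) cs))) \<le> ?K * ?K"
      "cmod (ntrace N (mprod N (take i cs)) * ntrace N (mprod N (drop i cs))) \<le> ?K * ?K"
      using b[of i] b[of "Suc i"] c unfolding norm_mult by (intro mult_mono; simp)+
    then have "cmod (ntrace N (mprod N (take (Suc i) cs)) * ntrace N (mprod N (drop (Suc i) cs))
        - ntrace N (mprod N (take i cs)) * ntrace N (mprod N (drop i cs))) \<le> ?K * ?K + ?K * ?K"
      by (intro order_trans[OF norm_triangle_ineq4] add_mono)
    moreover have "0 \<le> 2 * ?K ^ 2" using c by simp
    ultimately show "cmod (if fst (cs ! i) then ntrace N (mprod N (take (Suc i) cs)) * ntrace N (mprod N (drop (Suc i) cs))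
        - ntrace N (mprod N (take i cs)) * ntrace N (mprod N (drop i cs)) else 0) \<le> 2 * ?K ^ 2"
      by (auto simp: power2_eq_square)
  qed
  then show ?thesis by simp
qed

lemma ntrace_rot_diff:
  assumes x: "(\<Sum>i<N. cmod (x i) ^ 2) = 1" and c: "1 \<le> c" and cs: "mbound N c cs" and N: "N > 0" and n: "length cs \<le> n"
  shows "cmod (ntrace N (mprod N (mconj (rot N x t) cs)) - ntrace N (mprod N cs))
    \<le> 2 * cmod (cis t - 1) * real n * c ^ n / real N"
proof -
  have G: "rot N x t \<in> unitary_group N" by (rule rot_unitary[OF x])
  have car: "mprod N (mconj (rot N x t) cs) \<in> carrier_mat N N" "mprod N cs \<in> carrier_mat N N"
    using mprod_carrier[OF mconj_bound[OF cs G]] mprod_carrier[OF cs] c by auto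
  have "cmod (mtr N (1\<^sub>m N * mprod N (mconj (rot N x t) cs)) - mtr N (1\<^sub>m N * mprod N cs))
      \<le> 2 * cmod (cis t - 1) * real (length cs) * c ^ length cs * 1"
    by (rule mtr_rot_diff[OF x c cs opnorm_le_unitary[OF one_unitary_group]]) simp
  also have "\<dots> \<le> 2 * cmod (cis t - 1) * real n * c ^ n"
    using n c by (auto intro!: mult_mono power_increasing)
  finally have "cmod (mtr N (mprod N (mconj (rot N x t) cs)) - mtr N (mprod N cs)) \<le> 2 * cmod (cis t - 1) * real n * c ^ n"
    using car by simp
  then show ?thesis
    using N by (simp add: ntrace_mtr diff_divide_distrib[symmetric] norm_divide divide_right_mono)
qed

text \<open>Each normalised trace is at most K and moves by at most d, which is of order t / N. A
  summand of \<open>dtr\<close> is a difference of two products of such traces, so it moves by at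
  most 4 K d; together with the factor 2 n K inside d this gives the constant 8.\<close>

lemma dtr_rot_diff:
  assumes x: "(\<Sum>i<N. cmod (x i) ^ 2) = 1" and c: "1 \<le> c" and cs: "mbound N c cs" and N: "N > 0"
  shows "cmod (dtr N (mconj (rot N x t) cs) - dtr N cs)
    \<le> 8 * real (length cs) ^ 2 * (c ^ length cs) ^ 2 * cmod (cis t - 1) / real N"
proof -
  let ?n = "length cs" and ?K = "c ^ length cs" and ?G = "rot N x t"
  define d where "d = 2 * cmod (cis t - 1) * real ?n * ?K / real N"
  have G: "?G \<in> unitary_group N" by (rule rot_unitary[OF x])
  have cs': "mbound N c (mconj ?G cs)" by (rule mconj_bound[OF cs G]) (use c in simp)
  define T where "T i = ntrace N (mprod N (take i cs))" for i
  define T' where "T' i = ntrace N (mprod N (take i (mconj ?G cs)))" for i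
  define D where "D i = ntrace N (mprod N (drop i cs))" for i
  define D' where "D' i = ntrace N (mprod N (drop i (mconj ?G cs)))" for i
  have bnd: "cmod (T i) \<le> ?K" "cmod (D' i) \<le> ?K" for i
    using cmod_ntrace_take_drop_le[OF c cs N, of i] cmod_ntrace_take_drop_le[OF c cs' N, of i]
    by (simp_all add: T_def D'_def)
  have dif: "cmod (T' i - T i) \<le> d" "cmod (D' i - D i) \<le> d" for i
    unfolding T_def T'_def D_def D'_def take_mconj drop_mconj d_def
    by (intro ntrace_rot_diff[OF x c _ N]; simp add: mbound_take mbound_drop cs)+
  have prod_diff: "cmod (T' i * D' i - T i * D i) \<le> 2 * (?K * d)" for i
    by (rule cmod_mult_diff_le[OF bnd dif])
  have fst_eq: "fst (mconj ?G cs ! i) = fst (cs ! i)" if "i < ?n" for i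
    using that by (simp add: mconj_def case_prod_beta)
  have "dtr N (mconj ?G cs) - dtr N cs = (\<Sum>i<?n. if fst (cs ! i)
      then (T' (Suc i) * D' (Suc i) - T (Suc i) * D (Suc i)) - (T' i * D' i - T i * D i) else 0)"
    unfolding dtr_def T_def T'_def D_def D'_def mconj_simps(2) sum_subtractf[symmetric]
    by (intro sum.cong refl) (auto simp: fst_eq)
  also have "cmod \<dots> \<le> (\<Sum>i<?n. 4 * (?K * d))"
  proof (rule sum_norm_le)
    fix i
    have "0 \<le> d" using c by (simp add: d_def)
    then have "0 \<le> 4 * (?K * d)" using c by simp
    moreover have "cmod ((T' (Suc i) * D' (Suc i) - T (Suc i) * D (Suc i)) - (T' i * D' i - T i * D i)) \<le> 2 * (?K * d) + 2 * (?K * d)"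
      by (intro order_trans[OF norm_triangle_ineq4] add_mono prod_diff)
    ultimately show "cmod (if fst (cs ! i)
      then (T' (Suc i) * D' (Suc i) - T (Suc i) * D (Suc i)) - (T' i * D' i - T i * D i) else 0) \<le> 4 * (?K * d)"
      by (cases "fst (cs ! i)"; simp only: if_True if_False norm_zero; linarith)
  qed
  also have "(\<Sum>i<?n. 4 * (?K * d)) = 8 * real ?n ^ 2 * ?K ^ 2 * cmod (cis t - 1) / real N"
    by (simp add: d_def power2_eq_square)
  finally show ?thesis .
qed

text \<open>The entry is the trace against a matrix unit of norm 1. The bound depends on the
  matrices only through c, so it will dominate the difference quotients uniformly over the unitary
  group.\<close>

lemma mprod_rot_entry_diff:
  assumes x: "(\<Sum>i<N. cmod (x i) ^ 2) = 1" and c: "1 \<le> c" and cs: "mbound N c cs" and ab: "a < N" "b < N"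
  shows "cmod (mprod N (mconj (rot N x t) cs) $$ (a, b) - mprod N cs $$ (a, b))
    \<le> 2 * cmod (cis t - 1) * real (length cs) * c ^ length cs"
proof -
  define E where "E = mat N N (\<lambda>(k, l). if k = b \<and> l = a then 1 else 0 :: complex)"
  have E: "E \<in> carrier_mat N N" by (simp add: E_def)
  have Ev: "E *\<^sub>v v = (v $ a) \<cdot>\<^sub>v unit_vec N b" if v: "v \<in> carrier_vec N" for v
  proof (rule eq_vecI)
    fix i assume "i < dim_vec (v $ a \<cdot>\<^sub>v unit_vec N b)"
    then have i: "i < N" by simp
    have "(E *\<^sub>v v) $ i = (\<Sum>l<N. E $$ (i, l) * v $ l)"
      using i v E by (simp add: scalar_prod_def atLeast0LessThan)
    also have "\<dots> = (\<Sum>l<N. if a = l then (if i = b then v $ l else 0) else 0)"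
      using i by (intro sum.cong refl) (auto simp: E_def)
    also have "\<dots> = (if i = b then v $ a else 0)" using ab by (subst sum.delta') auto
    finally show "(E *\<^sub>v v) $ i = (v $ a \<cdot>\<^sub>v unit_vec N b) $ i" using i ab by auto
  qed (simp add: E_def)
  have "opnorm_le N E 1"
    unfolding opnorm_le_def using E ab
    by (auto simp: Ev vec_l2norm_smult vec_l2norm_unit_vec intro!: cmod_le_vec_l2norm)
  moreover have "mtr N (E * A) = A $$ (a, b)" if A: "A \<in> carrier_mat N N" for A
  proof -
    have "(\<Sum>l<N. E $$ (i, l) * A $$ (l, i)) = (if b = i then A $$ (a, i) else 0)" if "i < N" for i
    proof -
      have "(\<Sum>l<N. E $$ (i, l) * A $$ (l, i)) = (\<Sum>l<N. if a = l then (if b = i then A $$ (l, i) else 0) else 0)"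
        using that by (intro sum.cong) (auto simp: E_def)
      also have "\<dots> = (if b = i then A $$ (a, i) else 0)" using ab by (subst sum.delta') auto
      finally show ?thesis .
    qed
    then have "mtr N (E * A) = (\<Sum>i<N. if b = i then A $$ (a, i) else 0)"
      unfolding mtr_def by (intro sum.cong refl) (simp add: index_mat_mult_sum[OF E A] del: index_mult_mat)
    also have "\<dots> = A $$ (a, b)" using ab by (subst sum.delta') auto
    finally show ?thesis .
  qed
  moreover have "mprod N (mconj (rot N x t) cs) \<in> carrier_mat N N" "mprod N cs \<in> carrier_mat N N"
    using mprod_carrier[OF mconj_bound[OF cs rot_unitary[OF x]]] mprod_carrier[OF cs] c by auto
  ultimately show ?thesis
    using mtr_rot_diff[OF x c cs, of E 1 t] by simp
qed

text \<open>The limit is taken along a sequence because dominated convergence will be applied to the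
  quotients.\<close>

lemma difference_quotient_LIMSEQ:
  fixes f :: "real \<Rightarrow> complex"
  assumes "(f has_vector_derivative D) (at 0)"
  shows "(\<lambda>n. (f (1 / real (Suc n)) - f 0) / of_real (1 / real (Suc n))) \<longlonglongrightarrow> D"
proof -
  have "((\<lambda>h. norm (f (0 + h) - f 0 - h *\<^sub>R D) / norm h) \<longlongrightarrow> 0) (at 0)"
    using assms unfolding has_vector_derivative_def has_derivative_at by blast
  moreover have "filterlim (\<lambda>n. 1 / real (Suc n)) (at 0) sequentially"
    unfolding filterlim_at using LIMSEQ_inverse_real_of_nat by (simp add: inverse_eq_divide)
  ultimately have "(\<lambda>n. norm (f (0 + 1 / real (Suc n)) - f 0 - (1 / real (Suc n)) *\<^sub>R D) / norm (1 / real (Suc n))) \<longlonglongrightarrow> 0"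
    by (rule filterlim_compose)
  moreover have quot: "norm (f (0 + h) - f 0 - h *\<^sub>R D) / norm h = norm ((f h - f 0) / of_real h - D)" if "h > 0" for h
  proof -
    have "(f h - f 0) / of_real h - D = (f h - f 0 - of_real h * D) / of_real h"
      using that by (simp add: field_simps)
    then show ?thesis by (simp add: norm_divide scaleR_conv_of_real)
  qed
  ultimately have "(\<lambda>n. norm ((f (1 / real (Suc n)) - f 0) / of_real (1 / real (Suc n)) - D)) \<longlonglongrightarrow> 0"
    by (simp only: quot zero_less_divide_1_iff of_nat_0_less_iff zero_less_Suc)
  then show ?thesis by (rule LIM_zero_cancel[OF tendsto_norm_zero_cancel])
qed

lemma integrable_haar_bounded:
  fixes f :: "complex mat \<Rightarrow> 'b::{banach, second_countable_topology}"
  assumes "f \<in> borel_measurable (borel_unitary N)" "\<And>W. W \<in> unitary_group N \<Longrightarrow> norm (f W) \<le> B"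
  shows "integrable (haar_unitary N) f"
proof -
  interpret prob_space "haar_unitary N" by (rule prob_space_haar_unitary)
  show ?thesis
    by (rule integrable_const_bound[of _ B]) (use assms in \<open>auto cong: measurable_cong_sets\<close>)
qed

lemma integral_haar_norm_le:
  fixes f :: "complex mat \<Rightarrow> complex"
  assumes "\<And>W. W \<in> unitary_group N \<Longrightarrow> cmod (f W) \<le> B" "0 \<le> B"
  shows "cmod (\<integral>W. f W \<partial>haar_unitary N) \<le> B"
proof -
  interpret prob_space "haar_unitary N" by (rule prob_space_haar_unitary)
  have "cmod (\<integral>W. f W \<partial>haar_unitary N) \<le> (\<integral>W. cmod (f W) \<partial>haar_unitary N)"
    by (rule integral_norm_bound)
  also have "\<dots> \<le> (\<integral>W. B \<partial>haar_unitary N)"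
    by (rule integral_mono') (use assms in auto)
  also have "\<dots> = B" by (simp add: prob_space[simplified])
  finally show ?thesis .
qed

context
  fixes N :: nat and ds :: "(bool \<times> complex mat) list" and c :: real
  assumes N: "N > 0" and ds: "mbound N c ds" and c: "1 \<le> c"
begin

lemma measurable_dtr: "(\<lambda>W. dtr N (mconj W ds)) \<in> borel_measurable (borel_unitary N)"
proof -
  have "(\<lambda>W. ntrace N (mprod N (mconj W (take i ds)))) \<in> borel_measurable (borel_unitary N)"
    "(\<lambda>W. ntrace N (mprod N (mconj W (drop i ds)))) \<in> borel_measurable (borel_unitary N)" for i
    by (rule mat_measurable_ntrace, rule mat_measurable_mprod_mconj, rule mbound_take[OF ds],
        rule mat_measurable_ntrace, rule mat_measurable_mprod_mconj, rule mbound_drop[OF ds])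
  then have "(\<lambda>W. \<Sum>i<length ds. if fst (ds ! i)
     then ntrace N (mprod N (mconj W (take (Suc i) ds))) * ntrace N (mprod N (mconj W (drop (Suc i) ds)))
        - ntrace N (mprod N (mconj W (take i ds))) * ntrace N (mprod N (mconj W (drop i ds))) else 0)
     \<in> borel_measurable (borel_unitary N)"
    by (intro borel_measurable_sum) auto
  moreover have "fst (mconj W ds ! i) = fst (ds ! i)" if "i < length ds" for W i
    using that by (simp add: mconj_def case_prod_beta)
  then have "dtr N (mconj W ds) = (\<Sum>i<length ds. if fst (ds ! i)
     then ntrace N (mprod N (mconj W (take (Suc i) ds))) * ntrace N (mprod N (mconj W (drop (Suc i) ds)))
        - ntrace N (mprod N (mconj W (take i ds))) * ntrace N (mprod N (mconj W (drop i ds))) else 0)" for W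
    unfolding dtr_def by (intro sum.cong) (auto simp: take_mconj drop_mconj)
  ultimately show ?thesis by simp
qed

lemma measurable_mprod_entry:
  assumes "a < N" "b < N"
  shows "(\<lambda>W. mprod N (mconj W ds) $$ (a, b)) \<in> borel_measurable (borel_unitary N)"
  using mat_measurable_mprod_mconj[OF ds] assms by (simp add: mat_measurable_def)

text \<open>Invariance under \<open>rot N x t\<close>, divided by \<open>t\<close>: the increment of the factor
  \<open>cnj (dtr \<dots>)\<close> is of order \<open>t / N\<close> and gives the error term.\<close>

lemma loop_rank1:
  assumes x: "(\<Sum>i<N. cmod (x i) ^ 2) = 1" and ab: "a < N" "b < N"
  shows "cmod (\<integral>W. der_entry N (\<lambda>k l. x k * cnj (x l)) (mconj W ds) a b * cnj (dtr N (mconj W ds)) \<partial>haar_unitary N)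
    \<le> 8 * real (length ds) ^ 2 * (c ^ length ds) ^ 3 / real N"
proof -
  let ?n = "length ds" and ?K = "c ^ length ds" and ?H = "haar_unitary N"
  interpret prob_space ?H by (rule prob_space_haar_unitary)
  define f where "f W = mprod N (mconj W ds) $$ (a, b)" for W
  \<comment> \<open>Testing against the conjugate of \<open>dtr\<close> is what turns the sum over
    the matrix units into the second moment of \<open>dtr\<close>.\<close>
  define h where "h W = cnj (dtr N (mconj W ds))" for W
  define C where "C = 8 * real ?n ^ 2 * ?K ^ 2"
  have K1: "?K \<ge> 1" using c by simp
  have f[measurable]: "f \<in> borel_measurable (borel_unitary N)"
    unfolding f_def by (rule measurable_mprod_entry[OF ab])
  have h[measurable]: "h \<in> borel_measurable (borel_unitary N)"
    unfolding h_def by (rule measurable_cnj[OF measurable_dtr])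
  have fb: "cmod (f W) \<le> ?K" if "W \<in> unitary_group N" for W
    unfolding f_def using opnorm_le_entry[OF mprod_bound[OF mconj_bound[OF ds that]] ab] c by simp
  have hb: "cmod (h W) \<le> real ?n * (2 * ?K ^ 2)" if "W \<in> unitary_group N" for W
    unfolding h_def using cmod_dtr_le[OF c mconj_bound[OF ds that] N] c by simp
  define G where "G k = rot N x (1 / real (Suc k))" for k
  define t where "t k = 1 / real (Suc k)" for k
  have t: "t k > 0" for k by (simp add: t_def)
  have G: "G k \<in> unitary_group N" for k unfolding G_def by (rule rot_unitary[OF x])
  have GW: "mconj (G k * W) ds = mconj (rot N x (t k)) (mconj W ds)" if "W \<in> unitary_group N" for k W
    unfolding G_def t_def by (rule mconj_mult[OF ds _ that]) (rule rot_unitary[OF x])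
  have mG: "(\<lambda>W. u (G k * W)) \<in> borel_measurable (borel_unitary N)"
    if "u \<in> borel_measurable (borel_unitary N)" for u :: "complex mat \<Rightarrow> complex" and k
  proof -
    have "(\<lambda>W. G k * W) \<in> measurable (borel_unitary N) (borel_unitary N)"
      by (rule measurable_unitary_mult) (use G in simp_all)
    from measurable_compose[OF this that] show ?thesis .
  qed
  note mGf[measurable] = mG[OF f] and mGh[measurable] = mG[OF h]
  have int: "integrable ?H (\<lambda>W. u W * v W)"
    if "u \<in> borel_measurable (borel_unitary N)" "v \<in> borel_measurable (borel_unitary N)"
      "\<And>W. W \<in> unitary_group N \<Longrightarrow> cmod (u W) \<le> B1" "\<And>W. W \<in> unitary_group N \<Longrightarrow> cmod (v W) \<le> B2" "0 \<le> B1"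
    for u v :: "complex mat \<Rightarrow> complex" and B1 B2
    using that by (intro integrable_haar_bounded[where B = "B1 * B2"]) (auto simp: norm_mult intro!: mult_mono)
  define q where "q k W = (f (G k * W) - f W) / of_real (t k) * h W" for k W
  have K0: "0 \<le> ?K" using K1 by linarith
  have i1: "integrable ?H (\<lambda>W. f (G k * W) * h (G k * W))" for k
    by (rule int[OF mGf mGh fb hb K0]) (simp_all add: mult_unitary_group G)
  have i2: "integrable ?H (\<lambda>W. f W * h W)" by (rule int[OF f h fb hb K0])
  have i3: "integrable ?H (\<lambda>W. f (G k * W) * h W)" for k
    by (rule int[OF mGf h fb hb K0]) (simp_all add: mult_unitary_group G)
  have qint: "cmod (\<integral>W. q k W \<partial>?H) \<le> ?K * C / real N" for k
  proof -
    \<comment> \<open>Invariance of the integral of f h moves the increment from f to h.\<close>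
    have "(\<integral>W. f (G k * W) * h (G k * W) \<partial>?H) = (\<integral>W. f W * h W \<partial>?H)"
      by (rule integral_haar_left[OF G, of "\<lambda>W. f W * h W"]) measurable
    then have "(\<integral>W. f (G k * W) * h W - f W * h W \<partial>?H)
        = - (\<integral>W. f (G k * W) * (h (G k * W) - h W) \<partial>?H)"
      using i1[of k] i2 i3[of k] by (simp add: right_diff_distrib)
    then have q_eq: "(\<integral>W. q k W \<partial>?H) = - (\<integral>W. f (G k * W) * (h (G k * W) - h W) \<partial>?H) / of_real (t k)"
      unfolding q_def by (simp add: left_diff_distrib diff_divide_distrib[symmetric])
    have "cmod (\<integral>W. f (G k * W) * (h (G k * W) - h W) \<partial>?H) \<le> ?K * (C * t k / real N)"
    proof (rule integral_haar_norm_le)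
      fix W assume W: "W \<in> unitary_group N"
      have "cmod (h (G k * W) - h W) = cmod (dtr N (mconj (rot N x (t k)) (mconj W ds)) - dtr N (mconj W ds))"
        by (simp add: h_def GW[OF W] complex_cnj_diff[symmetric] del: complex_cnj_diff)
      also have "\<dots> \<le> C * cmod (cis (t k) - 1) / real N"
        using dtr_rot_diff[OF x c mconj_bound[OF ds W] N, of "t k"] c by (simp add: C_def)
      also have "\<dots> \<le> C * t k / real N"
        using cmod_cis_minus_one_le[of "t k"] t[of k]
        by (intro divide_right_mono mult_left_mono) (auto simp: C_def)
      finally show "cmod (f (G k * W) * (h (G k * W) - h W)) \<le> ?K * (C * t k / real N)"
        unfolding norm_mult using fb[OF mult_unitary_group[OF G W]] K0 by (intro mult_mono) auto
    next
      show "0 \<le> ?K * (C * t k / real N)" using t[of k] K0 by (simp add: C_def)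
    qed
    then have "cmod (\<integral>W. f (G k * W) * (h (G k * W) - h W) \<partial>?H) / t k \<le> ?K * C / real N"
      by (subst pos_divide_le_eq[OF t]) (simp add: ac_simps)
    then show ?thesis
      unfolding q_eq norm_divide norm_minus_cancel using t[of k] by simp
  qed
  define L where "L W = \<i> * der_entry N (\<lambda>k l. x k * cnj (x l)) (mconj W ds) a b * h W" for W
  have lim: "(\<lambda>k. q k W) \<longlonglongrightarrow> L W" if W: "W \<in> unitary_group N" for W
  proof -
    have "((\<lambda>t. mprod N (mconj (rot N x t) (mconj W ds)) $$ (a, b)) has_vector_derivative
        \<i> * der_entry N (\<lambda>k l. x k * cnj (x l)) (mconj W ds) a b) (at 0)"
      by (rule mprod_rot_derivative[OF rot_unitary[OF x] _ mconj_bound[OF ds W] ab]) (use c in auto)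
    from difference_quotient_LIMSEQ[OF this]
    have "(\<lambda>k. (f (G k * W) - f W) / of_real (t k)) \<longlonglongrightarrow> \<i> * der_entry N (\<lambda>k l. x k * cnj (x l)) (mconj W ds) a b"
      using c by (simp add: f_def GW[OF W] t_def mconj_rot_zero[OF mconj_bound[OF ds W]])
    then show ?thesis unfolding q_def L_def by (intro tendsto_mult tendsto_const)
  qed
  \<comment> \<open>The increment of f is of order t, so the division by t leaves a bound
    independent of k and W.\<close>
  have qb: "cmod (q k W) \<le> (2 * real ?n * ?K) * (real ?n * (2 * ?K ^ 2))" if W: "W \<in> unitary_group N" for k W
  proof -
    have "cmod (f (G k * W) - f W) \<le> 2 * cmod (cis (t k) - 1) * real ?n * ?K"
      using mprod_rot_entry_diff[OF x c mconj_bound[OF ds W] ab, of "t k"] c by (simp add: f_def GW[OF W])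
    also have "\<dots> \<le> 2 * t k * real ?n * ?K"
      using cmod_cis_minus_one_le[of "t k"] t[of k] K0 by (intro mult_right_mono) auto
    finally have "cmod ((f (G k * W) - f W) / of_real (t k)) \<le> 2 * real ?n * ?K"
      using t[of k] by (simp add: norm_divide field_simps)
    then show ?thesis unfolding q_def norm_mult
      using hb[OF W] K0 by (intro mult_mono) auto
  qed
  have "L \<in> borel_measurable ?H"
  proof (rule borel_measurable_LIMSEQ_metric[of q])
    show "q k \<in> borel_measurable ?H" for k
      unfolding q_def by (simp cong: measurable_cong_sets)
  qed (use lim in simp)
  then have "(\<lambda>k. \<integral>W. q k W \<partial>?H) \<longlonglongrightarrow> (\<integral>W. L W \<partial>?H)"
    by (rule integral_dominated_convergence[where w = "\<lambda>_. (2 * real ?n * ?K) * (real ?n * (2 * ?K ^ 2))"])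
      (use lim qb in \<open>auto simp: q_def cong: measurable_cong_sets\<close>)
  then have "cmod (\<integral>W. L W \<partial>?H) \<le> ?K * C / real N"
    by (rule LIMSEQ_le_const2[OF tendsto_norm]) (use qint in auto)
  moreover have "(\<integral>W. L W \<partial>?H) = \<i> * (\<integral>W. der_entry N (\<lambda>k l. x k * cnj (x l)) (mconj W ds) a b * h W \<partial>?H)"
    unfolding L_def by (simp add: mult.assoc)
  ultimately show ?thesis
    by (simp add: norm_mult h_def C_def power2_eq_square power3_eq_cube ac_simps)
qed

end

lemma cmod_der_entry_le:
  assumes c: "1 \<le> c" and cs: "mbound N c cs" and ab: "a < N" "b < N" and P: "\<And>k l. cmod (P k l) \<le> 1"
  shows "cmod (der_entry N P cs a b) \<le> real (length cs) * (2 * (real N * (real N * (c ^ length cs * c ^ length cs))))"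
proof -
  let ?K = "c ^ length cs"
  have K: "0 \<le> ?K" using c by simp
  have T: "opnorm_le N (mprod N (take i cs)) ?K" and D: "opnorm_le N (mprod N (drop i cs)) ?K" for i
    using mprod_bound[OF mbound_take[OF cs], of i] mprod_bound[OF mbound_drop[OF cs], of i] c
    by (auto elim!: opnorm_le_mono intro!: power_increasing)
  have tri: "cmod (tri N A P B a b) \<le> real N * (real N * (?K * ?K))" if "opnorm_le N A ?K" "opnorm_le N B ?K" for A B
  proof -
    have "cmod (tri N A P B a b) \<le> (\<Sum>k<N. \<Sum>l<N. ?K * ?K)"
      unfolding tri_def
    proof (intro sum_norm_le)
      fix k l assume kl: "k \<in> {..<N}" "l \<in> {..<N}"
      have "cmod (A $$ (a, k)) * cmod (P k l) * cmod (B $$ (l, b)) \<le> ?K * 1 * ?K"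
        using opnorm_le_entry[OF that(1) ab(1), of k] opnorm_le_entry[OF that(2) _ ab(2), of l] P[of k l] kl K
        by (intro mult_mono) auto
      then show "cmod (A $$ (a, k) * P k l * B $$ (l, b)) \<le> ?K * ?K" by (simp add: norm_mult)
    qed
    then show ?thesis by simp
  qed
  have "cmod (der_entry N P cs a b) \<le> (\<Sum>i<length cs. 2 * (real N * (real N * (?K * ?K))))"
    unfolding der_entry_def
  proof (rule sum_norm_le)
    fix i
    have "cmod (tri N (mprod N (take i cs)) P (mprod N (drop i cs)) a b
        - tri N (mprod N (take (Suc i) cs)) P (mprod N (drop (Suc i) cs)) a b)
      \<le> real N * (real N * (?K * ?K)) + real N * (real N * (?K * ?K))"
      by (intro order_trans[OF norm_triangle_ineq4] add_mono tri T D)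
    moreover have "0 \<le> real N * (real N * (?K * ?K))" using K by simp
    ultimately show "cmod (if fst (cs ! i) then tri N (mprod N (take i cs)) P (mprod N (drop i cs)) a b
        - tri N (mprod N (take (Suc i) cs)) P (mprod N (drop (Suc i) cs)) a b else 0)
      \<le> 2 * (real N * (real N * (?K * ?K)))"
      by (cases "fst (cs ! i)"; simp only: if_True if_False norm_zero; linarith)
  qed
  then show ?thesis by simp
qed

lemma measurable_der_entry:
  assumes ds: "mbound N c ds" and ab: "a < N" "b < N"
  shows "(\<lambda>W. der_entry N P (mconj W ds) a b) \<in> borel_measurable (borel_unitary N)"
proof -
  have T: "mat_measurable (borel_unitary N) N (\<lambda>W. mprod N (mconj W (take i ds)))"
    and D: "mat_measurable (borel_unitary N) N (\<lambda>W. mprod N (mconj W (drop i ds)))" for i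
    by (rule mat_measurable_mprod_mconj, rule mbound_take[OF ds], rule mat_measurable_mprod_mconj, rule mbound_drop[OF ds])
  have tri: "(\<lambda>W. tri N (A W) P (B W) a b) \<in> borel_measurable (borel_unitary N)"
    if "mat_measurable (borel_unitary N) N A" "mat_measurable (borel_unitary N) N B" for A B
    unfolding tri_def using that ab
    by (intro borel_measurable_sum borel_measurable_times borel_measurable_const) (auto simp: mat_measurable_def)
  have "(\<lambda>W. \<Sum>i<length ds. if fst (ds ! i)
     then tri N (mprod N (mconj W (take i ds))) P (mprod N (mconj W (drop i ds))) a b
        - tri N (mprod N (mconj W (take (Suc i) ds))) P (mprod N (mconj W (drop (Suc i) ds))) a b else 0)
     \<in> borel_measurable (borel_unitary N)"
    using tri[OF T D] by (intro borel_measurable_sum) auto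
  moreover have "fst (mconj W ds ! i) = fst (ds ! i)" if "i < length ds" for W i
    using that by (simp add: mconj_def case_prod_beta)
  then have "der_entry N P (mconj W ds) a b = (\<Sum>i<length ds. if fst (ds ! i)
     then tri N (mprod N (mconj W (take i ds))) P (mprod N (mconj W (drop i ds))) a b
        - tri N (mprod N (mconj W (take (Suc i) ds))) P (mprod N (mconj W (drop (Suc i) ds))) a b else 0)" for W
    unfolding der_entry_def by (intro sum.cong) (auto simp: take_mconj drop_mconj)
  ultimately show ?thesis by simp
qed

context
  fixes N :: nat and ds :: "(bool \<times> complex mat) list" and c :: real
  assumes N: "N > 0" and ds: "mbound N c ds" and c: "1 \<le> c"
begin

lemma integrable_der_entry_dtr:
  assumes ab: "a < N" "b < N" and P: "\<And>k l. cmod (P k l) \<le> 1"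
  shows "integrable (haar_unitary N) (\<lambda>W. der_entry N P (mconj W ds) a b * cnj (dtr N (mconj W ds)))"
proof (rule integrable_haar_bounded)
  show "(\<lambda>W. der_entry N P (mconj W ds) a b * cnj (dtr N (mconj W ds))) \<in> borel_measurable (borel_unitary N)"
    by (intro borel_measurable_times measurable_cnj measurable_dtr[OF N ds c] measurable_der_entry[OF ds ab])
  fix W assume W: "W \<in> unitary_group N"
  let ?n = "length ds" and ?K = "c ^ length ds"
  have b: "mbound N c (mconj W ds)" using c by (intro mconj_bound[OF ds W]) auto
  show "norm (der_entry N P (mconj W ds) a b * cnj (dtr N (mconj W ds)))
    \<le> real ?n * (2 * (real N * (real N * (?K * ?K)))) * (real ?n * (2 * ?K ^ 2))"
    unfolding norm_mult using cmod_der_entry_le[OF c b ab P] cmod_dtr_le[OF c b N] c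
    by (intro mult_mono) auto
qed

text \<open>For a = b the unit is a rank one projection. Otherwise polarization gives four terms
  with weights of modulus 1/2, whence the factor 2.\<close>

lemma loop_matrix_unit:
  assumes ab: "a < N" "b < N"
  shows "cmod (\<integral>W. der_entry N (\<lambda>k l. if k = a \<and> l = b then 1 else 0) (mconj W ds) a b * cnj (dtr N (mconj W ds)) \<partial>haar_unitary N)
    \<le> 2 * (8 * real (length ds) ^ 2 * (c ^ length ds) ^ 3 / real N)"
proof -
  let ?B = "8 * real (length ds) ^ 2 * (c ^ length ds) ^ 3 / real N"
  have B: "0 \<le> ?B" using c by simp
  show ?thesis
  proof (cases "a = b")
    case True
    define x :: "nat \<Rightarrow> complex" where "x k = (if k = a then 1 else 0)" for k
    have x: "(\<Sum>i<N. cmod (x i) ^ 2) = 1"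
    proof -
      have "(\<Sum>i<N. cmod (x i) ^ 2) = (\<Sum>i<N. if a = i then 1 else 0)"
        by (intro sum.cong) (auto simp: x_def)
      then show ?thesis using ab by simp
    qed
    have "(\<lambda>k l. if k = a \<and> l = b then 1 else 0) = (\<lambda>k l. x k * cnj (x l))"
      using True by (auto simp: x_def fun_eq_iff)
    then show ?thesis using loop_rank1[OF N ds c x ab] B by simp
  next
    case False
    define x where "x s k = (if k = a then 1 else if k = b then \<i> ^ s else 0) / complex_of_real (sqrt 2)" for s :: nat and k
    have x: "(\<Sum>i<N. cmod (x s i) ^ 2) = 1" for s
    proof -
      have "(\<Sum>i<N. cmod (x s i) ^ 2) = (\<Sum>i<N. (if a = i then 1 / 2 else 0) + (if b = i then 1 / 2 else 0))"
        using False by (intro sum.cong) (auto simp: x_def norm_divide norm_power power_divide)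
      also have "\<dots> = 1" using ab by (simp add: sum.distrib)
      finally show ?thesis .
    qed
    have x1: "cmod (x s k * cnj (x s l)) \<le> 1" for s k l
    proof -
      have "cmod (x s k) \<le> 1" for k by (auto simp: x_def norm_divide norm_power)
      then show ?thesis unfolding norm_mult by (intro mult_le_one) auto
    qed
    define J where "J s = (\<integral>W. der_entry N (\<lambda>k l. x s k * cnj (x s l)) (mconj W ds) a b * cnj (dtr N (mconj W ds)) \<partial>haar_unitary N)" for s
    have "der_entry N (\<lambda>k l. if k = a \<and> l = b then 1 else 0) cs a b
        = (\<Sum>s<(4::nat). (\<i> ^ s / 2) * der_entry N (\<lambda>k l. x s k * cnj (x s l)) cs a b)" for cs
      unfolding matrix_unit_polarization[OF False] x_def by (rule der_entry_sum)
    then have "(\<integral>W. der_entry N (\<lambda>k l. if k = a \<and> l = b then 1 else 0) (mconj W ds) a b * cnj (dtr N (mconj W ds)) \<partial>haar_unitary N)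
        = (\<integral>W. (\<Sum>s<(4::nat). (\<i> ^ s / 2) * (der_entry N (\<lambda>k l. x s k * cnj (x s l)) (mconj W ds) a b * cnj (dtr N (mconj W ds)))) \<partial>haar_unitary N)"
      by (simp only: sum_distrib_right mult.assoc)
    also have "\<dots> = (\<Sum>s<(4::nat). (\<i> ^ s / 2) * J s)"
      unfolding J_def
      by (subst Bochner_Integration.integral_sum) (simp_all add: integrable_der_entry_dtr[OF ab x1] del: lessThan_Suc)
    also have "cmod \<dots> \<le> (\<Sum>s<(4::nat). ?B / 2)"
    proof (rule sum_norm_le)
      fix s
      have "cmod (J s) \<le> ?B" unfolding J_def by (rule loop_rank1[OF N ds c x ab])
      then show "cmod ((\<i> ^ s / 2) * J s) \<le> ?B / 2" by (simp add: norm_mult norm_divide norm_power)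
    qed
    finally show ?thesis by simp
  qed
qed

text \<open>Summing over all N^2 pairs (a, b) bounds N^2 times the second moment by N^2 times the
  error of a single unit, so the decay 1 / N survives; 16 is 2 times 8.\<close>

lemma loop_estimate:
  "(\<integral>W. cmod (dtr N (mconj W ds)) ^ 2 \<partial>haar_unitary N) \<le> 16 * real (length ds) ^ 2 * (c ^ length ds) ^ 3 / real N"
proof -
  let ?H = "haar_unitary N"
  let ?B = "16 * real (length ds) ^ 2 * (c ^ length ds) ^ 3 / real N"
  define u where "u W = dtr N (mconj W ds)" for W
  define E :: "nat \<Rightarrow> nat \<Rightarrow> nat \<Rightarrow> nat \<Rightarrow> complex" where "E a b k l = (if k = a \<and> l = b then 1 else 0)" for a b k l
  have "of_nat N ^ 2 * (u W * cnj (u W)) = - (\<Sum>a<N. \<Sum>b<N. der_entry N (E a b) (mconj W ds) a b * cnj (u W))" for W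
    using der_entry_matrix_units[OF N, of "mconj W ds"] by (simp add: u_def E_def[abs_def] sum_distrib_right[symmetric])
  then have "of_nat N ^ 2 * (\<integral>W. u W * cnj (u W) \<partial>?H)
      = - (\<integral>W. (\<Sum>a<N. \<Sum>b<N. der_entry N (E a b) (mconj W ds) a b * cnj (u W)) \<partial>?H)"
    by (subst integral_mult_right_zero[symmetric]) simp
  also have "\<dots> = - (\<Sum>a<N. \<Sum>b<N. \<integral>W. der_entry N (E a b) (mconj W ds) a b * cnj (u W) \<partial>?H)"
  proof -
    have int: "integrable ?H (\<lambda>W. der_entry N (E a b) (mconj W ds) a b * cnj (u W))" if "a < N" "b < N" for a b
      unfolding u_def by (rule integrable_der_entry_dtr[OF that]) (simp add: E_def)
    then show ?thesis
      by (subst Bochner_Integration.integral_sum, force, intro arg_cong[where f = uminus] sum.cong refl,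
          subst Bochner_Integration.integral_sum, auto)
  qed
  finally have eq: "of_nat N ^ 2 * (\<integral>W. u W * cnj (u W) \<partial>?H)
      = - (\<Sum>a<N. \<Sum>b<N. \<integral>W. der_entry N (E a b) (mconj W ds) a b * cnj (u W) \<partial>?H)" .
  have "cmod (\<Sum>a<N. \<Sum>b<N. \<integral>W. der_entry N (E a b) (mconj W ds) a b * cnj (u W) \<partial>?H) \<le> (\<Sum>a<N. \<Sum>b<N. ?B)"
    unfolding u_def E_def[abs_def] by (intro sum_norm_le) (use loop_matrix_unit in fastforce)
  then have "cmod (of_nat N ^ 2 * (\<integral>W. u W * cnj (u W) \<partial>?H)) \<le> real N ^ 2 * ?B"
    unfolding eq norm_minus_cancel by (simp add: power2_eq_square)
  then have le: "cmod (\<integral>W. u W * cnj (u W) \<partial>?H) \<le> ?B"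
    unfolding norm_mult norm_power norm_of_nat
    by (rule mult_left_le_imp_le) (use N in simp)
  have "(\<integral>W. u W * cnj (u W) \<partial>?H) = (\<integral>W. complex_of_real (cmod (u W) ^ 2) \<partial>?H)"
    by (simp only: complex_norm_square)
  also have "\<dots> = complex_of_real (\<integral>W. cmod (u W) ^ 2 \<partial>?H)" by (rule integral_complex_of_real)
  finally have "cmod (\<integral>W. u W * cnj (u W) \<partial>?H) = \<bar>\<integral>W. cmod (u W) ^ 2 \<partial>?H\<bar>"
    by (simp only: norm_of_real)
  then show ?thesis using le unfolding u_def by linarith
qed

end

section \<open>Asymptotic freeness\<close>

lemma mat_eval_simps [simp]: "mat_eval N As [] = 1\<^sub>m N"
  "mat_eval N As ((j, b) # w) = (if b then mat_adjoint (As ! j) else As ! j) * mat_eval N As w"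
  by (simp_all add: mat_eval_def)

lemma mat_eval_carrier:
  assumes "set As \<subseteq> carrier_mat N N" "\<forall>(j, b)\<in>set w. j < length As"
  shows "mat_eval N As w \<in> carrier_mat N N"
  using assms(2)
proof (induction w)
  case (Cons l w)
  obtain j b where l: "l = (j, b)" by force
  have "As ! j \<in> carrier_mat N N" using Cons.prems assms(1) by (auto simp: l)
  then show ?case using Cons by (simp add: l)
qed simp

lemma mat_eval_append:
  assumes "set As \<subseteq> carrier_mat N N" "\<forall>(j, b)\<in>set (u @ w). j < length As"
  shows "mat_eval N As (u @ w) = mat_eval N As u * mat_eval N As w"
  using assms(2)
proof (induction u)
  case Nil
  then show ?case using mat_eval_carrier[OF assms(1), of w] by simp
next
  case (Cons l u)
  obtain j b where l: "l = (j, b)" by force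
  have "As ! j \<in> carrier_mat N N" using Cons.prems assms(1) by (auto simp: l)
  moreover have "mat_eval N As u \<in> carrier_mat N N" "mat_eval N As w \<in> carrier_mat N N"
    using Cons.prems by (intro mat_eval_carrier[OF assms(1)], auto)+
  ultimately show ?case using Cons by (simp add: l assoc_mult_mat[of _ N N _ N _ N])
qed

text \<open>A star word as a coloured list: the indices below r, belonging to the models of
  \<open>Xs\<close>, are the letters to be conjugated.\<close>

definition letters :: "nat \<Rightarrow> complex mat list \<Rightarrow> star_word \<Rightarrow> (bool \<times> complex mat) list" where
  "letters r L w = map (\<lambda>(j, b). (j < r, if b then mat_adjoint (L ! j) else L ! j)) w"

lemma length_letters [simp]: "length (letters r L w) = length w"
  by (simp add: letters_def)

definition conj_list :: "complex mat \<Rightarrow> complex mat list \<Rightarrow> complex mat list" where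
  "conj_list W As = map (\<lambda>A. W * A * mat_adjoint W) As"

lemma length_conj_list [simp]: "length (conj_list W As) = length As"
  by (simp add: conj_list_def)

lemma adjoint_conj:
  fixes W A :: "complex mat"
  assumes "W \<in> carrier_mat N N" "A \<in> carrier_mat N N"
  shows "mat_adjoint (W * A * mat_adjoint W) = W * mat_adjoint A * mat_adjoint W"
  using assms by (simp add: mat_adjoint_mult[of _ N N _ N] assoc_mult_mat[of _ N N _ N _ N])

text \<open>Starred letters fit in because the adjoint of a conjugate is the conjugate of the
  adjoint.\<close>

lemma mat_eval_conv_mprod:
  assumes W: "W \<in> carrier_mat N N" and As: "set As \<subseteq> carrier_mat N N"
    and w: "\<forall>(j, b)\<in>set w. j < length (As @ Vs)"
  shows "mat_eval N (conj_list W As @ Vs) w = mprod N (mconj W (letters (length As) (As @ Vs) w))"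
  using w
proof (induction w)
  case (Cons l w)
  obtain j b where l: "l = (j, b)" by force
  have "mat_adjoint (W * As ! j * mat_adjoint W) = W * mat_adjoint (As ! j) * mat_adjoint W" if "j < length As"
    using that As by (intro adjoint_conj[OF W]) auto
  then show ?case using Cons by (auto simp: l letters_def nth_append conj_list_def)
qed (simp add: letters_def)

section \<open>Convergence in mean over varying unitary groups\<close>

text \<open>Convergence in L1 to a constant, where each \<open>X k\<close> lives on its own
  probability space. The uniform bound is part of the notion so that it is stable under
  products.\<close>

definition L1_tendsto :: "(nat \<Rightarrow> nat) \<Rightarrow> (nat \<Rightarrow> complex mat \<Rightarrow> complex) \<Rightarrow> complex \<Rightarrow> bool" where
  "L1_tendsto d X x \<longleftrightarrow> (\<forall>k. X k \<in> borel_measurable (borel_unitary (d k))) \<and>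
     (\<exists>B. \<forall>k. \<forall>W\<in>unitary_group (d k). cmod (X k W) \<le> B) \<and>
     (\<lambda>k. \<integral>W. cmod (X k W - x) \<partial>haar_unitary (d k)) \<longlonglongrightarrow> 0"

lemma LIMSEQ_null_of_le:
  fixes f g :: "nat \<Rightarrow> real"
  assumes "\<And>k. 0 \<le> f k" "\<And>k. f k \<le> g k" "g \<longlonglongrightarrow> 0"
  shows "f \<longlonglongrightarrow> 0"
  by (rule tendsto_sandwich[OF _ _ tendsto_const assms(3)]) (use assms in auto)

lemma L1_tendstoD:
  assumes "L1_tendsto d X x"
  shows "X k \<in> borel_measurable (borel_unitary (d k))" "\<exists>B. \<forall>k. \<forall>W\<in>unitary_group (d k). cmod (X k W) \<le> B"
    "(\<lambda>k. \<integral>W. cmod (X k W - x) \<partial>haar_unitary (d k)) \<longlonglongrightarrow> 0"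
    "integrable (haar_unitary (d k)) (\<lambda>W. cmod (X k W - x))"
proof -
  show m: "X k \<in> borel_measurable (borel_unitary (d k))" and "\<exists>B. \<forall>k. \<forall>W\<in>unitary_group (d k). cmod (X k W) \<le> B"
    "(\<lambda>k. \<integral>W. cmod (X k W - x) \<partial>haar_unitary (d k)) \<longlonglongrightarrow> 0"
    using assms by (auto simp: L1_tendsto_def)
  then obtain B where B: "\<And>W. W \<in> unitary_group (d k) \<Longrightarrow> cmod (X k W) \<le> B" by blast
  show "integrable (haar_unitary (d k)) (\<lambda>W. cmod (X k W - x))"
  proof (rule integrable_haar_bounded[where B = "B + cmod x"])
    show "(\<lambda>W. cmod (X k W - x)) \<in> borel_measurable (borel_unitary (d k))" using m by simp
    show "norm (cmod (X k W - x)) \<le> B + cmod x" if "W \<in> unitary_group (d k)" for W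
      using B[OF that] norm_triangle_ineq4[of "X k W" x] by simp
  qed
qed

text \<open>Integrates a pointwise bound by two mean errors; the estimates for differences and
  products are of this form.\<close>

lemma L1_tendstoI_dominated:
  assumes m: "\<And>k. Z k \<in> borel_measurable (borel_unitary (d k))"
    and b: "\<And>k W. W \<in> unitary_group (d k) \<Longrightarrow> cmod (Z k W) \<le> B"
    and X: "L1_tendsto d X x" and Y: "L1_tendsto d Y y"
    and dom: "\<And>k W. W \<in> unitary_group (d k) \<Longrightarrow> cmod (Z k W - z) \<le> p * cmod (X k W - x) + q * cmod (Y k W - y)"
  shows "L1_tendsto d Z z"
  unfolding L1_tendsto_def
proof (intro conjI allI)
  show "\<exists>B. \<forall>k. \<forall>W\<in>unitary_group (d k). cmod (Z k W) \<le> B" using b by blast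
  have "(\<integral>W. cmod (Z k W - z) \<partial>haar_unitary (d k)) \<le> p * (\<integral>W. cmod (X k W - x) \<partial>haar_unitary (d k))
      + q * (\<integral>W. cmod (Y k W - y) \<partial>haar_unitary (d k))" for k
  proof -
    have "(\<integral>W. cmod (Z k W - z) \<partial>haar_unitary (d k))
        \<le> (\<integral>W. p * cmod (X k W - x) + q * cmod (Y k W - y) \<partial>haar_unitary (d k))"
      by (rule integral_mono') (use dom L1_tendstoD(4)[OF X] L1_tendstoD(4)[OF Y] order_trans[OF norm_ge_zero dom] in auto)
    then show ?thesis using L1_tendstoD(4)[OF X, of k] L1_tendstoD(4)[OF Y, of k] by simp
  qed
  moreover have "(\<lambda>k. p * (\<integral>W. cmod (X k W - x) \<partial>haar_unitary (d k))
      + q * (\<integral>W. cmod (Y k W - y) \<partial>haar_unitary (d k))) \<longlonglongrightarrow> p * 0 + q * 0"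
    by (intro tendsto_intros L1_tendstoD(3)[OF X] L1_tendstoD(3)[OF Y])
  ultimately show "(\<lambda>k. \<integral>W. cmod (Z k W - z) \<partial>haar_unitary (d k)) \<longlonglongrightarrow> 0"
    using LIMSEQ_null_of_le[of "\<lambda>k. \<integral>W. cmod (Z k W - z) \<partial>haar_unitary (d k)"] by fastforce
qed (rule m)

lemma L1_tendsto_deterministic:
  assumes "a \<longlonglongrightarrow> x" "\<And>k W. W \<in> unitary_group (d k) \<Longrightarrow> X k W = a k"
  shows "L1_tendsto d X x"
  unfolding L1_tendsto_def
proof (intro conjI allI)
  show "X k \<in> borel_measurable (borel_unitary (d k))" for k
    by (rule measurable_cong[THEN iffD2, of _ _ "\<lambda>_. a k"]) (use assms(2) in auto)
  obtain B where "\<And>k. cmod (a k) \<le> B" using assms(1) convergent_imp_Bseq convergentI BseqE by metis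
  then show "\<exists>B. \<forall>k. \<forall>W\<in>unitary_group (d k). cmod (X k W) \<le> B" using assms(2) by auto
  have "(\<integral>W. cmod (X k W - x) \<partial>haar_unitary (d k)) = cmod (a k - x)" for k
  proof -
    interpret prob_space "haar_unitary (d k)" by (rule prob_space_haar_unitary)
    have "(\<integral>W. cmod (X k W - x) \<partial>haar_unitary (d k)) = (\<integral>W. cmod (a k - x) \<partial>haar_unitary (d k))"
      by (rule Bochner_Integration.integral_cong) (use assms(2) in auto)
    then show ?thesis by (simp add: prob_space[simplified])
  qed
  then show "(\<lambda>k. \<integral>W. cmod (X k W - x) \<partial>haar_unitary (d k)) \<longlonglongrightarrow> 0"
    using tendsto_norm_zero[OF LIM_zero[OF assms(1)]] by simp
qed

lemma L1_tendsto_diff: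
  assumes "L1_tendsto d X x" "L1_tendsto d Y y"
  shows "L1_tendsto d (\<lambda>k W. X k W - Y k W) (x - y)"
proof -
  obtain B C where B: "\<And>k W. W \<in> unitary_group (d k) \<Longrightarrow> cmod (X k W) \<le> B"
    and C: "\<And>k W. W \<in> unitary_group (d k) \<Longrightarrow> cmod (Y k W) \<le> C"
    using L1_tendstoD(2)[OF assms(1)] L1_tendstoD(2)[OF assms(2)] by blast
  show ?thesis
  proof (rule L1_tendstoI_dominated[OF _ _ assms, where p = 1 and q = 1 and B = "B + C"])
    fix k W assume W: "W \<in> unitary_group (d k)"
    show "cmod (X k W - Y k W) \<le> B + C"
      using B[OF W] C[OF W] norm_triangle_ineq4[of "X k W" "Y k W"] by linarith
    show "cmod (X k W - Y k W - (x - y)) \<le> 1 * cmod (X k W - x) + 1 * cmod (Y k W - y)"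
      using norm_triangle_ineq4[of "X k W - x" "Y k W - y"] by (simp add: algebra_simps)
  qed (intro borel_measurable_diff L1_tendstoD(1)[OF assms(1)] L1_tendstoD(1)[OF assms(2)])
qed

lemma L1_tendsto_zero: "L1_tendsto d (\<lambda>_ _. 0) 0"
  by (rule L1_tendsto_deterministic[of "\<lambda>_. 0"]) auto

lemma L1_tendsto_add:
  assumes "L1_tendsto d X x" "L1_tendsto d Y y"
  shows "L1_tendsto d (\<lambda>k W. X k W + Y k W) (x + y)"
  using L1_tendsto_diff[OF assms(1) L1_tendsto_diff[OF L1_tendsto_zero assms(2)]] by simp

lemma L1_tendsto_sum: "(\<And>i. i \<in> S \<Longrightarrow> L1_tendsto d (X i) (x i)) \<Longrightarrow> L1_tendsto d (\<lambda>k W. \<Sum>i\<in>S. X i k W) (\<Sum>i\<in>S. x i)"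
  by (induction S rule: infinite_finite_induct) (auto intro: L1_tendsto_add L1_tendsto_zero)

lemma L1_tendsto_mult:
  assumes "L1_tendsto d X x" "L1_tendsto d Y y"
  shows "L1_tendsto d (\<lambda>k W. X k W * Y k W) (x * y)"
proof -
  obtain B C where B: "\<And>k W. W \<in> unitary_group (d k) \<Longrightarrow> cmod (X k W) \<le> B"
    and C: "\<And>k W. W \<in> unitary_group (d k) \<Longrightarrow> cmod (Y k W) \<le> C"
    using L1_tendstoD(2)[OF assms(1)] L1_tendstoD(2)[OF assms(2)] by blast
  show ?thesis
  proof (rule L1_tendstoI_dominated[OF _ _ assms, where p = "\<bar>C\<bar>" and q = "cmod x" and B = "\<bar>B\<bar> * \<bar>C\<bar>"])
    fix k W assume W: "W \<in> unitary_group (d k)"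
    show "cmod (X k W * Y k W) \<le> \<bar>B\<bar> * \<bar>C\<bar>"
      unfolding norm_mult using B[OF W] C[OF W] by (intro mult_mono) auto
    have "X k W * Y k W - x * y = (X k W - x) * Y k W + x * (Y k W - y)" by (simp add: algebra_simps)
    then have "cmod (X k W * Y k W - x * y) \<le> cmod (X k W - x) * cmod (Y k W) + cmod x * cmod (Y k W - y)"
      by (metis norm_triangle_ineq norm_mult)
    also have "\<dots> \<le> cmod (X k W - x) * \<bar>C\<bar> + cmod x * cmod (Y k W - y)"
      using C[OF W] by (intro add_right_mono mult_left_mono) auto
    finally show "cmod (X k W * Y k W - x * y) \<le> \<bar>C\<bar> * cmod (X k W - x) + cmod x * cmod (Y k W - y)"
      by (simp add: mult.commute)
  qed (intro borel_measurable_times L1_tendstoD(1)[OF assms(1)] L1_tendstoD(1)[OF assms(2)])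
qed

lemma L1_tendsto_cong: "L1_tendsto d X x \<Longrightarrow> (\<And>k W. W \<in> unitary_group (d k) \<Longrightarrow> X k W = Y k W) \<Longrightarrow> L1_tendsto d Y x"
proof -
  assume X: "L1_tendsto d X x" and eq: "\<And>k W. W \<in> unitary_group (d k) \<Longrightarrow> X k W = Y k W"
  obtain B where B: "\<And>k W. W \<in> unitary_group (d k) \<Longrightarrow> cmod (X k W) \<le> B"
    using L1_tendstoD(2)[OF X] by blast
  show ?thesis
  proof (rule L1_tendstoI_dominated[OF _ _ X X, where p = 1 and q = 0 and B = B])
    show "Y k \<in> borel_measurable (borel_unitary (d k))" for k
      using L1_tendstoD(1)[OF X, of k] by (rule measurable_cong[THEN iffD1, rotated]) (use eq in auto)
  qed (use B eq in auto)
qed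

text \<open>Nonnegativity of the variance; it converts the second moment bound of the loop equation
  into convergence in mean.\<close>

lemma expectation_le_sqrt:
  fixes f :: "'a \<Rightarrow> real"
  assumes "prob_space M" "integrable M f" "integrable M (\<lambda>x. f x ^ 2)"
  shows "(\<integral>x. f x \<partial>M) \<le> sqrt (\<integral>x. f x ^ 2 \<partial>M)"
proof -
  interpret prob_space M by fact
  define m where "m = (\<integral>x. f x \<partial>M)"
  have "0 \<le> (\<integral>x. (f x - m) ^ 2 \<partial>M)" by simp
  also have "\<dots> = (\<integral>x. f x ^ 2 \<partial>M) - m ^ 2"
    unfolding m_def using assms(2,3) by (rule variance_eq)
  finally have "m ^ 2 \<le> (\<integral>x. f x ^ 2 \<partial>M)" by simp
  then show ?thesis unfolding m_def by (rule real_le_rsqrt)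
qed

text \<open>Cut the word where a letter satisfying P is followed by one that does not, and swap the
  two pieces. If there is no such place, the word consists of letters outside P followed by letters
  in P and is already in the desired form.\<close>

lemma mixed_word_rotation:
  assumes "\<exists>x\<in>set w. P x" "\<exists>x\<in>set w. \<not> P x"
  obtains xs ys where "w = xs @ ys" "ys @ xs \<noteq> []" "\<not> P (hd (ys @ xs))" "P (last (ys @ xs))"
proof (cases "successively (\<lambda>x y. P x \<longrightarrow> P y) w")
  case False
  then obtain xs x y ys where "w = xs @ x # y # ys" "\<not> (P x \<longrightarrow> P y)" by (rule not_successively_decomp)
  then show thesis using that[of "xs @ [x]" "y # ys"] by auto
next
  case True
  have last: "P (last u)" if "successively (\<lambda>x y. P x \<longrightarrow> P y) u" "z \<in> set u" "P z" for u z
    using that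
  proof (induction u arbitrary: z)
    case (Cons a u)
    show ?case
    proof (cases "u = []")
      case False
      have succ: "successively (\<lambda>x y. P x \<longrightarrow> P y) u" "P a \<longrightarrow> P (hd u)"
        using Cons.prems(1) False by (auto simp: successively_Cons)
      have "z = a \<or> z \<in> set u" using Cons.prems(2) by simp
      then have "P (last u)"
        using Cons.IH[OF succ(1), of z] Cons.IH[OF succ(1) hd_in_set[OF False]] succ(2) Cons.prems(3) by blast
      then show ?thesis using False by simp
    qed (use Cons.prems in simp)
  qed simp
  have all: "\<forall>z\<in>set u. P z" if "successively (\<lambda>x y. P x \<longrightarrow> P y) u" "u \<noteq> []" "P (hd u)" for u
    using that
  proof (induction u)
    case (Cons a u)
    show ?case
    proof (cases "u = []")
      case False
      have succ: "successively (\<lambda>x y. P x \<longrightarrow> P y) u" "P a \<longrightarrow> P (hd u)"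
        using Cons.prems(1) False by (auto simp: successively_Cons)
      have Pa: "P a" using Cons.prems(3) by simp
      then have "\<forall>z\<in>set u. P z" using Cons.IH[OF succ(1) False] succ(2) by blast
      then show ?thesis using Pa unfolding list.set by blast
    qed (use Cons.prems in simp)
  qed simp
  have "w \<noteq> []" using assms by auto
  then show thesis using that[of "[]" w] last[OF True] all[OF True] assms by (metis append_Nil2 append_Nil)
qed

text \<open>Only the last index contributes the full word with a plus sign, multiplied by \<phi> of
  the empty word.\<close>

lemma wsum_split_last:
  assumes "u \<noteq> []" "fst (last u) < r"
  shows "wsum \<phi> r u = \<phi> u * \<phi> [] + ((\<Sum>i<length u - 1. if fst (u ! i) < r
     then \<phi> (take (Suc i) u) * \<phi> (drop (Suc i) u) - \<phi> (take i u) * \<phi> (drop i u) else 0)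
     - \<phi> (take (length u - 1) u) * \<phi> (drop (length u - 1) u))"
proof -
  define m where "m = length u - 1"
  have m: "length u = Suc m" using assms(1) by (simp add: m_def)
  then have "fst (u ! m) < r" using assms by (simp add: last_conv_nth)
  moreover have "take (Suc m) u = u" "drop (Suc m) u = []" using m by simp_all
  ultimately show ?thesis unfolding wsum_def m_def[symmetric] m by simp
qed

text \<open>\<open>As k\<close> and \<open>Vs k\<close> are matrix models of \<open>Xs\<close> and \<open>vs\<close> of size \<open>d k\<close>.\<close>

locale free_models =
  fixes M :: "'h::complex_hilbert_space op set" and \<tau> :: "'h op \<Rightarrow> complex" and Xs vs :: "'h op list"
    and d :: "nat \<Rightarrow> nat" and As Vs :: "nat \<Rightarrow> complex mat list" and R :: real
  assumes vN: "von_neumann_algebra M" and st: "state_on M \<tau>" and tracial: "tracial_on M \<tau>"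
    and Xs: "set Xs \<subseteq> M" and vs: "set vs \<subseteq> M" and free: "freely_independent \<tau> Xs vs"
    and d_pos: "\<And>k. d k > 0" and d_lim: "filterlim d at_top sequentially"
    and As: "\<And>k. length (As k) = length Xs" "\<And>k. set (As k) \<subseteq> sa_mats_bounded (d k) R"
    and Vs: "\<And>k. length (Vs k) = length vs" "\<And>k. set (Vs k) \<subseteq> unitary_group (d k)"
    and As_lim: "\<And>w. \<forall>(j, b)\<in>set w. j < length Xs \<Longrightarrow>
      (\<lambda>k. ntrace (d k) (mat_eval (d k) (As k) w)) \<longlonglongrightarrow> \<tau> (op_eval Xs w)"
    and Vs_lim: "\<And>w. \<forall>(j, b)\<in>set w. j < length vs \<Longrightarrow>
      (\<lambda>k. ntrace (d k) (mat_eval (d k) (Vs k) w)) \<longlonglongrightarrow> \<tau> (op_eval vs w)"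
begin

abbreviation r where "r \<equiv> length Xs"

definition good_word :: "star_word \<Rightarrow> bool" where
  "good_word w \<longleftrightarrow> (\<forall>(j, b)\<in>set w. j < length (Xs @ vs))"

definition \<phi> :: "star_word \<Rightarrow> complex" where
  "\<phi> w = \<tau> (op_eval (Xs @ vs) w)"

definition T :: "star_word \<Rightarrow> nat \<Rightarrow> complex mat \<Rightarrow> complex" where
  "T w k W = ntrace (d k) (mat_eval (d k) (conj_list W (As k) @ Vs k) w)"

text \<open>Bounds the models of \<open>Xs\<close> and the unitaries alike; being at least 1, its
  powers increase with the word length.\<close>

definition bd :: real where "bd = max 1 R"

lemma good_word_simps: "good_word []" "good_word (u @ w) \<longleftrightarrow> good_word u \<and> good_word w"
  "good_word u \<Longrightarrow> good_word (take i u)" "good_word u \<Longrightarrow> good_word (drop i u)"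
  by (auto simp: good_word_def dest: in_set_takeD in_set_dropD)

lemma As_carrier: "set (As k) \<subseteq> carrier_mat (d k) (d k)"
  using As(2)[of k] by (auto simp: sa_mats_bounded_def sa_mats_def)

lemma Vs_carrier: "set (Vs k) \<subseteq> carrier_mat (d k) (d k)"
  using Vs(2)[of k] by (auto intro: unitary_group_carrier)

lemma conj_carrier:
  assumes "W \<in> unitary_group (d k)"
  shows "set (conj_list W (As k) @ Vs k) \<subseteq> carrier_mat (d k) (d k)"
proof -
  have "W \<in> carrier_mat (d k) (d k)" by (rule unitary_group_carrier[OF assms])
  then show ?thesis using As_carrier[of k] Vs_carrier[of k] by (fastforce simp: conj_list_def)
qed

lemma op_eval_M: "good_word w \<Longrightarrow> op_eval (Xs @ vs) w \<in> M"
proof (induction w)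
  case (Cons l w)
  obtain j b where l: "l = (j, b)" by force
  have "(Xs @ vs) ! j \<in> set (Xs @ vs)" using Cons.prems by (intro nth_mem) (simp add: good_word_def l)
  then have "(Xs @ vs) ! j \<in> M" using Xs vs by auto
  then show ?case using Cons by (simp add: l good_word_def von_neumann_algebra_closed[OF vN])
qed (simp add: von_neumann_algebra_closed[OF vN])

lemma mbound_letters: "good_word w \<Longrightarrow> mbound (d k) bd (letters r (As k @ Vs k) w)"
proof (induction w)
  case (Cons l w)
  obtain j b where l: "l = (j, b)" by force
  have j: "j < length (As k @ Vs k)" using Cons.prems by (simp add: l good_word_def As Vs)
  have "opnorm_le (d k) (if b then mat_adjoint ((As k @ Vs k) ! j) else (As k @ Vs k) ! j) bd"
  proof (cases "j < r")
    case True
    then have "(As k @ Vs k) ! j = As k ! j" "As k ! j \<in> set (As k)" using As(1)[of k] by (auto simp: nth_append)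
    then have A: "(As k @ Vs k) ! j \<in> sa_mats_bounded (d k) R" using As(2)[of k] by auto
    then have "opnorm_le (d k) ((As k @ Vs k) ! j) R" "mat_adjoint ((As k @ Vs k) ! j) = (As k @ Vs k) ! j"
      by (auto simp: sa_mats_bounded_def sa_mats_def intro: opnorm_le_of_mat_opnorm)
    then show ?thesis by (auto simp: bd_def elim: opnorm_le_mono)
  next
    case False
    then have "(As k @ Vs k) ! j \<in> unitary_group (d k)"
      using Vs(2)[of k] nth_mem[of "j - r" "Vs k"] j by (auto simp: nth_append As)
    then show ?thesis by (auto simp: bd_def intro: opnorm_le_mono[OF opnorm_le_unitary] adjoint_unitary_group)
  qed
  then show ?case using Cons by (simp add: l letters_def good_word_def)
qed (simp add: letters_def)

lemma mat_eval_eq_mprod: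
  assumes "W \<in> unitary_group (d k)" "good_word w"
  shows "mat_eval (d k) (conj_list W (As k) @ Vs k) w = mprod (d k) (mconj W (letters r (As k @ Vs k) w))"
  using mat_eval_conv_mprod[OF unitary_group_carrier[OF assms(1)] As_carrier, of w "Vs k"] assms(2)
  by (simp add: good_word_def As Vs)

lemma T_Nil: "T [] k W = 1"
  using d_pos[of k] by (simp add: T_def ntrace_def)

lemma T_rotate:
  assumes "W \<in> unitary_group (d k)" "good_word (u @ w)"
  shows "T (u @ w) k W = T (w @ u) k W"
proof -
  have g: "\<forall>(j, b)\<in>set (u @ w). j < length (conj_list W (As k) @ Vs k)"
    "\<forall>(j, b)\<in>set (w @ u). j < length (conj_list W (As k) @ Vs k)"
    using assms(2) by (auto simp: good_word_def As Vs)
  show ?thesis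
    unfolding T_def mat_eval_append[OF conj_carrier[OF assms(1)] g(1)] mat_eval_append[OF conj_carrier[OF assms(1)] g(2)]
    by (rule ntrace_comm; rule mat_eval_carrier[OF conj_carrier[OF assms(1)]]) (use g in auto)
qed

lemma \<phi>_rotate: "good_word (u @ w) \<Longrightarrow> \<phi> (u @ w) = \<phi> (w @ u)"
  using tracial by (simp add: \<phi>_def op_eval_append good_word_simps tracial_on_def op_eval_M)

text \<open>On random moments \<open>wsum\<close> is the \<open>dtr\<close> of the conjugated
  letters, so \<open>loop_estimate\<close> bounds its second moment by a constant over
  \<open>d k\<close>, with a constant depending only on the word and on \<open>R\<close>.\<close>

lemma L1_tendsto_wsum:
  assumes w: "good_word w"
  shows "L1_tendsto d (\<lambda>k W. wsum (\<lambda>u. T u k W) r w) 0"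
proof -
  let ?n = "length w"
  define C where "C = 16 * real ?n ^ 2 * (bd ^ ?n) ^ 3"
  have bd: "1 \<le> bd" by (simp add: bd_def)
  define D where "D k W = dtr (d k) (mconj W (letters r (As k @ Vs k) w))" for k W
  have fst_eq: "fst (mconj W (letters r (As k @ Vs k) w) ! i) = (fst (w ! i) < r)" if "i < ?n" for W k i
    using that by (simp add: mconj_def letters_def case_prod_beta)
  have eq: "wsum (\<lambda>u. T u k W) r w = D k W" if W: "W \<in> unitary_group (d k)" for k W
  proof -
    have 1: "ntrace (d k) (mprod (d k) (take i (mconj W (letters r (As k @ Vs k) w)))) = T (take i w) k W"
     and 2: "ntrace (d k) (mprod (d k) (drop i (mconj W (letters r (As k @ Vs k) w)))) = T (drop i w) k W" for i
      using mat_eval_eq_mprod[OF W good_word_simps(3)[OF w]] mat_eval_eq_mprod[OF W good_word_simps(4)[OF w]]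
      by (simp_all add: T_def take_mconj drop_mconj letters_def take_map drop_map)
    show ?thesis
      unfolding wsum_def D_def dtr_def 1 2
      by (intro sum.cong) (auto simp: fst_eq)
  qed
  have m: "D k \<in> borel_measurable (borel_unitary (d k))" for k
    unfolding D_def by (rule measurable_dtr[OF d_pos mbound_letters[OF w] bd])
  have b: "cmod (D k W) \<le> real ?n * (2 * (bd ^ ?n) ^ 2)" if "W \<in> unitary_group (d k)" for k W
    unfolding D_def
    using cmod_dtr_le[OF bd mconj_bound[OF mbound_letters[OF w] that] d_pos] bd by (simp add: letters_def)
  have est: "(\<integral>W. cmod (D k W - 0) \<partial>haar_unitary (d k)) \<le> sqrt (C / real (d k))" for k
  proof -
    have i1: "integrable (haar_unitary (d k)) (\<lambda>W. cmod (D k W))"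
      by (rule integrable_haar_bounded[where B = "real ?n * (2 * (bd ^ ?n) ^ 2)"]) (use m b in auto)
    have i2: "integrable (haar_unitary (d k)) (\<lambda>W. cmod (D k W) ^ 2)"
      by (rule integrable_haar_bounded[where B = "(real ?n * (2 * (bd ^ ?n) ^ 2)) ^ 2"])
        (use m b in \<open>auto intro!: power_mono\<close>)
    have "(\<integral>W. cmod (D k W) \<partial>haar_unitary (d k)) \<le> sqrt (\<integral>W. cmod (D k W) ^ 2 \<partial>haar_unitary (d k))"
      by (rule expectation_le_sqrt[OF prob_space_haar_unitary i1 i2])
    also have "\<dots> \<le> sqrt (C / real (d k))"
      using loop_estimate[OF d_pos mbound_letters[OF w] bd, of k] by (simp add: D_def C_def letters_def)
    finally show ?thesis by simp
  qed
  have "filterlim (\<lambda>k. real (d k)) at_top sequentially"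
    by (rule filterlim_compose[OF filterlim_real_sequentially d_lim])
  then have "(\<lambda>k. C / real (d k)) \<longlonglongrightarrow> 0"
    by (intro tendsto_divide_0[OF tendsto_const] filterlim_at_top_imp_at_infinity)
  then have "(\<lambda>k. sqrt (C / real (d k))) \<longlonglongrightarrow> sqrt 0" by (rule tendsto_real_sqrt)
  then have "(\<lambda>k. \<integral>W. cmod (D k W - 0) \<partial>haar_unitary (d k)) \<longlonglongrightarrow> 0"
    using LIMSEQ_null_of_le[OF _ est] by fastforce
  then have "L1_tendsto d D 0" unfolding L1_tendsto_def using m b by blast
  then show ?thesis by (rule L1_tendsto_cong) (use eq in simp)
qed

lemma \<phi>_wsum: "good_word w \<Longrightarrow> wsum \<phi> r w = 0"
  using wsum_free[OF vN st Xs vs free, of w] by (simp add: good_word_def \<phi>_def[abs_def])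

text \<open>The inner factors W^* W cancel, and the trace of the remaining conjugate does not depend
  on W: such moments are deterministic.\<close>

lemma T_pure_X:
  assumes W: "W \<in> unitary_group (d k)" and w: "\<forall>(j, b)\<in>set w. j < r"
  shows "T w k W = ntrace (d k) (mat_eval (d k) (As k) w)"
proof -
  note c = unitary_group_carrier[OF W]
  have car: "mat_eval (d k) (As k) w \<in> carrier_mat (d k) (d k)" if "\<forall>(j, b)\<in>set w. j < r" for w
    by (rule mat_eval_carrier[OF As_carrier]) (use that in \<open>simp add: As\<close>)
  have unit: "W * mat_adjoint W = 1\<^sub>m (d k)" "mat_adjoint W * W = 1\<^sub>m (d k)" using W by (auto simp: unitary_group_def)
  have "mat_eval (d k) (conj_list W (As k) @ Vs k) w = W * mat_eval (d k) (As k) w * mat_adjoint W"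
    using w
  proof (induction w)
    case Nil
    then show ?case using c unit by simp
  next
    case (Cons l w)
    obtain j b where l: "l = (j, b)" by force
    have j: "j < length (As k)" using Cons.prems by (simp add: l As)
    define B where "B = (if b then mat_adjoint (As k ! j) else As k ! j)"
    have A: "As k ! j \<in> carrier_mat (d k) (d k)" using As_carrier[of k] j by auto
    then have B: "B \<in> carrier_mat (d k) (d k)" by (simp add: B_def)
    have E: "mat_eval (d k) (As k) w \<in> carrier_mat (d k) (d k)" using Cons.prems by (intro car) simp
    have "mat_eval (d k) (conj_list W (As k) @ Vs k) (l # w)
        = (W * B * mat_adjoint W) * (W * mat_eval (d k) (As k) w * mat_adjoint W)"
      using Cons j adjoint_conj[OF c A] by (simp add: l nth_append conj_list_def B_def)
    also have "\<dots> = (W * B * mat_adjoint W) * (W * (mat_eval (d k) (As k) w * mat_adjoint W))"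
      using c E by (simp add: assoc_mult_mat[of W "d k" "d k" _ "d k" _ "d k"])
    also have "\<dots> = (W * B) * (mat_eval (d k) (As k) w * mat_adjoint W)"
      by (rule mult_cancel_middle[of _ "d k"]) (use c B E unit in auto)
    also have "\<dots> = W * mat_eval (d k) (As k) (l # w) * mat_adjoint W"
      using c B E by (simp add: l B_def[symmetric] assoc_mult_mat[of _ "d k" "d k" _ "d k" _ "d k"])
    finally show ?case .
  qed
  then have "T w k W = ntrace (d k) (W * mat_eval (d k) (As k) w * mat_adjoint W)" by (simp add: T_def)
  also have "\<dots> = ntrace (d k) (mat_adjoint W * (W * mat_eval (d k) (As k) w))"
    by (rule ntrace_comm) (use c car[OF w] in auto)
  also have "mat_adjoint W * (W * mat_eval (d k) (As k) w) = (mat_adjoint W * W) * mat_eval (d k) (As k) w"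
    using c car[OF w] by (simp add: assoc_mult_mat[of _ "d k" "d k" _ "d k" _ "d k"])
  also have "\<dots> = mat_eval (d k) (As k) w" using car[OF w] by (simp add: unit)
  finally show ?thesis .
qed

lemma op_eval_pure_X: "\<forall>(j, b)\<in>set w. j < r \<Longrightarrow> op_eval (Xs @ vs) w = op_eval Xs w"
  by (induction w) (auto simp: nth_append)

definition shift :: "star_word \<Rightarrow> star_word" where
  "shift w = map (\<lambda>(j, b). (j - r, b)) w"

lemma op_eval_pure_v: "\<forall>(j, b)\<in>set w. \<not> j < r \<Longrightarrow> op_eval (Xs @ vs) w = op_eval vs (shift w)"
  by (induction w) (auto simp: nth_append shift_def)

lemma mat_eval_pure_v: "\<forall>(j, b)\<in>set w. \<not> j < r \<Longrightarrow>
    mat_eval (d k) (conj_list W (As k) @ Vs k) w = mat_eval (d k) (Vs k) (shift w)"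
  by (induction w) (auto simp: nth_append shift_def As)

text \<open>A mixed word can be rotated so that it starts with a letter of \<open>vs\<close> and ends with one of \<open>Xs\<close>.
  Then all terms of \<open>wsum\<close> but one only involve shorter words.\<close>

lemma L1_tendsto_moment: "good_word w \<Longrightarrow> L1_tendsto d (T w) (\<phi> w)"
proof (induction w rule: measure_induct_rule[where f = length])
  case (less w)
  consider "\<forall>l\<in>set w. fst l < r" | "\<forall>l\<in>set w. \<not> fst l < r"
    | "\<exists>l\<in>set w. fst l < r" "\<exists>l\<in>set w. \<not> fst l < r" by blast
  then show ?case
  proof cases
    case 1
    then have w: "\<forall>(j, b)\<in>set w. j < r" by auto
    show ?thesis unfolding \<phi>_def op_eval_pure_X[OF w]
      by (rule L1_tendsto_deterministic[OF As_lim[OF w]]) (rule T_pure_X[OF _ w])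
  next
    case 2
    then have w: "\<forall>(j, b)\<in>set w. \<not> j < r" by auto
    have s: "\<forall>(j, b)\<in>set (shift w). j < length vs"
      using w less.prems by (fastforce simp: shift_def good_word_def)
    show ?thesis unfolding \<phi>_def op_eval_pure_v[OF w]
      by (rule L1_tendsto_deterministic[OF Vs_lim[OF s]]) (simp add: T_def mat_eval_pure_v[OF w])
  next
    case 3
    then obtain xs ys where w: "w = xs @ ys" and ne: "ys @ xs \<noteq> []"
      and hd: "\<not> fst (hd (ys @ xs)) < r" and last: "fst (last (ys @ xs)) < r"
      by (rule mixed_word_rotation)
    define u where "u = ys @ xs"
    have gu: "good_word u" and len: "length u = length w" and ne: "u \<noteq> []" and hd: "\<not> fst (u ! 0) < r"
      using less.prems hd ne by (auto simp: u_def w good_word_simps hd_conv_nth)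
    define n where "n = length u"
    have n: "n > 0" using ne by (simp add: n_def)
    have short: "L1_tendsto d (T (take i u)) (\<phi> (take i u))" if "i < n" for i
      using that gu by (intro less.IH) (auto simp: good_word_simps n_def len)
    have short': "L1_tendsto d (T (drop i u)) (\<phi> (drop i u))" if "0 < i" for i
      using that gu n by (intro less.IH) (auto simp: good_word_simps n_def len)
    define rest where "rest f = (\<Sum>i<n - 1. if fst (u ! i) < r
       then f (take (Suc i) u) * f (drop (Suc i) u) - f (take i u) * f (drop i u) else 0)
       - f (take (n - 1) u) * f (drop (n - 1) u)" for f :: "star_word \<Rightarrow> complex"
    have split: "wsum f r u = f u * f [] + rest f" for f
      unfolding rest_def n_def using wsum_split_last[OF ne, of r f] last by (simp add: u_def)
    have term_cv: "L1_tendsto d (\<lambda>k W. T (take (Suc i) u) k W * T (drop (Suc i) u) k W - T (take i u) k W * T (drop i u) k W)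
        (\<phi> (take (Suc i) u) * \<phi> (drop (Suc i) u) - \<phi> (take i u) * \<phi> (drop i u))"
      if "i < n - 1" "fst (u ! i) < r" for i
    proof -
      \<comment> \<open>At i = 0 the summand would contain the full word with a minus sign and
        cancel the very term that is solved for. A first letter from \<open>vs\<close> excludes
        this.\<close>
      have "i \<noteq> 0" using hd that by (cases i) auto
      then show ?thesis using that by (intro L1_tendsto_diff L1_tendsto_mult short short') auto
    qed
    have rest_term: "L1_tendsto d (\<lambda>k W. if fst (u ! i) < r then T (take (Suc i) u) k W * T (drop (Suc i) u) k W - T (take i u) k W * T (drop i u) k W else 0)
        (if fst (u ! i) < r then \<phi> (take (Suc i) u) * \<phi> (drop (Suc i) u) - \<phi> (take i u) * \<phi> (drop i u) else 0)"
      if "i < n - 1" for i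
      using term_cv[OF that] L1_tendsto_zero by (cases "fst (u ! i) < r") simp_all
    have last_cv: "L1_tendsto d (\<lambda>k W. T (take (n - 1) u) k W * T (drop (n - 1) u) k W) (\<phi> (take (n - 1) u) * \<phi> (drop (n - 1) u))"
    \<comment> \<open>A word of one letter cannot start in \<open>vs\<close> and end in
      \<open>Xs\<close>.\<close>
    proof (cases "n = 1")
      case True
      then have "length u = 1" by (simp add: n_def)
      then have "u ! 0 = last u" using ne by (simp add: last_conv_nth)
      then show ?thesis using hd last by (simp add: u_def)
    next
      case False
      then show ?thesis using n by (intro L1_tendsto_mult short short') auto
    qed
    have "L1_tendsto d (\<lambda>k W. rest (\<lambda>w. T w k W)) (rest \<phi>)"
      unfolding rest_def by (intro L1_tendsto_diff L1_tendsto_sum rest_term last_cv) simp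
    from L1_tendsto_diff[OF L1_tendsto_wsum[OF gu] this] have "L1_tendsto d (T u) (0 - rest \<phi>)"
      by (rule L1_tendsto_cong) (simp add: split T_Nil)
    \<comment> \<open>The exact moments solve the same equation, without error term.\<close>
    moreover have "\<phi> u = - rest \<phi>"
      using \<phi>_wsum[OF gu] state_id[OF vN st] unfolding split
      by (simp add: \<phi>_def[of "[]"] eq_neg_iff_add_eq_0)
    ultimately have "L1_tendsto d (T u) (\<phi> u)" by simp
    moreover have "\<phi> w = \<phi> u" using less.prems \<phi>_rotate[of xs ys] by (simp add: w u_def)
    moreover have "T u k W = T w k W" if "W \<in> unitary_group (d k)" for k W
      using T_rotate[OF that, of xs ys] less.prems by (simp add: w u_def)
    ultimately show ?thesis
      by (metis (mono_tags, lifting) L1_tendsto_cong)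
  qed
qed

end

lemma finite_star_words: "finite (star_words r m)"
proof -
  have "star_words r m \<subseteq> {w. set w \<subseteq> {..<r} \<times> UNIV \<and> length w \<le> m}"
    by (auto simp: star_words_def)
  then show ?thesis by (rule finite_subset) (intro finite_lists_length_le, simp)
qed

lemma moments_closeD:
  "moments_close \<tau> Ys N m \<delta> As \<Longrightarrow> length w \<le> m \<Longrightarrow> \<forall>(j, b)\<in>set w. j < length Ys \<Longrightarrow>
    cmod (ntrace N (mat_eval N As w) - \<tau> (op_eval Ys w)) < \<delta>"
  by (auto simp: moments_close_def star_words_def)

text \<open>A fixed word is covered by the accuracy of the k-th model as soon as k reaches its
  length, and the error bound then tends to 0.\<close>

lemma LIMSEQ_of_moments_close:
  assumes "\<And>k. moments_close \<tau> Ys (d k) k (1 / real (Suc k)) (As k)" "\<forall>(j, b)\<in>set w. j < length Ys"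
  shows "(\<lambda>k. ntrace (d k) (mat_eval (d k) (As k) w)) \<longlonglongrightarrow> \<tau> (op_eval Ys w)"
proof (rule LIM_zero_cancel, rule Lim_null_comparison)
  show "\<forall>\<^sub>F k in sequentially. norm (ntrace (d k) (mat_eval (d k) (As k) w) - \<tau> (op_eval Ys w)) \<le> 1 / real (Suc k)"
    using eventually_ge_at_top[of "length w"]
    by eventually_elim (use moments_closeD[OF assms(1) _ assms(2)] in \<open>auto intro: less_imp_le\<close>)
  show "(\<lambda>k. 1 / real (Suc k)) \<longlonglongrightarrow> 0"
    using LIMSEQ_inverse_real_of_nat by (simp add: inverse_eq_divide)
qed

context free_models
begin

text \<open>Markov's inequality for each of the finitely many words and a union bound. Once the
  summed mean errors are below \<delta> / 2, the exceptional set has probability at most 1/2. A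
  single such k suffices for the contradiction in
  \<open>uniform_asymptotic_freeness\<close>.\<close>

lemma eventually_moments_close:
  assumes \<delta>: "\<delta> > 0"
  shows "\<exists>k. measure (haar_unitary (d k))
    {W\<in>unitary_group (d k). moments_close \<tau> (Xs @ vs) (d k) m \<delta> (conj_list W (As k) @ Vs k)} \<ge> 1 / 2"
proof -
  let ?S = "star_words (length (Xs @ vs)) m"
  define e where "e w k = (\<integral>W. cmod (T w k W - \<phi> w) \<partial>haar_unitary (d k))" for w k
  have L1_tendsto: "L1_tendsto d (T w) (\<phi> w)" if "w \<in> ?S" for w
    using that by (intro L1_tendsto_moment) (auto simp: good_word_def star_words_def)
  have "(\<lambda>k. \<Sum>w\<in>?S. e w k) \<longlonglongrightarrow> (\<Sum>w\<in>?S. 0)"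
    unfolding e_def by (intro tendsto_sum L1_tendstoD(3) L1_tendsto)
  then have "\<forall>\<^sub>F k in sequentially. (\<Sum>w\<in>?S. e w k) < \<delta> / 2"
    using \<delta> by (intro order_tendstoD) auto
  then obtain k where k: "(\<Sum>w\<in>?S. e w k) < \<delta> / 2" by (auto simp: eventually_sequentially)
  interpret prob_space "haar_unitary (d k)" by (rule prob_space_haar_unitary)
  define B where "B w = {W\<in>unitary_group (d k). cmod (T w k W - \<phi> w) \<ge> \<delta>}" for w
  have B: "B w \<in> events \<and> prob (B w) \<le> e w k / \<delta>" if "w \<in> ?S" for w
  proof
    have m: "(\<lambda>W. cmod (T w k W - \<phi> w)) \<in> borel_measurable (haar_unitary (d k))"
      using L1_tendstoD(1)[OF L1_tendsto[OF that], of k] by (simp cong: measurable_cong_sets)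
    then have "{W\<in>space (haar_unitary (d k)). cmod (T w k W - \<phi> w) \<ge> \<delta>} \<in> events" by measurable
    then show "B w \<in> events" by (simp add: B_def)
    show "prob (B w) \<le> e w k / \<delta>"
      using integral_Markov_inequality_measure[OF L1_tendstoD(4)[OF L1_tendsto[OF that], of k], of "{}" \<delta>] \<delta>
      by (simp add: B_def e_def)
  qed
  have fin: "finite ?S" by (rule finite_star_words)
  have UB: "(\<Union>w\<in>?S. B w) \<in> events" using B fin by auto
  have "prob (\<Union>w\<in>?S. B w) \<le> (\<Sum>w\<in>?S. prob (B w))"
    by (rule finite_measure_subadditive_finite[OF fin]) (use B in auto)
  also have "\<dots> \<le> (\<Sum>w\<in>?S. e w k / \<delta>)" by (rule sum_mono) (use B in auto)
  also have "\<dots> = (\<Sum>w\<in>?S. e w k) / \<delta>" by (simp add: sum_divide_distrib)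
  also have "\<dots> \<le> 1 / 2" using k \<delta> by (simp add: field_simps)
  finally have "1 / 2 \<le> prob (space (haar_unitary (d k)) - (\<Union>w\<in>?S. B w))"
    by (subst prob_compl[OF UB]) simp
  also have "space (haar_unitary (d k)) - (\<Union>w\<in>?S. B w)
      = {W\<in>unitary_group (d k). moments_close \<tau> (Xs @ vs) (d k) m \<delta> (conj_list W (As k) @ Vs k)}"
    by (auto simp: B_def moments_close_def T_def \<phi>_def not_le)
  finally show ?thesis by blast
qed

end

text \<open>Otherwise there are counterexamples with m' = k, \<delta>' = 1 / (k + 1) and N > k for
  every k. They form an instance of \<open>free_models\<close>, in which
  \<open>eventually_moments_close\<close> refutes one of them.\<close>

lemma uniform_asymptotic_freeness:
  fixes M :: "'h::complex_hilbert_space op set"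
  assumes "von_neumann_algebra M" "state_on M \<tau>" "tracial_on M \<tau>" "set Xs \<subseteq> M" "set vs \<subseteq> M"
    "freely_independent \<tau> Xs vs" and \<delta>: "\<delta> > 0"
  shows "\<exists>m' \<delta>' N0. \<delta>' > 0 \<and> (\<forall>N As Vs. N \<ge> N0 \<and> As \<in> Gamma_R R \<tau> Xs N m' \<delta>' \<and> length Vs = length vs \<and>
      set Vs \<subseteq> unitary_group N \<and> moments_close \<tau> vs N m' \<delta>' Vs \<longrightarrow>
      measure (haar_unitary N) {W\<in>unitary_group N. moments_close \<tau> (Xs @ vs) N m \<delta> (conj_list W As @ Vs)} \<ge> 1 / 2)"
proof -
  define Q where "Q m' \<delta>' N As Vs \<longleftrightarrow> As \<in> Gamma_R R \<tau> Xs N m' \<delta>' \<and> length Vs = length vs \<and> set Vs \<subseteq> unitary_group N \<and>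
      moments_close \<tau> vs N m' \<delta>' Vs \<and>
      \<not> measure (haar_unitary N) {W\<in>unitary_group N. moments_close \<tau> (Xs @ vs) N m \<delta> (conj_list W As @ Vs)} \<ge> 1 / 2"
    for m' \<delta>' N As Vs
  have "\<exists>m' \<delta>' N0. \<delta>' > 0 \<and> (\<forall>N As Vs. N \<ge> N0 \<longrightarrow> \<not> Q m' \<delta>' N As Vs)"
  proof (rule ccontr)
    assume neg: "\<not> ?thesis"
    have "\<exists>N As Vs. N \<ge> Suc k \<and> Q k (1 / real (Suc k)) N As Vs" for k
    proof -
      have "1 / real (Suc k) > 0" by simp
      with neg show ?thesis by blast
    qed
    then obtain d As Vs where d: "\<And>k. d k \<ge> Suc k" and Q: "\<And>k. Q k (1 / real (Suc k)) (d k) (As k) (Vs k)"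
      by metis
    have mc: "moments_close \<tau> Xs (d k) k (1 / real (Suc k)) (As k)" "moments_close \<tau> vs (d k) k (1 / real (Suc k)) (Vs k)" for k
      using Q[of k] by (simp_all add: Q_def Gamma_R_def)
    interpret free_models M \<tau> Xs vs d As Vs R
    proof
      show "d k > 0" for k using d[of k] by simp
      show "filterlim d at_top sequentially"
        by (rule filterlim_at_top_mono[OF filterlim_Suc]) (use d in simp)
      show "length (As k) = length Xs" "set (As k) \<subseteq> sa_mats_bounded (d k) R"
        "length (Vs k) = length vs" "set (Vs k) \<subseteq> unitary_group (d k)" for k
        using Q[of k] by (simp_all add: Q_def Gamma_R_def)
      show "(\<lambda>k. ntrace (d k) (mat_eval (d k) (As k) w)) \<longlonglongrightarrow> \<tau> (op_eval Xs w)"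
        if "\<forall>(j, b)\<in>set w. j < length Xs" for w
        by (rule LIMSEQ_of_moments_close[OF mc(1) that])
      show "(\<lambda>k. ntrace (d k) (mat_eval (d k) (Vs k) w)) \<longlonglongrightarrow> \<tau> (op_eval vs w)"
        if "\<forall>(j, b)\<in>set w. j < length vs" for w
        by (rule LIMSEQ_of_moments_close[OF mc(2) that])
    qed (use assms in auto)
    show False using eventually_moments_close[OF \<delta>, of m] Q unfolding Q_def by blast
  qed
  then obtain m' \<delta>' N0 where pos: "\<delta>' > 0" and nQ: "\<And>N As Vs. N \<ge> N0 \<Longrightarrow> \<not> Q m' \<delta>' N As Vs"
    by blast
  show ?thesis
    by (intro exI[of _ m'] exI[of _ \<delta>'] exI[of _ N0] conjI pos allI impI) (use nQ in \<open>auto simp: Q_def\<close>)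
qed

section \<open>Measurability of microstate spaces\<close>

text \<open>\<open>entropy_limit\<close> is a \<open>Lim\<close>, whose value is known only once
  convergence has been proved. Monotonicity in m and \<delta> makes the values decrease to their
  infimum.\<close>

lemma entropy_limit_eq_INF:
  assumes anti: "\<And>N m m' \<delta> \<delta>'. m \<le> m' \<Longrightarrow> 0 < \<delta>' \<Longrightarrow> \<delta>' \<le> \<delta> \<Longrightarrow> F N m' \<delta>' \<le> F N m \<delta>"
  shows "entropy_limit F = (INF p\<in>UNIV \<times> {0<..}. limsup (\<lambda>N. F N (fst p) (snd p) / ereal (real (N ^ 2))))"
proof -
  define g where "g m \<delta> = limsup (\<lambda>N. F N m \<delta> / ereal (real (N ^ 2)))" for m \<delta>
  define L where "L = (INF p\<in>UNIV \<times> {0<..}. g (fst p) (snd p))"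
  have mono: "g m' \<delta>' \<le> g m \<delta>" if "m \<le> m'" "0 < \<delta>'" "\<delta>' \<le> \<delta>" for m m' \<delta> \<delta>'
    unfolding g_def
  proof (rule Limsup_mono)
    \<comment> \<open>N = 0 is left out, as there the division would be by 0.\<close>
    show "\<forall>\<^sub>F N in sequentially. F N m' \<delta>' / ereal (real (N ^ 2)) \<le> F N m \<delta> / ereal (real (N ^ 2))"
      using eventually_gt_at_top[of 0]
      by eventually_elim (use anti[OF that] in \<open>auto intro!: ereal_divide_right_mono\<close>)
  qed
  have lower: "L \<le> g m \<delta>" if "\<delta> > 0" for m \<delta>
    unfolding L_def using that by (intro INF_lower2[of "(m, \<delta>)"]) auto
  have pos: "\<forall>\<^sub>F p in sequentially \<times>\<^sub>F at_right (0::real). snd p > 0"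
    by (rule eventually_prodI[of "\<lambda>_. True" _ "\<lambda>\<delta>. \<delta> > 0", THEN eventually_mono])
      (auto simp: eventually_at_right_less)
  have "((\<lambda>(m, \<delta>). g m \<delta>) \<longlongrightarrow> L) (sequentially \<times>\<^sub>F at_right 0)"
  proof (rule order_tendstoI)
    fix a assume "a < L"
    show "\<forall>\<^sub>F p in sequentially \<times>\<^sub>F at_right 0. a < (case p of (m, \<delta>) \<Rightarrow> g m \<delta>)"
      using pos by eventually_elim (use \<open>a < L\<close> lower in \<open>auto intro: less_le_trans\<close>)
  next
    fix a assume "L < a"
    then obtain m \<delta> where md: "\<delta> > 0" "g m \<delta> < a" unfolding L_def INF_less_iff by auto
    have "\<forall>\<^sub>F p in sequentially \<times>\<^sub>F at_right (0::real). fst p \<ge> m \<and> (snd p > 0 \<and> snd p < \<delta>)"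
      by (rule eventually_prodI) (use md in \<open>auto simp: eventually_ge_at_top eventually_at_right_less
          eventually_at_right_field intro!: eventually_conj\<close>)
    then show "\<forall>\<^sub>F p in sequentially \<times>\<^sub>F at_right 0. (case p of (m, \<delta>) \<Rightarrow> g m \<delta>) < a"
    proof eventually_elim
      case (elim p)
      then have "g (fst p) (snd p) \<le> g m \<delta>" by (intro mono) auto
      then show ?case using md(2) by (simp add: case_prod_beta)
    qed
  qed
  then have "entropy_limit F = L"
    unfolding entropy_limit_def g_def by (intro tendsto_Lim) (auto simp: prod_filter_eq_bot)
  then show ?thesis by (simp add: L_def g_def)
qed

text \<open>The accuracy on the side of \<open>F\<close> may differ from the one on the side of
  \<open>G\<close>: asymptotic freeness trades (m, \<delta>) for another pair.\<close>

lemma entropy_limit_mono: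
  assumes F: "\<And>N m m' \<delta> \<delta>'. m \<le> m' \<Longrightarrow> 0 < \<delta>' \<Longrightarrow> \<delta>' \<le> \<delta> \<Longrightarrow> F N m' \<delta>' \<le> F N m \<delta>"
    and G: "\<And>N m m' \<delta> \<delta>'. m \<le> m' \<Longrightarrow> 0 < \<delta>' \<Longrightarrow> \<delta>' \<le> \<delta> \<Longrightarrow> G N m' \<delta>' \<le> G N m \<delta>"
    and le: "\<And>m \<delta>. \<delta> > 0 \<Longrightarrow> \<exists>m' \<delta>'. \<delta>' > 0 \<and>
      limsup (\<lambda>N. F N m' \<delta>' / ereal (real (N ^ 2))) \<le> limsup (\<lambda>N. G N m \<delta> / ereal (real (N ^ 2)))"
  shows "entropy_limit F \<le> entropy_limit G"
proof -
  have eqF: "entropy_limit F = (INF p\<in>UNIV \<times> {0<..}. limsup (\<lambda>N. F N (fst p) (snd p) / ereal (real (N ^ 2))))"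
    and eqG: "entropy_limit G = (INF p\<in>UNIV \<times> {0<..}. limsup (\<lambda>N. G N (fst p) (snd p) / ereal (real (N ^ 2))))"
    by (rule entropy_limit_eq_INF, rule F, assumption+) (rule entropy_limit_eq_INF, rule G, assumption+)
  show ?thesis
    unfolding eqF eqG
  proof (rule INF_greatest)
    fix p :: "nat \<times> real" assume "p \<in> UNIV \<times> {0<..}"
    then obtain m' \<delta>' where "\<delta>' > 0" "limsup (\<lambda>N. F N m' \<delta>' / ereal (real (N ^ 2)))
        \<le> limsup (\<lambda>N. G N (fst p) (snd p) / ereal (real (N ^ 2)))"
      using le[of "snd p" "fst p"] by auto
    then show "(INF p\<in>UNIV \<times> {0<..}. limsup (\<lambda>N. F N (fst p) (snd p) / ereal (real (N ^ 2))))
        \<le> limsup (\<lambda>N. G N (fst p) (snd p) / ereal (real (N ^ 2)))"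
      by (intro INF_lower2[of "(m', \<delta>')"]) auto
  qed
qed

lemma log_ext_mono: "0 \<le> p \<Longrightarrow> p \<le> q \<Longrightarrow> log_ext p \<le> log_ext q"
  by (auto simp: log_ext_def)

lemma moments_close_antimono:
  "moments_close \<tau> Ys N m' \<delta>' As \<Longrightarrow> m \<le> m' \<Longrightarrow> \<delta>' \<le> \<delta> \<Longrightarrow> moments_close \<tau> Ys N m \<delta> As"
proof -
  assume mc: "moments_close \<tau> Ys N m' \<delta>' As" and le: "m \<le> m'" "\<delta>' \<le> \<delta>"
  show ?thesis
    unfolding moments_close_def
  proof
    fix w assume "w \<in> star_words (length Ys) m"
    then have "cmod (ntrace N (mat_eval N As w) - \<tau> (op_eval Ys w)) < \<delta>'"
      using le by (intro moments_closeD[OF mc]) (auto simp: star_words_def)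
    then show "cmod (ntrace N (mat_eval N As w) - \<tau> (op_eval Ys w)) < \<delta>" using le by linarith
  qed
qed

section \<open>Measurable sets of unitary tuples\<close>

lemma prob_space_haar_power: "prob_space (haar_power N k)"
  unfolding haar_power_def by (intro prob_space_PiM prob_space_haar_unitary)

lemma space_haar_power [simp]: "space (haar_power N k) = unitary_power N k"
  by (simp add: haar_power_def space_PiM unitary_power_def)

lemma mat_measurable_component:
  "i < k \<Longrightarrow> mat_measurable (haar_power N k) N (\<lambda>U. U i)"
proof (rule mat_measurable_unitary)
  assume "i < k"
  then have "(\<lambda>U. U i) \<in> measurable (haar_power N k) (haar_unitary N)"
    unfolding haar_power_def by (intro measurable_component_singleton) simp
  then show "(\<lambda>U. U i) \<in> measurable (haar_power N k) (borel_unitary N)"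
    by (simp cong: measurable_cong_sets)
qed

text \<open>Tuples of matrix-valued maps as lists of constant length, the form in which
  \<open>orbit_tuple\<close> and \<open>mat_eval\<close> handle them.\<close>

definition list_measurable :: "'a measure \<Rightarrow> nat \<Rightarrow> nat \<Rightarrow> ('a \<Rightarrow> complex mat list) \<Rightarrow> bool" where
  "list_measurable M N n F \<longleftrightarrow> (\<forall>x. length (F x) = n) \<and> (\<forall>j<n. mat_measurable M N (\<lambda>x. F x ! j))"

lemma list_measurable_append:
  assumes "list_measurable M N n F" "list_measurable M N n' G"
  shows "list_measurable M N (n + n') (\<lambda>x. F x @ G x)"
proof -
  have "mat_measurable M N (\<lambda>x. (F x @ G x) ! j)" if "j < n + n'" for j
  proof (cases "j < n")
    case True
    then show ?thesis using assms(1) by (simp add: list_measurable_def nth_append)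
  next
    case False
    then have "j - n < n'" using that by simp
    then show ?thesis using assms False by (simp add: list_measurable_def nth_append)
  qed
  then show ?thesis using assms by (simp add: list_measurable_def)
qed

lemma list_measurable_concat:
  assumes "\<And>i. i < K \<Longrightarrow> list_measurable M N (n i) (F i)"
  shows "list_measurable M N (\<Sum>i<K. n i) (\<lambda>x. concat (map (\<lambda>i. F i x) [0..<K]))"
  using assms
proof (induction K)
  case (Suc K)
  then show ?case using list_measurable_append[of M N "\<Sum>i<K. n i" _ "n K" "F K"] by simp
qed (simp add: list_measurable_def)

lemma measurable_ntrace_mat_eval:
  assumes "list_measurable M N n F" "\<forall>(j, b)\<in>set w. j < n"
  shows "(\<lambda>x. ntrace N (mat_eval N (F x) w)) \<in> borel_measurable M"
proof (rule mat_measurable_ntrace)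
  show "mat_measurable M N (\<lambda>x. mat_eval N (F x) w)"
    using assms(2)
  proof (induction w)
    case (Cons l w)
    obtain j b where l: "l = (j, b)" by force
    have "mat_measurable M N (\<lambda>x. F x ! j)" using assms(1) Cons.prems by (simp add: l list_measurable_def)
    then have "mat_measurable M N (\<lambda>x. if b then mat_adjoint (F x ! j) else F x ! j)"
      using mat_measurable_adjoint by (cases b) auto
    from mat_measurable_mult[OF this Cons.IH] show ?case using Cons.prems by (simp add: l)
  qed (simp add: mat_measurable_const)
qed

lemma sets_moments_close:
  assumes "list_measurable M N (length Ys) F"
  shows "{x\<in>space M. moments_close \<tau> Ys N m \<delta> (F x)} \<in> sets M"
  unfolding moments_close_def
proof (rule sets.sets_Collect_finite_All[OF _ finite_star_words])
  fix w assume "w \<in> star_words (length Ys) m"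
  then have "\<forall>(j, b)\<in>set w. j < length Ys" by (auto simp: star_words_def)
  note [measurable] = measurable_ntrace_mat_eval[OF assms this]
  show "{x\<in>space M. cmod (ntrace N (mat_eval N (F x) w) - \<tau> (op_eval Ys w)) < \<delta>} \<in> sets M"
    by measurable
qed

lemma mat_tuplesD:
  assumes "As \<in> mat_tuples Ys S"
  shows "length As = length Ys" "i < length Ys \<Longrightarrow> length (As ! i) = length (Ys ! i)"
    "i < length Ys \<Longrightarrow> set (As ! i) \<subseteq> S"
proof -
  have m: "map length As = map length Ys" and S: "\<forall>A\<in>set As. set A \<subseteq> S"
    using assms by (auto simp: mat_tuples_def)
  show l: "length As = length Ys" using m by (metis length_map)
  show "length (As ! i) = length (Ys ! i)" if "i < length Ys" for i
    using m l that by (metis nth_map)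
  show "set (As ! i) \<subseteq> S" if "i < length Ys" for i using S l that nth_mem by metis
qed

lemma length_concat_sum: "length (concat Ys) = (\<Sum>i<length Ys. length (Ys ! i))"
  by (induction Ys rule: rev_induct) (simp_all add: nth_append)

lemma list_measurable_orbit:
  assumes As: "As \<in> mat_tuples Ys (sa_mats_bounded N R)"
  shows "list_measurable (haar_power N (length Ys)) N (length (concat Ys)) (\<lambda>U. orbit_tuple U As)"
proof -
  note D = mat_tuplesD[OF As]
  have "list_measurable (haar_power N (length Ys)) N (length (Ys ! i)) (\<lambda>U. map (\<lambda>A. U i * A * mat_adjoint (U i)) (As ! i))"
    if i: "i < length Ys" for i
    unfolding list_measurable_def
  proof (intro conjI allI impI)
    show "length (map (\<lambda>A. U i * A * mat_adjoint (U i)) (As ! i)) = length (Ys ! i)" for U :: "nat \<Rightarrow> complex mat"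
      using D(2)[OF i] by simp
    fix j assume j: "j < length (Ys ! i)"
    then have "As ! i ! j \<in> sa_mats_bounded N R" using D(2,3)[OF i] by auto
    then have "As ! i ! j \<in> carrier_mat N N" by (simp add: sa_mats_bounded_def sa_mats_def)
    then have "mat_measurable (haar_power N (length Ys)) N (\<lambda>U. U i * (As ! i ! j) * mat_adjoint (U i))"
      by (intro mat_measurable_mult mat_measurable_adjoint mat_measurable_const mat_measurable_component i)
    then show "mat_measurable (haar_power N (length Ys)) N (\<lambda>U. map (\<lambda>A. U i * A * mat_adjoint (U i)) (As ! i) ! j)"
      using j D(2)[OF i] by simp
  qed
  from list_measurable_concat[where K = "length Ys", OF this] show ?thesis
    unfolding orbit_tuple_def length_concat_sum D(1) .
qed

lemma sets_Gamma_orb: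
  assumes "As \<in> mat_tuples Ys (sa_mats_bounded N R)"
  shows "Gamma_orb \<tau> Ys As N m \<delta> \<in> sets (haar_power N (length Ys))"
  using sets_moments_close[OF list_measurable_orbit[OF assms], of \<tau> m \<delta>] by (simp add: Gamma_orb_def)

lemma sets_Gamma_u: "Gamma_u \<tau> vs N m \<delta> \<in> sets (haar_power N (length vs))"
proof -
  have "list_measurable (haar_power N (length vs)) N (length vs) (\<lambda>V. map V [0..<length vs])"
    by (auto simp: list_measurable_def mat_measurable_component)
  from sets_moments_close[OF this, of \<tau> m \<delta>] show ?thesis by (simp add: Gamma_u_def)
qed

text \<open>Tuples of matrices are coded by functions on a countable index set. The product topology
  on these is second countable, so every set of codes has a countable dense subset. Coordinates out
  of range are ignored when decoding.\<close>

definition decode :: "nat \<Rightarrow> nat \<Rightarrow> (nat \<times> nat \<times> nat \<Rightarrow> complex) \<Rightarrow> complex mat list" where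
  "decode N s f = map (\<lambda>j. mat N N (\<lambda>(a, b). f (j, a, b))) [0..<s]"

definition encode :: "complex mat list \<Rightarrow> nat \<times> nat \<times> nat \<Rightarrow> complex" where
  "encode Vs = (\<lambda>(j, a, b). Vs ! j $$ (a, b))"

lemma decode_encode:
  assumes "length Vs = s" "set Vs \<subseteq> carrier_mat N N"
  shows "decode N s (encode Vs) = Vs"
proof (rule nth_equalityI)
  show "length (decode N s (encode Vs)) = length Vs" using assms by (simp add: decode_def)
  fix j assume j: "j < length (decode N s (encode Vs))"
  then have "Vs ! j \<in> carrier_mat N N" using assms by (auto simp: decode_def)
  then show "decode N s (encode Vs) ! j = Vs ! j"
    using j by (intro eq_matI) (auto simp: decode_def encode_def)
qed

text \<open>The entries of a word are polynomials in the coded entries and their conjugates.\<close>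

lemma continuous_mat_eval_decode:
  assumes L: "set L \<subseteq> carrier_mat N N"
  shows "\<forall>(j, b)\<in>set w. j < length L + s \<Longrightarrow> a < N \<Longrightarrow> b < N \<Longrightarrow>
    continuous_on UNIV (\<lambda>f. mat_eval N (L @ decode N s f) w $$ (a, b))"
proof (induction w arbitrary: a)
  case (Cons l w)
  obtain j c where l: "l = (j, c)" by force
  let ?L = "\<lambda>f. L @ decode N s f"
  let ?M = "\<lambda>f. if c then mat_adjoint (?L f ! j) else ?L f ! j"
  have car: "set (?L f) \<subseteq> carrier_mat N N" for f using L by (auto simp: decode_def)
  have j: "j < length (?L f)" for f using Cons.prems by (simp add: l decode_def)
  have M: "?L f ! j \<in> carrier_mat N N" for f using car j[of f] nth_mem by blast
  then have M': "?M f \<in> carrier_mat N N" for f by simp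
  have E: "mat_eval N (?L f) w \<in> carrier_mat N N" for f
    by (rule mat_eval_carrier[OF car]) (use Cons.prems in \<open>auto simp: decode_def\<close>)
  have ent: "continuous_on UNIV (\<lambda>f. ?L f ! j $$ (a, k))" if "a < N" "k < N" for a k
    using that j[of "\<lambda>_. 0"]
    by (cases "j < length L") (auto simp: nth_append decode_def intro!: continuous_on_product_coordinates continuous_intros)
  have "continuous_on UNIV (\<lambda>f. ?M f $$ (a, k))" if "k < N" for k
  proof (cases c)
    case True
    have "?M f $$ (a, k) = cnj (?L f ! j $$ (k, a))" for f
      using True M[of f] that Cons.prems by auto
    then show ?thesis using ent[OF that Cons.prems(2)] by (simp add: continuous_on_cnj)
  qed (use ent[OF Cons.prems(2) that] in simp)
  moreover have "continuous_on UNIV (\<lambda>f. mat_eval N (?L f) w $$ (k, b))" if "k < N" for k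
    using Cons.prems that by (intro Cons.IH) auto
  ultimately have "continuous_on UNIV (\<lambda>f. \<Sum>k<N. ?M f $$ (a, k) * mat_eval N (?L f) w $$ (k, b))"
    by (intro continuous_on_sum continuous_on_mult) auto
  then show ?case
    unfolding l mat_eval_simps index_mat_mult_sum[OF M' E Cons.prems(2,3)] .
qed (simp add: continuous_on_const)

text \<open>By continuity and separability it suffices to let \<open>V\<close> range over a countable set.\<close>

lemma sets_Gamma_orb_pres:
  assumes As: "As \<in> mat_tuples Ys (sa_mats_bounded N R)"
  shows "Gamma_orb_pres \<tau> Ys As vs N m \<delta> \<in> sets (haar_power N (length Ys))"
proof -
  let ?H = "haar_power N (length Ys)" and ?s = "length vs"
  define \<V> where "\<V> = {Vs. length Vs = ?s \<and> set Vs \<subseteq> unitary_group N}"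
  have carV: "set Vs \<subseteq> carrier_mat N N" if "Vs \<in> \<V>" for Vs
    using that unitary_group_carrier by (auto simp: \<V>_def)
  have dec: "decode N ?s (encode Vs) = Vs" if "Vs \<in> \<V>" for Vs
    using decode_encode[OF _ carV[OF that]] that by (simp add: \<V>_def)
  \<comment> \<open>\<open>D\<close> is chosen inside the codes of unitary tuples, so each of its
    elements decodes to an admissible witness.\<close>
  obtain D where D: "countable D" "D \<subseteq> encode ` \<V>" "encode ` \<V> \<subseteq> closure D" by (rule separable)
  define S where "S f = {U\<in>unitary_power N (length Ys). moments_close \<tau> (concat Ys @ vs) N m \<delta> (orbit_tuple U As @ decode N ?s f)}" for f
  have S: "S f \<in> sets ?H" if "f \<in> D" for f
  proof -
    have "list_measurable ?H N ?s (\<lambda>U. decode N ?s f)"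
      by (auto simp: list_measurable_def decode_def intro!: mat_measurable_const)
    from sets_moments_close[OF list_measurable_append[OF list_measurable_orbit[OF As] this, folded length_append], of \<tau> m \<delta>]
    show ?thesis by (simp add: S_def)
  qed
  have "Gamma_orb_pres \<tau> Ys As vs N m \<delta> = (\<Union>f\<in>D. S f)"
  proof (intro equalityI subsetI)
    fix U assume "U \<in> Gamma_orb_pres \<tau> Ys As vs N m \<delta>"
    then obtain Vs where U: "U \<in> unitary_power N (length Ys)" and Vs: "Vs \<in> \<V>"
      and mc: "moments_close \<tau> (concat Ys @ vs) N m \<delta> (orbit_tuple U As @ Vs)"
      by (auto simp: Gamma_orb_pres_def \<V>_def)
    define L where "L = orbit_tuple U As"
    have lm: "list_measurable ?H N (length (concat Ys)) (\<lambda>U. orbit_tuple U As)" by (rule list_measurable_orbit[OF As])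
    have lenL: "length L = length (concat Ys)" using lm by (simp add: L_def list_measurable_def)
    have carL: "set L \<subseteq> carrier_mat N N"
    proof
      fix A assume "A \<in> set L"
      then obtain j where "j < length L" "A = L ! j" by (auto simp: in_set_conv_nth)
      then show "A \<in> carrier_mat N N" using lm U lenL by (auto simp: L_def list_measurable_def mat_measurable_def)
    qed
    \<comment> \<open>For fixed U the codes meeting the moment conditions form an open set, as these
      are finitely many strict inequalities. An open set that meets the closure of \<open>D\<close>
      meets \<open>D\<close>.\<close>
    define Op where "Op = {f. moments_close \<tau> (concat Ys @ vs) N m \<delta> (L @ decode N ?s f)}"
    have "open Op"
    proof -
      have "open {f. cmod (ntrace N (mat_eval N (L @ decode N ?s f) w) - \<tau> (op_eval (concat Ys @ vs) w)) < \<delta>}"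
        if "w \<in> star_words (length (concat Ys @ vs)) m" for w
      proof (rule open_Collect_less)
        have "continuous_on UNIV (\<lambda>f. ntrace N (mat_eval N (L @ decode N ?s f) w))"
          unfolding ntrace_def divide_inverse using that
          by (intro continuous_on_mult continuous_on_const continuous_on_sum continuous_mat_eval_decode[OF carL])
            (auto simp: star_words_def lenL)
        then show "continuous_on UNIV (\<lambda>f. cmod (ntrace N (mat_eval N (L @ decode N ?s f) w) - \<tau> (op_eval (concat Ys @ vs) w)))"
          by (intro continuous_intros)
      qed (rule continuous_on_const)
      then have "open (\<Inter>w\<in>star_words (length (concat Ys @ vs)) m.
          {f. cmod (ntrace N (mat_eval N (L @ decode N ?s f) w) - \<tau> (op_eval (concat Ys @ vs) w)) < \<delta>})"
        by (intro open_INT finite_star_words) auto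
      also have "(\<Inter>w\<in>star_words (length (concat Ys @ vs)) m.
          {f. cmod (ntrace N (mat_eval N (L @ decode N ?s f) w) - \<tau> (op_eval (concat Ys @ vs) w)) < \<delta>}) = Op"
        by (auto simp: Op_def moments_close_def)
      finally show ?thesis .
    qed
    moreover have "encode Vs \<in> Op" using mc by (simp add: Op_def dec[OF Vs] L_def)
    moreover have "encode Vs \<in> closure D" using D(3) Vs by auto
    ultimately have "Op \<inter> D \<noteq> {}" using open_Int_closure_eq_empty[of Op D] by auto
    then show "U \<in> (\<Union>f\<in>D. S f)" using U by (auto simp: S_def Op_def L_def)
  next
    fix U assume "U \<in> (\<Union>f\<in>D. S f)"
    then obtain f where "f \<in> D" "U \<in> S f" by auto
    moreover then obtain Vs where "Vs \<in> \<V>" "f = encode Vs" using D(2) by auto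
    ultimately show "U \<in> Gamma_orb_pres \<tau> Ys As vs N m \<delta>"
      using dec by (auto simp: S_def Gamma_orb_pres_def \<V>_def)
  qed
  then show ?thesis using sets.countable_UN''[OF D(1), of S ?H] S by simp
qed

section \<open>Comparison of the entropies\<close>

lemma moments_close_reindex:
  assumes f: "\<And>j. j < length Ys \<Longrightarrow> f j < length Zs \<and> Zs ! f j = Ys ! j \<and> Cs ! f j = As ! j"
    and mc: "moments_close \<tau> Zs N m \<delta> Cs"
  shows "moments_close \<tau> Ys N m \<delta> As"
  unfolding moments_close_def
proof
  fix w assume "w \<in> star_words (length Ys) m"
  then have len: "length w \<le> m" and w: "\<forall>(j, b)\<in>set w. j < length Ys" by (auto simp: star_words_def)
  define w' where "w' = map (\<lambda>(j, b). (f j, b)) w"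
  have "op_eval Zs w' = op_eval Ys w \<and> mat_eval N Cs w' = mat_eval N As w"
    using w unfolding w'_def by (induction w) (auto simp: f)
  moreover have "\<forall>(j, b)\<in>set w'. j < length Zs" using w f by (auto simp: w'_def)
  ultimately show "cmod (ntrace N (mat_eval N As w) - \<tau> (op_eval Ys w)) < \<delta>"
    using moments_closeD[OF mc, of w'] len by (simp add: w'_def)
qed

text \<open>Comparing the sets of pairs of an operator and its model avoids index computations in
  concatenated tuples.\<close>

lemma moments_close_zip:
  assumes len: "length Zs = length Cs" "length Ys = length As"
    and sub: "set (zip Ys As) \<subseteq> set (zip Zs Cs)"
    and mc: "moments_close \<tau> Zs N m \<delta> Cs"
  shows "moments_close \<tau> Ys N m \<delta> As"
proof -
  have "\<exists>i. i < length Zs \<and> Zs ! i = Ys ! j \<and> Cs ! i = As ! j" if j: "j < length Ys" for j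
  proof -
    have "(Ys ! j, As ! j) \<in> set (zip Ys As)" using j len by (auto simp: set_zip)
    then have "(Ys ! j, As ! j) \<in> set (zip Zs Cs)" using sub by blast
    then show ?thesis using len by (auto simp: set_zip)
  qed
  then obtain f where "\<And>j. j < length Ys \<Longrightarrow> f j < length Zs \<and> Zs ! f j = Ys ! j \<and> Cs ! f j = As ! j" by metis
  then show ?thesis using mc by (rule moments_close_reindex)
qed

text \<open>Each letter is replaced by a word of length at most q in other letters, so a word of
  degree m becomes one of degree at most q m.\<close>

lemma moments_close_subst:
  assumes Cs: "set Cs \<subseteq> carrier_mat N N" "length Cs = length Zs"
    and sub: "\<And>j b. j < length Ys \<Longrightarrow> \<exists>u. length u \<le> q \<and> (\<forall>(i, c)\<in>set u. i < length Zs) \<and>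
      op_eval Zs u = (if b then op_adj (Ys ! j) else Ys ! j) \<and>
      mat_eval N Cs u = (if b then mat_adjoint (As ! j) else As ! j)"
    and mc: "moments_close \<tau> Zs N (q * m) \<delta> Cs"
  shows "moments_close \<tau> Ys N m \<delta> As"
  unfolding moments_close_def
proof
  fix w assume "w \<in> star_words (length Ys) m"
  then have len: "length w \<le> m" and w: "\<forall>(j, b)\<in>set w. j < length Ys" by (auto simp: star_words_def)
  have "\<exists>u. length u \<le> q * length w \<and> (\<forall>(i, c)\<in>set u. i < length Zs) \<and> op_eval Zs u = op_eval Ys w \<and> mat_eval N Cs u = mat_eval N As w"
    using w
  proof (induction w)
    case Nil
    show ?case by (rule exI[of _ "[]"]) simp
  next
    case (Cons l w)
    obtain j b where l: "l = (j, b)" by force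
    obtain u where u: "length u \<le> q * length w" "\<forall>(i, c)\<in>set u. i < length Zs" "op_eval Zs u = op_eval Ys w" "mat_eval N Cs u = mat_eval N As w"
      using Cons by auto
    have "j < length Ys" using Cons.prems by (simp add: l)
    from sub[OF this, of b] obtain u' where u': "length u' \<le> q" "\<forall>(i, c)\<in>set u'. i < length Zs"
      "op_eval Zs u' = (if b then op_adj (Ys ! j) else Ys ! j)" "mat_eval N Cs u' = (if b then mat_adjoint (As ! j) else As ! j)" by blast
    have all: "\<forall>(i, c)\<in>set (u' @ u). i < length Zs" using u(2) u'(2) by auto
    then have "mat_eval N Cs (u' @ u) = mat_eval N Cs u' * mat_eval N Cs u"
      by (intro mat_eval_append[OF Cs(1)]) (simp add: Cs(2))
    then show ?case
      by (intro exI[of _ "u' @ u"]) (use u u' all in \<open>auto simp: l op_eval_append\<close>)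
  qed
  then obtain u where u: "length u \<le> q * length w" "\<forall>(i, c)\<in>set u. i < length Zs" "op_eval Zs u = op_eval Ys w" "mat_eval N Cs u = mat_eval N As w"
    by blast
  have "length u \<le> q * m" by (rule order_trans[OF u(1)]) (use len in simp)
  then show "cmod (ntrace N (mat_eval N As w) - \<tau> (op_eval Ys w)) < \<delta>"
    using moments_closeD[OF mc _ u(2)] unfolding u(3,4) by blast
qed

lemma zip_concat:
  assumes "list_all2 (\<lambda>x y. length x = length y) Ys Bs"
  shows "zip (concat Ys) (concat Bs) = concat (map (\<lambda>(x, y). zip x y) (zip Ys Bs))"
  using assms by (induction rule: list_all2_induct) simp_all

lemma set_zip_concat:
  assumes "length Ys = length Bs" "\<And>i. i < length Ys \<Longrightarrow> length (Ys ! i) = length (Bs ! i)"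
  shows "set (zip (concat Ys) (concat Bs)) = {(Ys ! i ! l, Bs ! i ! l) | i l. i < length Ys \<and> l < length (Ys ! i)}"
proof -
  have all2: "list_all2 (\<lambda>x y. length x = length y) Ys Bs" using assms by (simp add: list_all2_conv_all_nth)
  have 1: "set (zip Ys Bs) = (\<lambda>i. (Ys ! i, Bs ! i)) ` {..<length Ys}"
    using assms(1) by (auto simp: set_zip)
  have 2: "set (zip (Ys ! i) (Bs ! i)) = (\<lambda>l. (Ys ! i ! l, Bs ! i ! l)) ` {..<length (Ys ! i)}" if "i < length Ys" for i
    using assms(2)[OF that] by (auto simp: set_zip)
  have "set (zip (concat Ys) (concat Bs)) = (\<Union>i\<in>{..<length Ys}. set (zip (Ys ! i) (Bs ! i)))"
    unfolding zip_concat[OF all2] by (simp add: 1)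
  also have "\<dots> = (\<Union>i\<in>{..<length Ys}. (\<lambda>l. (Ys ! i ! l, Bs ! i ! l)) ` {..<length (Ys ! i)})"
    using 2 by simp
  also have "\<dots> = {(Ys ! i ! l, Bs ! i ! l) | i l. i < length Ys \<and> l < length (Ys ! i)}"
    by blast
  finally show ?thesis .
qed

lemma length_concat_eq:
  assumes "length Ys = length Bs" "\<And>i. i < length Ys \<Longrightarrow> length (Ys ! i) = length (Bs ! i)"
  shows "length (concat Ys) = length (concat Bs)"
  unfolding length_concat_sum using assms by auto

definition orbit_blocks :: "(nat \<Rightarrow> complex mat) \<Rightarrow> complex mat list list \<Rightarrow> complex mat list list" where
  "orbit_blocks U As = map (\<lambda>i. map (\<lambda>A. U i * A * mat_adjoint (U i)) (As ! i)) [0..<length As]"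

lemma orbit_tuple_blocks: "orbit_tuple U As = concat (orbit_blocks U As)"
  by (simp add: orbit_tuple_def orbit_blocks_def)

lemma orbit_blocks_simps:
  "length (orbit_blocks U As) = length As"
  "i < length As \<Longrightarrow> length (orbit_blocks U As ! i) = length (As ! i)"
  "i < length As \<Longrightarrow> l < length (As ! i) \<Longrightarrow> orbit_blocks U As ! i ! l = U i * (As ! i ! l) * mat_adjoint (U i)"
  by (simp_all add: orbit_blocks_def)

lemma set_zip_orbit:
  assumes As: "As \<in> mat_tuples Ys S"
  shows "set (zip (concat Ys) (orbit_tuple U As))
      = {(Ys ! i ! l, U i * (As ! i ! l) * mat_adjoint (U i)) | i l. i < length Ys \<and> l < length (Ys ! i)}"
    "length (orbit_tuple U As) = length (concat Ys)"
proof -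
  note D = mat_tuplesD[OF As]
  have len: "length Ys = length (orbit_blocks U As)" "\<And>i. i < length Ys \<Longrightarrow> length (Ys ! i) = length (orbit_blocks U As ! i)"
    using D by (simp_all add: orbit_blocks_simps)
  show "length (orbit_tuple U As) = length (concat Ys)"
    unfolding orbit_tuple_blocks using length_concat_eq[OF len] by simp
  have "set (zip (concat Ys) (orbit_tuple U As)) = {(Ys ! i ! l, orbit_blocks U As ! i ! l) | i l. i < length Ys \<and> l < length (Ys ! i)}"
    unfolding orbit_tuple_blocks by (rule set_zip_concat[OF len])
  also have "\<dots> = {(Ys ! i ! l, U i * (As ! i ! l) * mat_adjoint (U i)) | i l. i < length Ys \<and> l < length (Ys ! i)}"
    using D by (intro Collect_cong) (metis orbit_blocks_simps(3))
  finally show "set (zip (concat Ys) (orbit_tuple U As))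
      = {(Ys ! i ! l, U i * (As ! i ! l) * mat_adjoint (U i)) | i l. i < length Ys \<and> l < length (Ys ! i)}" .
qed

text \<open>Measurability is required of the larger set alone: a non-measurable set has
  \<open>measure\<close> 0.\<close>

lemma log_measure_mono:
  assumes "A \<subseteq> B" "B \<in> sets (haar_power N k)"
  shows "log_ext (measure (haar_power N k) A) \<le> log_ext (measure (haar_power N k) B)"
proof -
  interpret prob_space "haar_power N k" by (rule prob_space_haar_power)
  show ?thesis by (intro log_ext_mono measure_nonneg finite_measure_mono assms)
qed

lemma chibar_orb_R_antimono:
  assumes "m \<le> m'" "\<delta>' \<le> \<delta>"
  shows "chibar_orb_R R \<tau> Ys N m' \<delta>' \<le> chibar_orb_R R \<tau> Ys N m \<delta>"
  unfolding chibar_orb_R_def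
proof (rule SUP_mono)
  fix As assume As: "As \<in> mat_tuples Ys (sa_mats_bounded N R)"
  have "Gamma_orb \<tau> Ys As N m' \<delta>' \<subseteq> Gamma_orb \<tau> Ys As N m \<delta>"
    using assms by (auto simp: Gamma_orb_def intro: moments_close_antimono)
  then show "\<exists>Bs\<in>mat_tuples Ys (sa_mats_bounded N R).
      log_ext (measure (haar_power N (length Ys)) (Gamma_orb \<tau> Ys As N m' \<delta>'))
      \<le> log_ext (measure (haar_power N (length Ys)) (Gamma_orb \<tau> Ys Bs N m \<delta>))"
    by (intro bexI[OF _ As] log_measure_mono sets_Gamma_orb[OF As])
qed

lemma chibar_orb_pres_R_antimono:
  assumes "m \<le> m'" "\<delta>' \<le> \<delta>"
  shows "chibar_orb_pres_R R \<tau> Ys vs N m' \<delta>' \<le> chibar_orb_pres_R R \<tau> Ys vs N m \<delta>"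
  unfolding chibar_orb_pres_R_def
proof (rule SUP_mono)
  fix As assume As: "As \<in> mat_tuples Ys (sa_mats_bounded N R)"
  have "Gamma_orb_pres \<tau> Ys As vs N m' \<delta>' \<subseteq> Gamma_orb_pres \<tau> Ys As vs N m \<delta>"
    using assms by (auto simp: Gamma_orb_pres_def dest: moments_close_antimono)
  then show "\<exists>Bs\<in>mat_tuples Ys (sa_mats_bounded N R).
      log_ext (measure (haar_power N (length Ys)) (Gamma_orb_pres \<tau> Ys As vs N m' \<delta>'))
      \<le> log_ext (measure (haar_power N (length Ys)) (Gamma_orb_pres \<tau> Ys Bs vs N m \<delta>))"
    by (intro bexI[OF _ As] log_measure_mono sets_Gamma_orb_pres[OF As])
qed

lemma Gamma_u_antimono:
  assumes "m \<le> m'" "\<delta>' \<le> \<delta>"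
  shows "log_ext (measure (haar_power N (length vs)) (Gamma_u \<tau> vs N m' \<delta>'))
    \<le> log_ext (measure (haar_power N (length vs)) (Gamma_u \<tau> vs N m \<delta>))"
proof (rule log_measure_mono[OF _ sets_Gamma_u])
  show "Gamma_u \<tau> vs N m' \<delta>' \<subseteq> Gamma_u \<tau> vs N m \<delta>"
    using assms by (auto simp: Gamma_u_def intro: moments_close_antimono)
qed

lemma entropy_limit_mono_pointwise:
  assumes "\<And>N m m' \<delta> \<delta>'. m \<le> m' \<Longrightarrow> 0 < \<delta>' \<Longrightarrow> \<delta>' \<le> \<delta> \<Longrightarrow> F N m' \<delta>' \<le> F N m \<delta>"
    and "\<And>N m m' \<delta> \<delta>'. m \<le> m' \<Longrightarrow> 0 < \<delta>' \<Longrightarrow> \<delta>' \<le> \<delta> \<Longrightarrow> G N m' \<delta>' \<le> G N m \<delta>"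
    and le: "\<And>N m \<delta>. F N m \<delta> \<le> G N m \<delta>"
  shows "entropy_limit F \<le> entropy_limit G"
proof (rule entropy_limit_mono[OF assms(1,2)])
  fix m and \<delta> :: real assume "\<delta> > 0"
  moreover have "limsup (\<lambda>N. F N m \<delta> / ereal (real (N ^ 2))) \<le> limsup (\<lambda>N. G N m \<delta> / ereal (real (N ^ 2)))"
  proof (rule Limsup_mono)
    show "\<forall>\<^sub>F N in sequentially. F N m \<delta> / ereal (real (N ^ 2)) \<le> G N m \<delta> / ereal (real (N ^ 2))"
      using eventually_gt_at_top[of 0]
      by eventually_elim (use le in \<open>auto intro!: ereal_divide_right_mono\<close>)
  qed
  ultimately show "\<exists>m' \<delta>'. \<delta>' > 0 \<and> limsup (\<lambda>N. F N m' \<delta>' / ereal (real (N ^ 2)))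
      \<le> limsup (\<lambda>N. G N m \<delta> / ereal (real (N ^ 2)))" by blast
qed

lemma chi_orb_pres_le_chi_orb: "chi_orb_pres \<tau> Ys vs \<le> chi_orb \<tau> Ys"
proof -
  have "chibar_orb_pres_R R \<tau> Ys vs N m \<delta> \<le> chibar_orb_R R \<tau> Ys N m \<delta>" for R N m \<delta>
    unfolding chibar_orb_pres_R_def chibar_orb_R_def
  proof (rule SUP_mono)
    fix As assume As: "As \<in> mat_tuples Ys (sa_mats_bounded N R)"
    have "Gamma_orb_pres \<tau> Ys As vs N m \<delta> \<subseteq> Gamma_orb \<tau> Ys As N m \<delta>"
    proof
      fix U assume "U \<in> Gamma_orb_pres \<tau> Ys As vs N m \<delta>"
      then obtain Vs where U: "U \<in> unitary_power N (length Ys)"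
        and mc: "moments_close \<tau> (concat Ys @ vs) N m \<delta> (orbit_tuple U As @ Vs)"
        by (auto simp: Gamma_orb_pres_def)
      have "moments_close \<tau> (concat Ys) N m \<delta> (orbit_tuple U As)"
        by (rule moments_close_reindex[where f = "\<lambda>j. j", OF _ mc])
          (auto simp: nth_append set_zip_orbit(2)[OF As])
      then show "U \<in> Gamma_orb \<tau> Ys As N m \<delta>" using U by (simp add: Gamma_orb_def)
    qed
    then show "\<exists>Bs\<in>mat_tuples Ys (sa_mats_bounded N R).
        log_ext (measure (haar_power N (length Ys)) (Gamma_orb_pres \<tau> Ys As vs N m \<delta>))
        \<le> log_ext (measure (haar_power N (length Ys)) (Gamma_orb \<tau> Ys Bs N m \<delta>))"
      by (intro bexI[OF _ As] log_measure_mono sets_Gamma_orb[OF As])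
  qed
  then show ?thesis
    unfolding chi_orb_pres_def chi_orb_def chi_orb_pres_R_def chi_orb_R_def
    by (intro SUP_mono' entropy_limit_mono_pointwise chibar_orb_pres_R_antimono chibar_orb_R_antimono)
qed

text \<open>The selection \<open>g\<close> picks a model of the smaller tuples out of a model of the
  larger ones. U and V stay the same, so the microstate sets are nested.\<close>

lemma chi_orb_pres_subtuples:
  assumes len: "length Ys = length Zs"
    and g: "\<And>i l. i < length Ys \<Longrightarrow> l < length (Ys ! i) \<Longrightarrow> g i l < length (Zs ! i) \<and> Zs ! i ! g i l = Ys ! i ! l"
  shows "chi_orb_pres \<tau> Zs vs \<le> chi_orb_pres \<tau> Ys vs"
proof -
  have "chibar_orb_pres_R R \<tau> Zs vs N m \<delta> \<le> chibar_orb_pres_R R \<tau> Ys vs N m \<delta>" for R N m \<delta>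
    unfolding chibar_orb_pres_R_def
  proof (rule SUP_mono)
    fix Cs assume Cs: "Cs \<in> mat_tuples Zs (sa_mats_bounded N R)"
    note C = mat_tuplesD[OF Cs]
    define As where "As = map (\<lambda>i. map (\<lambda>l. Cs ! i ! g i l) [0..<length (Ys ! i)]) [0..<length Ys]"
    have A: "length As = length Ys" "\<And>i. i < length Ys \<Longrightarrow> length (As ! i) = length (Ys ! i)"
      "\<And>i l. i < length Ys \<Longrightarrow> l < length (Ys ! i) \<Longrightarrow> As ! i ! l = Cs ! i ! g i l"
      by (simp_all add: As_def)
    have "set (As ! i) \<subseteq> sa_mats_bounded N R" if i: "i < length Ys" for i
    proof
      fix B assume "B \<in> set (As ! i)"
      then obtain l where l: "l < length (Ys ! i)" "B = As ! i ! l" using A(2)[OF i] by (auto simp: in_set_conv_nth)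
      then have "B = Cs ! i ! g i l" using A(3)[OF i] by simp
      moreover have "g i l < length (Cs ! i)" using g[OF i l(1)] C(2)[of i] i len by simp
      ultimately show "B \<in> sa_mats_bounded N R" using C(3)[of i] i len nth_mem by fastforce
    qed
    then have "\<forall>A\<in>set As. set A \<subseteq> sa_mats_bounded N R"
      using A(1) by (metis in_set_conv_nth)
    moreover have "map length As = map length Ys"
      by (rule nth_equalityI) (auto simp: A)
    ultimately have As: "As \<in> mat_tuples Ys (sa_mats_bounded N R)" by (simp add: mat_tuples_def)
    have "Gamma_orb_pres \<tau> Zs Cs vs N m \<delta> \<subseteq> Gamma_orb_pres \<tau> Ys As vs N m \<delta>"
    proof
      fix U assume "U \<in> Gamma_orb_pres \<tau> Zs Cs vs N m \<delta>"
      then obtain Vs where U: "U \<in> unitary_power N (length Ys)"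
        and Vs: "length Vs = length vs" "set Vs \<subseteq> unitary_group N"
        and mc: "moments_close \<tau> (concat Zs @ vs) N m \<delta> (orbit_tuple U Cs @ Vs)"
        by (auto simp: Gamma_orb_pres_def len)
      have "set (zip (concat Ys) (orbit_tuple U As)) \<subseteq> set (zip (concat Zs) (orbit_tuple U Cs))"
      proof
        fix p assume "p \<in> set (zip (concat Ys) (orbit_tuple U As))"
        then obtain i l where il: "i < length Ys" "l < length (Ys ! i)"
          and p: "p = (Ys ! i ! l, U i * (As ! i ! l) * mat_adjoint (U i))"
          unfolding set_zip_orbit(1)[OF As] by blast
        have "p = (Zs ! i ! g i l, U i * (Cs ! i ! g i l) * mat_adjoint (U i))"
          using g[OF il] A(3)[OF il] by (simp add: p)
        moreover have "i < length Zs" "g i l < length (Zs ! i)" using g[OF il] il len by auto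
        ultimately show "p \<in> set (zip (concat Zs) (orbit_tuple U Cs))"
          unfolding set_zip_orbit(1)[OF Cs] by blast
      qed
      then have "moments_close \<tau> (concat Ys @ vs) N m \<delta> (orbit_tuple U As @ Vs)"
        by (intro moments_close_zip[OF _ _ _ mc])
          (auto simp: set_zip_orbit(2)[OF As] set_zip_orbit(2)[OF Cs] Vs(1))
      then show "U \<in> Gamma_orb_pres \<tau> Ys As vs N m \<delta>"
        using U Vs by (auto simp: Gamma_orb_pres_def)
    qed
    then show "\<exists>Bs\<in>mat_tuples Ys (sa_mats_bounded N R).
        log_ext (measure (haar_power N (length Zs)) (Gamma_orb_pres \<tau> Zs Cs vs N m \<delta>))
        \<le> log_ext (measure (haar_power N (length Ys)) (Gamma_orb_pres \<tau> Ys Bs vs N m \<delta>))"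
      unfolding len[symmetric] by (intro bexI[OF _ As] log_measure_mono sets_Gamma_orb_pres[OF As])
  qed
  then show ?thesis
    unfolding chi_orb_pres_def chi_orb_pres_R_def
    by (intro SUP_mono' entropy_limit_mono_pointwise chibar_orb_pres_R_antimono)
qed

section \<open>The change of variables on unitary tuples and the last inequality\<close>

text \<open>The last coordinate, with index n, is W itself; it acts on the tuple that is not
  conjugated by any v.\<close>

definition twist :: "nat \<Rightarrow> (nat \<Rightarrow> complex mat) \<Rightarrow> complex mat \<Rightarrow> nat \<Rightarrow> complex mat" where
  "twist n V W = (\<lambda>i\<in>{..<Suc n}. if i < n then V i * W else W)"

lemma product_sigma_finite_haar: "product_sigma_finite (\<lambda>_::nat. haar_unitary N)"
proof -
  interpret prob_space "haar_unitary N" by (rule prob_space_haar_unitary)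
  show ?thesis by standard
qed

lemma measurable_haar_mult:
  assumes "f \<in> measurable M (haar_unitary N)" "g \<in> measurable M (haar_unitary N)"
  shows "(\<lambda>x. f x * g x) \<in> measurable M (haar_unitary N)"
proof -
  have "f \<in> measurable M (borel_unitary N)" "g \<in> measurable M (borel_unitary N)"
    using assms by (simp_all cong: measurable_cong_sets)
  from measurable_unitary_mult[OF this] show ?thesis by (simp cong: measurable_cong_sets)
qed

lemma measurable_haar_power_component:
  "i < k \<Longrightarrow> (\<lambda>V. V i) \<in> measurable (haar_power N k) (haar_unitary N)"
  unfolding haar_power_def by (rule measurable_component_singleton) simp

lemma measurable_twist:
  "(\<lambda>(V, W). twist n V W) \<in> measurable (haar_power N n \<Otimes>\<^sub>M haar_unitary N) (haar_power N (Suc n))"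
  unfolding haar_power_def[of N "Suc n"] twist_def case_prod_beta
proof (rule measurable_restrict)
  fix i assume "i \<in> {..<Suc n}"
  have "(\<lambda>z. fst z i * snd z) \<in> measurable (haar_power N n \<Otimes>\<^sub>M haar_unitary N) (haar_unitary N)" if "i < n"
    by (intro measurable_haar_mult measurable_snd measurable_compose[OF measurable_fst measurable_haar_power_component[OF that]])
  then show "(\<lambda>z. if i < n then fst z i * snd z else snd z) \<in> measurable (haar_power N n \<Otimes>\<^sub>M haar_unitary N) (haar_unitary N)"
    by (cases "i < n") auto
qed

text \<open>Compared on boxes, where it is right invariance of the Haar measure in each
  coordinate.\<close>

lemma haar_power_right:
  assumes W: "W \<in> unitary_group N" and f: "f \<in> borel_measurable (haar_power N n)"
  shows "(\<integral>\<^sup>+V. f (\<lambda>i\<in>{..<n}. V i * W) \<partial>haar_power N n) = (\<integral>\<^sup>+V. f V \<partial>haar_power N n)"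
proof -
  let ?H = "haar_unitary N" and ?Q = "haar_power N n"
  let ?T = "\<lambda>V. \<lambda>i\<in>{..<n}. V i * W"
  have "?T \<in> measurable ?Q (\<Pi>\<^sub>M i\<in>{..<n}. ?H)"
  proof (rule measurable_restrict)
    fix i assume "i \<in> {..<n}"
    then show "(\<lambda>V. V i * W) \<in> measurable ?Q ?H"
      by (intro measurable_haar_mult measurable_haar_power_component) (use W in auto)
  qed
  then have m: "?T \<in> measurable ?Q ?Q" by (simp add: haar_power_def)
  have "distr ?Q ?Q ?T = (\<Pi>\<^sub>M i\<in>{..<n}. ?H)"
  proof (rule product_sigma_finite.PiM_eqI[OF product_sigma_finite_haar])
    fix A assume A: "\<And>i. i \<in> {..<n} \<Longrightarrow> A i \<in> sets ?H"
    have pre: "?T -` PiE {..<n} A \<inter> space ?Q = PiE {..<n} (\<lambda>i. {U\<in>unitary_group N. U * W \<in> A i})"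
      by (auto simp: unitary_power_def PiE_def Pi_def extensional_def)
    have mW: "(\<lambda>U. U * W) \<in> measurable ?H ?H"
      by (rule measurable_haar_mult) (use W in auto)
    have A': "{U\<in>unitary_group N. U * W \<in> A i} \<in> sets ?H" if "i \<in> {..<n}" for i
    proof -
      have "(\<lambda>U. U * W) -` A i \<inter> space ?H \<in> sets ?H" by (rule measurable_sets[OF mW A[OF that]])
      moreover have "(\<lambda>U. U * W) -` A i \<inter> space ?H = {U\<in>unitary_group N. U * W \<in> A i}" by auto
      ultimately show ?thesis by simp
    qed
    have "PiE {..<n} A \<in> sets ?Q"
      unfolding haar_power_def by (rule sets_PiM_I_finite) (use A in auto)
    then have "emeasure (distr ?Q ?Q ?T) (PiE {..<n} A)
        = emeasure ?Q (PiE {..<n} (\<lambda>i. {U\<in>unitary_group N. U * W \<in> A i}))"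
      by (simp only: emeasure_distr[OF m] pre)
    also have "\<dots> = (\<Prod>i\<in>{..<n}. emeasure ?H {U\<in>unitary_group N. U * W \<in> A i})"
      unfolding haar_power_def
      by (rule product_sigma_finite.emeasure_PiM[OF product_sigma_finite_haar]) (use A' in auto)
    also have "\<dots> = (\<Prod>i\<in>{..<n}. emeasure ?H (A i))"
    proof (rule prod.cong[OF refl])
      fix i assume i: "i \<in> {..<n}"
      have "emeasure ?H {U\<in>unitary_group N. U * W \<in> A i} = (\<integral>\<^sup>+U. indicator {U\<in>unitary_group N. U * W \<in> A i} U \<partial>?H)"
        by (rule nn_integral_indicator[OF A'[OF i], symmetric])
      also have "\<dots> = (\<integral>\<^sup>+U. indicator (A i) (U * W) \<partial>?H)"
        by (rule nn_integral_cong) (auto simp: indicator_def)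
      also have "\<dots> = (\<integral>\<^sup>+U. indicator (A i) U \<partial>?H)"
        by (rule nn_integral_haar_right[OF W]) (use A[OF i] in simp)
      also have "\<dots> = emeasure ?H (A i)" by (rule nn_integral_indicator[OF A[OF i]])
      finally show "emeasure ?H {U\<in>unitary_group N. U * W \<in> A i} = emeasure ?H (A i)" .
    qed
    finally show "emeasure (distr ?Q ?Q ?T) (PiE {..<n} A) = (\<Prod>i\<in>{..<n}. emeasure ?H (A i))" .
  qed (simp_all add: haar_power_def)
  then have d: "distr ?Q ?Q ?T = ?Q" by (simp add: haar_power_def)
  have "(\<integral>\<^sup>+V. f V \<partial>distr ?Q ?Q ?T) = (\<integral>\<^sup>+V. f (?T V) \<partial>?Q)"
    by (rule nn_integral_distr[OF m]) (use f in simp)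
  then show ?thesis by (simp only: d)
qed

text \<open>After a translation of the first n coordinates by the last one and an exchange of
  integrals, the measure of S is the mean over V of the probability in W that the twisted tuple lies
  in S; on G this probability is at least 1/2.\<close>

lemma haar_power_twist:
  assumes S: "S \<in> sets (haar_power N (Suc n))" and G: "G \<in> sets (haar_power N n)"
    and half: "\<And>V. V \<in> G \<Longrightarrow> 1 / 2 \<le> measure (haar_unitary N) {W\<in>unitary_group N. twist n V W \<in> S}"
  shows "measure (haar_power N n) G / 2 \<le> measure (haar_power N (Suc n)) S"
proof -
  let ?H = "haar_unitary N" and ?Q = "haar_power N n" and ?P = "haar_power N (Suc n)"
  interpret H: prob_space ?H by (rule prob_space_haar_unitary)
  interpret Q: prob_space ?Q by (rule prob_space_haar_power)
  interpret P: prob_space ?P by (rule prob_space_haar_power)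
  interpret QH: pair_sigma_finite ?Q ?H by standard
  define h where "h V W = (indicator S (twist n V W) :: ennreal)" for V W
  have h: "case_prod h \<in> borel_measurable (?Q \<Otimes>\<^sub>M ?H)"
  proof -
    have "case_prod h = (\<lambda>z. indicator S ((\<lambda>(V, W). twist n V W) z))"
      by (auto simp: h_def fun_eq_iff)
    then show ?thesis
      using measurable_compose[OF measurable_twist borel_measurable_indicator[OF S]] by simp
  qed
  have ins: "{..<Suc n} = insert n {..<n}" by auto
  have ind: "(indicator S :: _ \<Rightarrow> ennreal) \<in> borel_measurable (PiM (insert n {..<n}) (\<lambda>_. ?H))"
    using S unfolding haar_power_def ins by simp
  have "emeasure ?P S = (\<integral>\<^sup>+x. indicator S x \<partial>?P)" by (rule nn_integral_indicator[OF S, symmetric])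
  also have "\<dots> = (\<integral>\<^sup>+W. (\<integral>\<^sup>+V. indicator S (V(n := W)) \<partial>?Q) \<partial>?H)"
    unfolding haar_power_def ins
    by (rule product_sigma_finite.product_nn_integral_insert_rev[OF product_sigma_finite_haar _ _ ind]) auto
  also have "\<dots> = (\<integral>\<^sup>+W. (\<integral>\<^sup>+V. h V W \<partial>?Q) \<partial>?H)"
  proof (rule nn_integral_cong)
    fix W assume "W \<in> space ?H"
    then have W: "W \<in> unitary_group N" by simp
    have upd: "(\<lambda>V. V(n := W)) \<in> measurable ?Q (PiM (insert n {..<n}) (\<lambda>_. ?H))"
      unfolding haar_power_def by (rule measurable_fun_upd[where J = "{..<n}"]) (use W in auto)
    \<comment> \<open>W is fixed here, so right invariance allows V to be replaced by V W.\<close>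
    have "(\<integral>\<^sup>+V. indicator S ((\<lambda>i\<in>{..<n}. V i * W)(n := W)) \<partial>?Q) = (\<integral>\<^sup>+V. indicator S (V(n := W)) \<partial>?Q)"
      by (rule haar_power_right[OF W, of "\<lambda>V. indicator S (V(n := W))"]) (rule measurable_compose[OF upd ind])
    moreover have "(\<lambda>i\<in>{..<n}. V i * W)(n := W) = twist n V W" for V
      by (auto simp: twist_def fun_eq_iff)
    ultimately show "(\<integral>\<^sup>+V. indicator S (V(n := W)) \<partial>?Q) = (\<integral>\<^sup>+V. h V W \<partial>?Q)" by (simp add: h_def)
  qed
  also have "\<dots> = (\<integral>\<^sup>+V. (\<integral>\<^sup>+W. h V W \<partial>?H) \<partial>?Q)" by (rule QH.Fubini'[OF h])
  also have "\<dots> \<ge> (\<integral>\<^sup>+V. ennreal (1 / 2) * indicator G V \<partial>?Q)"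
  proof (rule nn_integral_mono)
    fix V assume V: "V \<in> space ?Q"
    show "ennreal (1 / 2) * indicator G V \<le> (\<integral>\<^sup>+W. h V W \<partial>?H)"
    proof (cases "V \<in> G")
      case True
      have "(\<lambda>W. (V, W)) \<in> measurable ?H (?Q \<Otimes>\<^sub>M ?H)" using V by (rule measurable_Pair1')
      from measurable_sets[OF measurable_compose[OF this measurable_twist] S]
      have "(\<lambda>W. twist n V W) -` S \<inter> space ?H \<in> sets ?H" by simp
      moreover have "(\<lambda>W. twist n V W) -` S \<inter> space ?H = {W\<in>unitary_group N. twist n V W \<in> S}" by auto
      ultimately have s: "{W\<in>unitary_group N. twist n V W \<in> S} \<in> sets ?H" by simp
      have "(\<integral>\<^sup>+W. h V W \<partial>?H) = (\<integral>\<^sup>+W. indicator {W\<in>unitary_group N. twist n V W \<in> S} W \<partial>?H)"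
        by (rule nn_integral_cong) (auto simp: h_def indicator_def)
      also have "\<dots> = ennreal (measure ?H {W\<in>unitary_group N. twist n V W \<in> S})"
        unfolding nn_integral_indicator[OF s] by (rule H.emeasure_eq_measure)
      finally have "ennreal (1 / 2) \<le> (\<integral>\<^sup>+W. h V W \<partial>?H)" using ennreal_leI[OF half[OF True]] by (simp only:)
      then show ?thesis using True by (simp only: indicator_simps mult_1_right)
    qed simp
  qed
  also have "(\<integral>\<^sup>+V. ennreal (1 / 2) * indicator G V \<partial>?Q) = ennreal (1 / 2) * emeasure ?Q G"
    by (rule nn_integral_cmult_indicator[OF G])
  finally have "ennreal (1 / 2) * ennreal (measure ?Q G) \<le> ennreal (measure ?P S)"
    by (simp add: Q.emeasure_eq_measure P.emeasure_eq_measure)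
  then have "ennreal (1 / 2 * measure ?Q G) \<le> ennreal (measure ?P S)"
    by (subst ennreal_mult) auto
  then show ?thesis by (subst (asm) ennreal_le_iff) auto
qed

lemma log_ext_half: "0 \<le> p \<Longrightarrow> log_ext p \<le> log_ext (p / 2) + ereal (ln 2)"
  by (auto simp: log_ext_def ln_div)

lemma limsup_le_of_bounded_diff:
  fixes f g :: "nat \<Rightarrow> ereal"
  assumes "\<forall>\<^sub>F N in sequentially. f N \<le> g N + ereal c"
  shows "limsup (\<lambda>N. f N / ereal (real (N ^ 2))) \<le> limsup (\<lambda>N. g N / ereal (real (N ^ 2)))"
proof -
  have "limsup (\<lambda>N. f N / ereal (real (N ^ 2))) \<le> limsup (\<lambda>N. g N / ereal (real (N ^ 2)) + ereal (c / real (N ^ 2)))"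
  proof (rule Limsup_mono)
    show "\<forall>\<^sub>F N in sequentially. f N / ereal (real (N ^ 2)) \<le> g N / ereal (real (N ^ 2)) + ereal (c / real (N ^ 2))"
      using assms eventually_gt_at_top[of 0]
    proof eventually_elim
      case (elim N)
      have "f N / ereal (real (N ^ 2)) \<le> (g N + ereal c) / ereal (real (N ^ 2))"
        using elim by (intro ereal_divide_right_mono) auto
      also have "\<dots> = g N / ereal (real (N ^ 2)) + ereal (c / real (N ^ 2))"
        using elim by (cases "g N") (auto simp: add_divide_distrib)
      finally show ?case .
    qed
  qed
  also have "\<dots> \<le> limsup (\<lambda>N. g N / ereal (real (N ^ 2))) + limsup (\<lambda>N. ereal (c / real (N ^ 2)))"
    by (rule ereal_limsup_add_mono)
  also have "limsup (\<lambda>N. ereal (c / real (N ^ 2))) = 0"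
  proof (rule lim_imp_Limsup)
    have "filterlim (\<lambda>N. real N ^ 2) at_top sequentially"
      by (rule filterlim_pow_at_top[OF _ filterlim_real_sequentially]) simp
    then have "(\<lambda>N. c / real N ^ 2) \<longlonglongrightarrow> 0"
      by (intro tendsto_divide_0[OF tendsto_const] filterlim_at_top_imp_at_infinity)
    then show "(\<lambda>N. ereal (c / real (N ^ 2))) \<longlonglongrightarrow> 0" by (simp add: zero_ereal_def)
  qed simp
  finally show ?thesis by simp
qed

lemma nth_in_set_zip: "j < length xs \<Longrightarrow> length ys = length xs \<Longrightarrow> (xs ! j, ys ! j) \<in> set (zip xs ys)"
  by (auto simp: set_zip)

lemma set_zip_append:
  "length xs = length ys \<Longrightarrow> set (zip (xs @ xs') (ys @ ys')) = set (zip xs ys) \<union> set (zip xs' ys')"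
  by simp

definition conj_tuples :: "'h::complex_hilbert_space op list \<Rightarrow> 'h op list \<Rightarrow> 'h op list list" where
  "conj_tuples Xs vs = map (\<lambda>i. op_conj (vs ! i) Xs) [0..<length vs] @ [Xs]"

lemma conj_tuples_simps:
  "length (conj_tuples Xs vs) = Suc (length vs)"
  "i < length vs \<Longrightarrow> conj_tuples Xs vs ! i = op_conj (vs ! i) Xs"
  "conj_tuples Xs vs ! length vs = Xs"
  "i \<le> length vs \<Longrightarrow> length (conj_tuples Xs vs ! i) = length Xs"
  by (auto simp: conj_tuples_def nth_append op_conj_def)

context
  fixes M :: "'h::complex_hilbert_space op set" and \<tau> :: "'h op \<Rightarrow> complex" and Xs vs :: "'h op list"
  assumes vN: "von_neumann_algebra M" and st: "state_on M \<tau>" and tr: "tracial_on M \<tau>"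
    and Xs: "set Xs \<subseteq> self_adjoints M" and vs: "set vs \<subseteq> unitaries M"
    and fda: "has_fda \<tau> Xs" and free: "freely_independent \<tau> Xs vs"
begin

lemma Xs_M: "set Xs \<subseteq> M" and vs_M: "set vs \<subseteq> M"
  using Xs vs by (auto simp: self_adjoints_def unitaries_def)

text \<open>With \<open>U = (V\<^sub>i W, \<dots>, W)\<close> the conjugates \<open>U\<^sub>i A U\<^sub>i\<^sup>*\<close> are words of length three in
  \<open>V\<close> and \<open>W A W\<^sup>*\<close>.\<close>

lemma moments_close_twist:
  assumes As: "length As = length Xs" "set As \<subseteq> sa_mats N"
    and V: "V \<in> unitary_power N (length vs)" and W: "W \<in> unitary_group N"
    and mc: "moments_close \<tau> (Xs @ vs) N (3 * m) \<delta> (conj_list W As @ map V [0..<length vs])"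
    and tup: "replicate (Suc (length vs)) As \<in> mat_tuples (conj_tuples Xs vs) S"
  shows "moments_close \<tau> (concat (conj_tuples Xs vs) @ vs) N m \<delta>
    (orbit_tuple (twist (length vs) V W) (replicate (Suc (length vs)) As) @ map V [0..<length vs])"
proof (rule moments_close_subst[OF _ _ _ mc])
  let ?n = "length vs" and ?r = "length Xs"
  let ?Ys = "conj_tuples Xs vs" and ?Bs = "replicate (Suc ?n) As" and ?U = "twist ?n V W"
  let ?Zs = "Xs @ vs" and ?Cs = "conj_list W As @ map V [0..<?n]"
  have Vi: "V i \<in> unitary_group N" if "i < ?n" for i using V that by (auto simp: unitary_power_def)
  have carV: "V i \<in> carrier_mat N N" if "i < ?n" for i using Vi[OF that] by (rule unitary_group_carrier)
  have carW: "W \<in> carrier_mat N N" by (rule unitary_group_carrier[OF W])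
  have carA: "As ! l \<in> carrier_mat N N" and adjA: "mat_adjoint (As ! l) = As ! l" if "l < ?r" for l
    using As(1) that subsetD[OF As(2), OF nth_mem[of l As]] by (simp_all add: sa_mats_def)
  show carC: "set ?Cs \<subseteq> carrier_mat N N"
  proof -
    have "W * A * mat_adjoint W \<in> carrier_mat N N" if "A \<in> set As" for A
      using that As(2) carW by (auto simp: sa_mats_def)
    then show ?thesis using carV by (auto simp: conj_list_def)
  qed
  show "length ?Cs = length ?Zs" using As by simp
  have lenorb: "length (orbit_tuple ?U ?Bs) = length (concat ?Ys)" by (rule set_zip_orbit(2)[OF tup])
  fix j b assume j: "j < length (concat ?Ys @ vs)"
  define y where "y = (concat ?Ys @ vs) ! j"
  define C where "C = (orbit_tuple ?U ?Bs @ map V [0..<?n]) ! j"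
  have "(y, C) \<in> set (zip (concat ?Ys @ vs) (orbit_tuple ?U ?Bs @ map V [0..<?n]))"
    unfolding y_def C_def by (rule nth_in_set_zip[OF j]) (simp add: lenorb del: replicate_Suc)
  then have yC: "(y, C) \<in> set (zip (concat ?Ys) (orbit_tuple ?U ?Bs)) \<union> set (zip vs (map V [0..<?n]))"
    by (simp only: set_zip_append[OF lenorb[symmetric]])
  define Q where "Q u \<longleftrightarrow> length u \<le> 3 \<and> (\<forall>(i, c)\<in>set u. i < length ?Zs) \<and>
      op_eval ?Zs u = (if b then op_adj y else y) \<and> mat_eval N ?Cs u = (if b then mat_adjoint C else C)" for u
  have opc: "T \<in> clinear_ops" if "T \<in> M" for T by (rule von_neumann_algebra_closed(6)[OF vN that])
  \<comment> \<open>The letters are of three kinds: conjugates of X by some v_i, X itself in the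
    last block, and the unitaries.\<close>
  consider i l where "i < ?n" "l < ?r" "y = vs ! i o\<^sub>L Xs ! l o\<^sub>L op_adj (vs ! i)" "C = V i * W * (As ! l) * mat_adjoint (V i * W)"
    | l where "l < ?r" "y = Xs ! l" "C = W * (As ! l) * mat_adjoint W"
    | i where "i < ?n" "y = vs ! i" "C = V i"
  proof -
    from yC consider "(y, C) \<in> set (zip (concat ?Ys) (orbit_tuple ?U ?Bs))" | "(y, C) \<in> set (zip vs (map V [0..<?n]))" by blast
    then show thesis
    proof cases
      case 1
      then obtain i l where il: "i < length ?Ys" "l < length (?Ys ! i)" "y = ?Ys ! i ! l"
        "C = ?U i * (?Bs ! i ! l) * mat_adjoint (?U i)"
        unfolding set_zip_orbit(1)[OF tup] by blast
      have i: "i < Suc ?n" and l: "l < ?r" using il conj_tuples_simps(1)[of Xs vs] conj_tuples_simps(4)[of i vs Xs] by auto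
      have B: "?Bs ! i ! l = As ! l" using i by (simp only: nth_replicate)
      show thesis
      proof (cases "i < ?n")
        case True
        have "y = vs ! i o\<^sub>L Xs ! l o\<^sub>L op_adj (vs ! i)"
          using il(3) True l by (simp add: conj_tuples_simps op_conj_def)
        moreover have "C = V i * W * (As ! l) * mat_adjoint (V i * W)"
          using il(4) True unfolding B by (simp add: twist_def)
        ultimately show thesis by (rule that(1)[OF True l])
      next
        case False
        then have "i = ?n" using i by simp
        then have "y = Xs ! l" "C = W * (As ! l) * mat_adjoint W"
          using il(3,4) unfolding B by (simp_all add: conj_tuples_simps twist_def)
        then show thesis by (rule that(2)[OF l])
      qed
    next
      case 2
      then obtain i where "i < ?n" "y = vs ! i" "C = V i" by (auto simp: set_zip)
      then show thesis by (rule that(3))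
    qed
  qed
  then have "\<exists>u. Q u"
  proof cases
    case (1 i l)
    have v: "vs ! i \<in> M" and x: "Xs ! l \<in> M" "op_adj (Xs ! l) = Xs ! l"
      using vs_M Xs nth_mem[OF 1(1)] nth_mem[OF 1(2)] by (auto simp: self_adjoints_def)
    note cl = opc[OF v] opc[OF x(1)] opc[OF von_neumann_algebra_closed(5)[OF vN v]]
    \<comment> \<open>Operator and model are both self-adjoint, so one word serves the letter and
      its starred version.\<close>
    have adjy: "op_adj y = y"
      unfolding 1(3) using cl
      by (simp add: op_adj_compose clinear_ops_compose op_adj_op_adj x(2) blinfun_compose_assoc)
    have adjC: "mat_adjoint C = C"
      unfolding 1(4) using carV[OF 1(1)] carW carA[OF 1(2)] adjA[OF 1(2)]
      by (subst adjoint_conj[of _ N]) simp_all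
    define u where "u = [(?r + i, False), (l, False), (?r + i, True)]"
    have "op_eval ?Zs u = y" using 1 by (simp add: u_def nth_append blinfun_compose_assoc)
    moreover have "mat_eval N ?Cs u = C"
    proof -
      have "mat_eval N ?Cs u = V i * ((W * As ! l * mat_adjoint W) * (mat_adjoint (V i) * 1\<^sub>m N))"
        using 1 As by (simp add: u_def nth_append conj_list_def)
      also have "\<dots> = C"
        unfolding 1(4) using carV[OF 1(1)] carW carA[OF 1(2)]
        by (simp add: mat_adjoint_mult[of _ N N _ N] assoc_mult_mat[of _ N N _ N _ N] right_mult_one_mat[of _ N N])
      finally show ?thesis .
    qed
    ultimately have "Q u" using 1 adjy adjC by (auto simp: Q_def u_def)
    then show ?thesis ..
  next
    case (2 l)
    have "mat_eval N ?Cs [(l, b)] = (if b then mat_adjoint C else C)"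
      using 2 As carW carA[OF 2(1)] by (simp add: nth_append conj_list_def right_mult_one_mat[of _ N N])
    then have "Q [(l, b)]" using 2 by (simp add: Q_def nth_append)
    then show ?thesis ..
  next
    case (3 i)
    have "mat_eval N ?Cs [(?r + i, b)] = (if b then mat_adjoint C else C)"
      using 3 As carV[OF 3(1)] by (simp add: nth_append right_mult_one_mat[of _ N N])
    then have "Q [(?r + i, b)]" using 3 by (simp add: Q_def nth_append)
    then show ?thesis ..
  qed
  then show "\<exists>u. length u \<le> 3 \<and> (\<forall>(i, c)\<in>set u. i < length ?Zs) \<and>
      op_eval ?Zs u = (if b then op_adj ((concat ?Ys @ vs) ! j) else (concat ?Ys @ vs) ! j) \<and>
      mat_eval N ?Cs u = (if b then mat_adjoint ((orbit_tuple ?U ?Bs @ map V [0..<?n]) ! j)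
        else (orbit_tuple ?U ?Bs @ map V [0..<?n]) ! j)"
    unfolding Q_def y_def C_def .
qed

lemma chi_u_le_chi_orb_pres: "chi_u \<tau> vs \<le> chi_orb_pres \<tau> (conj_tuples Xs vs) vs"
proof -
  let ?n = "length vs" and ?Ys = "conj_tuples Xs vs"
  \<comment> \<open>Strictly above all the norms, as \<open>has_fda\<close> demands, and positive
    even if \<open>Xs\<close> is empty.\<close>
  define R where "R = 1 + (\<Sum>T\<in>set Xs. norm T)"
  have R: "norm T < R" if "T \<in> set Xs" for T
    using member_le_sum[of T "set Xs" norm] that by (simp add: R_def)
  have R0: "R > 0" using sum_nonneg[of "set Xs" norm] unfolding R_def by (simp add: add_pos_nonneg)
  have "chi_u \<tau> vs \<le> chi_orb_pres_R R \<tau> ?Ys vs"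
    unfolding chi_u_def chi_orb_pres_R_def
  proof (rule entropy_limit_mono)
    fix m and \<delta> :: real assume \<delta>: "\<delta> > 0"
    \<comment> \<open>Degree 3 m pays for the substitution in
      \<open>moments_close_twist\<close>.\<close>
    obtain m' \<delta>' N0 where \<delta>': "\<delta>' > 0" and unif:
      "\<forall>N As Vs. N \<ge> N0 \<and> As \<in> Gamma_R R \<tau> Xs N m' \<delta>' \<and> length Vs = length vs \<and>
        set Vs \<subseteq> unitary_group N \<and> moments_close \<tau> vs N m' \<delta>' Vs \<longrightarrow>
        measure (haar_unitary N) {W\<in>unitary_group N. moments_close \<tau> (Xs @ vs) N (3 * m) \<delta> (conj_list W As @ Vs)} \<ge> 1 / 2"
      using uniform_asymptotic_freeness[OF vN st tr Xs_M vs_M free \<delta>, of R "3 * m"] by blast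
    have "\<forall>\<^sub>F N in sequentially. Gamma_R R \<tau> Xs N m' \<delta>' \<noteq> {}"
      using fda R \<delta>' by (simp add: has_fda_def)
    then have "\<forall>\<^sub>F N in sequentially. log_ext (measure (haar_power N ?n) (Gamma_u \<tau> vs N m' \<delta>'))
        \<le> chibar_orb_pres_R R \<tau> ?Ys vs N m \<delta> + ereal (ln 2)"
      using eventually_ge_at_top[of N0]
    proof eventually_elim
      case (elim N)
      then obtain As where As: "As \<in> Gamma_R R \<tau> Xs N m' \<delta>'" by blast
      then have lenA: "length As = length Xs" and setA: "set As \<subseteq> sa_mats_bounded N R" by (simp_all add: Gamma_R_def)
      \<comment> \<open>One model of all of X serves in each of the n + 1 blocks; only the unitaries
        tell the blocks apart.\<close>
      let ?Bs = "replicate (Suc ?n) As"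
      have tup: "?Bs \<in> mat_tuples ?Ys (sa_mats_bounded N R)"
      proof -
        have "map length ?Bs = map length ?Ys"
          by (rule nth_equalityI) (auto simp: conj_tuples_simps lenA simp del: replicate_Suc)
        then show ?thesis using setA by (auto simp: mat_tuples_def)
      qed
      let ?S = "Gamma_orb_pres \<tau> ?Ys ?Bs vs N m \<delta>" and ?G = "Gamma_u \<tau> vs N m' \<delta>'"
      have S: "?S \<in> sets (haar_power N (Suc ?n))"
        using sets_Gamma_orb_pres[OF tup] by (simp add: conj_tuples_simps)
      have "measure (haar_power N ?n) ?G / 2 \<le> measure (haar_power N (Suc ?n)) ?S"
      proof (rule haar_power_twist[OF S sets_Gamma_u])
        fix V assume V: "V \<in> ?G"
        then have Vp: "V \<in> unitary_power N ?n" and mc: "moments_close \<tau> vs N m' \<delta>' (map V [0..<?n])"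
          unfolding Gamma_u_def by blast+
        have setV: "set (map V [0..<?n]) \<subseteq> unitary_group N"
        proof
          fix U assume "U \<in> set (map V [0..<?n])"
          then obtain i where "i < ?n" "U = V i" by auto
          then show "U \<in> unitary_group N" using PiE_mem[OF Vp[unfolded unitary_power_def], of i] by simp
        qed
        have tw: "twist ?n V W \<in> unitary_power N (Suc ?n)" if "W \<in> unitary_group N" for W
          unfolding unitary_power_def twist_def
        proof (rule restrict_PiE[THEN iffD2], rule Pi_I)
          fix i
          show "(if i < ?n then V i * W else W) \<in> unitary_group N"
            using that PiE_mem[OF Vp[unfolded unitary_power_def], of i]
            by (cases "i < ?n") (simp_all add: mult_unitary_group)
        qed
        have "{W\<in>unitary_group N. moments_close \<tau> (Xs @ vs) N (3 * m) \<delta> (conj_list W As @ map V [0..<?n])}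
            \<subseteq> {W\<in>unitary_group N. twist ?n V W \<in> ?S}"
        proof
          fix W assume "W \<in> {W\<in>unitary_group N. moments_close \<tau> (Xs @ vs) N (3 * m) \<delta> (conj_list W As @ map V [0..<?n])}"
          then have W: "W \<in> unitary_group N" and mcW: "moments_close \<tau> (Xs @ vs) N (3 * m) \<delta> (conj_list W As @ map V [0..<?n])"
            by auto
          have "set As \<subseteq> sa_mats N" using setA by (auto simp: sa_mats_bounded_def)
          note mcl = moments_close_twist[OF lenA this Vp W mcW tup]
          have "twist ?n V W \<in> ?S"
            unfolding Gamma_orb_pres_def conj_tuples_simps(1)
            by (rule CollectI, rule conjI[OF tw[OF W]], rule exI[of _ "map V [0..<?n]"], intro conjI setV mcl) simp
          then show "W \<in> {W\<in>unitary_group N. twist ?n V W \<in> ?S}" using W by simp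
        qed
        moreover have "{W\<in>unitary_group N. twist ?n V W \<in> ?S} \<in> sets (haar_unitary N)"
        proof -
          have "(\<lambda>W. (V, W)) \<in> measurable (haar_unitary N) (haar_power N ?n \<Otimes>\<^sub>M haar_unitary N)"
            by (rule measurable_Pair1') (use Vp in simp)
          from measurable_sets[OF measurable_compose[OF this measurable_twist] S]
          have "(\<lambda>W. twist ?n V W) -` ?S \<inter> unitary_group N \<in> sets (haar_unitary N)" by simp
          moreover have "(\<lambda>W. twist ?n V W) -` ?S \<inter> unitary_group N = {W\<in>unitary_group N. twist ?n V W \<in> ?S}" by auto
          ultimately show ?thesis by simp
        qed
        moreover have "1 / 2 \<le> measure (haar_unitary N) {W\<in>unitary_group N. moments_close \<tau> (Xs @ vs) N (3 * m) \<delta> (conj_list W As @ map V [0..<?n])}"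
          using unif elim(2) As setV mc by (simp del: set_map)
        ultimately show "1 / 2 \<le> measure (haar_unitary N) {W\<in>unitary_group N. twist ?n V W \<in> ?S}"
          by (meson order_trans finite_measure.finite_measure_mono prob_space_def prob_space_haar_unitary)
      qed
      then have "log_ext (measure (haar_power N ?n) ?G / 2) \<le> log_ext (measure (haar_power N (Suc ?n)) ?S)"
        by (intro log_ext_mono) auto
      also have "\<dots> \<le> chibar_orb_pres_R R \<tau> ?Ys vs N m \<delta>"
        unfolding chibar_orb_pres_R_def conj_tuples_simps(1) by (rule SUP_upper[OF tup])
      finally have "log_ext (measure (haar_power N ?n) ?G / 2) + ereal (ln 2) \<le> chibar_orb_pres_R R \<tau> ?Ys vs N m \<delta> + ereal (ln 2)"
        by (rule add_right_mono)
      then show ?case using log_ext_half[OF measure_nonneg] order_trans by blast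
    qed
    from limsup_le_of_bounded_diff[OF this] show "\<exists>m' \<delta>'. \<delta>' > 0 \<and>
        limsup (\<lambda>N. log_ext (measure (haar_power N ?n) (Gamma_u \<tau> vs N m' \<delta>')) / ereal (real (N ^ 2)))
        \<le> limsup (\<lambda>N. chibar_orb_pres_R R \<tau> ?Ys vs N m \<delta> / ereal (real (N ^ 2)))"
      using \<delta>' by blast
  qed (simp_all add: Gamma_u_antimono chibar_orb_pres_R_antimono)
  also have "\<dots> \<le> chi_orb_pres \<tau> ?Ys vs"
    unfolding chi_orb_pres_def by (rule SUP_upper) (use R0 in simp)
  finally show ?thesis .
qed

end

lemma nth_concat_offset:
  "i < length X \<Longrightarrow> l < length (X ! i) \<Longrightarrow>
    (\<Sum>k<i. length (X ! k)) + l < length (concat X) \<and> concat X ! ((\<Sum>k<i. length (X ! k)) + l) = X ! i ! l"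
proof -
  assume i: "i < length X" and l: "l < length (X ! i)"
  have "concat X = concat (take i X) @ X ! i @ concat (drop (Suc i) X)"
    by (subst id_take_nth_drop[OF i]) simp
  moreover have "length (concat (take i X)) = (\<Sum>k<i. length (X ! k))"
    unfolding length_concat_sum using i by (intro sum.cong) auto
  ultimately show ?thesis using l by (simp add: nth_append)
qed

theorem theorem3p1:
  fixes M :: "'h::complex_hilbert_space op set"
    and \<tau> :: "'h op \<Rightarrow> complex"
    and X :: "'h op list list"
    and v :: "'h op list"
    and n :: nat
  assumes "tracial_W_prob_space M \<tau>"
    and "length X = n + 1"
    and "\<forall>Xi\<in>set X. set Xi \<subseteq> self_adjoints M"
    and "length v = n"
    and "set v \<subseteq> unitaries M"
    and "has_fda \<tau> (concat X)"
    and "freely_independent \<tau> (concat X) v"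
  shows "chi_orb \<tau> (map (\<lambda>i. op_conj (v ! i) (X ! i)) [0..<n] @ [X ! n])
           \<ge> chi_orb_pres \<tau> (map (\<lambda>i. op_conj (v ! i) (X ! i)) [0..<n] @ [X ! n]) v
       \<and> chi_orb_pres \<tau> (map (\<lambda>i. op_conj (v ! i) (X ! i)) [0..<n] @ [X ! n]) v
           \<ge> chi_orb_pres \<tau> (map (\<lambda>i. op_conj (v ! i) (concat X)) [0..<n] @ [concat X]) v
       \<and> chi_orb_pres \<tau> (map (\<lambda>i. op_conj (v ! i) (concat X)) [0..<n] @ [concat X]) v
           \<ge> chi_u \<tau> v"
proof (intro conjI)
  let ?Ys = "map (\<lambda>i. op_conj (v ! i) (X ! i)) [0..<n] @ [X ! n]"
  let ?Zs = "map (\<lambda>i. op_conj (v ! i) (concat X)) [0..<n] @ [concat X]"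
  show "chi_orb_pres \<tau> ?Ys v \<le> chi_orb \<tau> ?Ys" by (rule chi_orb_pres_le_chi_orb)
  \<comment> \<open>The position in \<open>concat X\<close> of entry l of block i.\<close>
  define g where "g i l = (\<Sum>k<i. length (X ! k)) + l" for i l
  show "chi_orb_pres \<tau> ?Zs v \<le> chi_orb_pres \<tau> ?Ys v"
  proof (rule chi_orb_pres_subtuples[where g = g])
    fix i l assume i: "i < length ?Ys" and l: "l < length (?Ys ! i)"
    have "i < length X" "l < length (X ! i)"
      using i l assms(2) by (auto simp: nth_append op_conj_def less_Suc_eq split: if_splits)
    from nth_concat_offset[OF this] show "g i l < length (?Zs ! i) \<and> ?Zs ! i ! g i l = ?Ys ! i ! l"
      using i l by (auto simp: g_def nth_append op_conj_def less_Suc_eq split: if_splits)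
  qed simp
  have "von_neumann_algebra M" "state_on M \<tau>" "tracial_on M \<tau>"
    using assms(1) by (auto simp: tracial_W_prob_space_def finite_von_neumann_algebra_def)
  moreover have "set (concat X) \<subseteq> self_adjoints M" using assms(3) by auto
  ultimately have "chi_u \<tau> v \<le> chi_orb_pres \<tau> (conj_tuples (concat X) v) v"
    using assms(5-7) by (rule chi_u_le_chi_orb_pres)
  then show "chi_u \<tau> v \<le> chi_orb_pres \<tau> ?Zs v" by (simp add: conj_tuples_def assms(4))
qed

end
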